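(* Let $F$ be a fatgraph with underlying graph $G$, and let $\mathcal C(F)$ be its chromatic chain complex. Then the Euler characteristic of the homology $H(\mathcal C(F))$ equals $Z(F,q)=(q+q^{-1})^{e(F)}M(G,(q+q^{-1})^2)$. Moreover, the homology $H(\mathcal C(F))$ is an invariant of fatgraphs and is a strictly stronger invariant than the chromatic polynomial $M(G,\cdot)$.
   Context: Fatgraphs: a fatgraph is a finite graph (loops and multiple edges allowed) with a cyclic order of the half-edges at each vertex; it determines a compact orientable surface with boundary (vertices thickened to discs, edges to untwisted bands). For a fatgraph $H$ let $v(H),e(H),k(H)$ be its numbers of vertices, edges, components, $p(H)$ the number of boundary components of its surface and $g(H)$ its genus. A state of $F$ is a spanning fatsubgraph $H=(V(F),W)$, $W\subseteq E(F)$, with inherited cyclic orders; its height is $h(H)=e(F)-e(H)$. The chromatic polynomial of a graph $G=(V,E)$ is $M(G,u)=\sum_{W\subseteq E}(-1)^{|W|}u^{k(V,W)}$. Graded modules and homology: for a graded $\mathbb Z$-module $M$, $\operatorname{qdim}(M)=\sum_i q^i\operatorname{rk}(M_i)$ and $M\{l\}_m=M_{m-l}$. For a cochain complex of graded modules with homology $H=(H^i)$, the Poincaré polynomial is $P(H)=\sum_i t^i\operatorname{qdim}(H^i)$ and the Euler characteristic is $P(H)|_{t=-1}$. Height shift: $(\mathcal C[s])^i=\mathcal C^{i-s}$. Chromatic complex: $V$ is free on $v_\pm$ in degrees $\pm1$, $R$ free on $x_{-2},x_0$ in degrees $-2,0$. Maps: $\widetilde m':V\otimes V\to V$, $v_+\otimes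 v_+\mapsto v_+$, $v_\pm\otimes v_\mp\mapsto v_-$, $v_-\otimes v_-\mapsto0$; $\widetilde\Delta':V\to V\otimes V$, $v_+\mapsto v_+\otimes v_-+v_-\otimes v_+$, $v_-\mapsto v_-\otimes v_-$; $\widehat m_g:V^{\otimes2g}\to V^{\otimes 2(g-1)}$ sends a basis tensor to the sum of all basis tensors of the same degree; $\overline\Delta_h:R^{\otimes h}\to R^{\otimes(h+1)}$ is $1\mapsto x_0$ for $h=0$ and, for $h\ge1$, acts on the last factor by $x_0\mapsto x_0\otimes x_0$, $x_{-2}\mapsto x_{-2}\otimes x_0+x_0\otimes x_{-2}$. Each state $H$ gets $A(H)=V^{\otimes v(H)}\otimes V^{\otimes p(H)}\otimes V^{\otimes2g(H)}\otimes R^{\otimes h(H)}\{h(H)\}$ (factors of $V^{\otimes p(H)}$ indexed by boundary components of $H$). Number edges $1,\dots,n$, encode states by $\alpha\in\{0,1\}^n$ ($\alpha_i=0$ iff edge $i$ present). For edge $j$ in $H$, $H'=H-e_j$ either merges two boundary components or splits one, and $g(H')\in\{g(H),g(H)-1\}$; the per-edge map $A(H)\to A(H')$ is $(-1)^{\sum_{i<j}\alpha_i}$ times the tensor of the identity on $V^{\otimes v}$, $\widetilde m'$ (merge) or $\widetilde\Delta'$ (split) on the affected boundary factors and identity on the others, identity or $\widehat m_g$ on $V^{\otimes 2g}$ according as the genus is unchanged or drops, and $\overline\Delta_{h(H)}$ on $R^{\otimes h(H)}$. Then $\widetilde{\mathcal C}^h(F)=\bigoplus_{h(H)=h}A(H)$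 with differential the sum of per-edge maps, and $\mathcal C(F)=\widetilde{\mathcal C}(F)[-e(F)]$. *)

theory Defs
  imports
    "HOL-Algebra.Free_Abelian_Groups"
    "HOL-Combinatorics.Orbits"
    "HOL-Computational_Algebra.Polynomial"
begin

section \<open>Multigraphs and the chromatic polynomial\<close>

record ('v, 'e) multigraph =
  mverts :: "'v set"
  medges :: "'e set"
  mends :: "'e \<Rightarrow> 'v set"  \<comment> \<open>a singleton for a loop\<close>

definition num_components :: "'v set \<Rightarrow> 'e set \<Rightarrow> ('e \<Rightarrow> 'v set) \<Rightarrow> nat" where
  "num_components V W ends =
     card (V // ({(u, v). u \<in> V \<and> v \<in> V \<and> (\<exists>e\<in>W. ends e = {u, v})}\<^sup>* \<inter> V \<times> V))"

definition chromatic_polynomial :: "('v, 'e) multigraph \<Rightarrow> int poly" where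
  "chromatic_polynomial G =
     (\<Sum>W\<in>Pow (medges G). monom ((-1) ^ card W) (num_components (mverts G) W (mends G)))"


section \<open>Fatgraphs\<close>

text \<open>Half-edges carry their vertex, the successor in the cyclic order at that vertex, and the
  other half of the same edge. Vertices are kept separately so that isolated ones are allowed.\<close>

record ('v, 'h) fatgraph =
  verts :: "'v set"
  halves :: "'h set"
  vert :: "'h \<Rightarrow> 'v"
  nxt :: "'h \<Rightarrow> 'h"
  opp :: "'h \<Rightarrow> 'h"

text \<open>The orbit condition says that \<^term>\<open>nxt F\<close> permutes the half-edges at each vertex in a
  single cycle.\<close>

locale fatgraph =
  fixes F :: "('v, 'h) fatgraph"
  assumes finite_verts: "finite (verts F)"
    and finite_halves: "finite (halves F)"
    and vert_in: "h \<in> halves F \<Longrightarrow> vert F h \<in> verts F"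
    and nxt_orbit: "h \<in> halves F \<Longrightarrow> orbit (nxt F) h = {h' \<in> halves F. vert F h' = vert F h}"
    and opp_in: "h \<in> halves F \<Longrightarrow> opp F h \<in> halves F"
    and opp_opp: "h \<in> halves F \<Longrightarrow> opp F (opp F h) = h"
    and opp_neq: "h \<in> halves F \<Longrightarrow> opp F h \<noteq> h"

definition edges :: "('v, 'h) fatgraph \<Rightarrow> 'h set set" where
  "edges F = {{h, opp F h} | h. h \<in> halves F}"

definition underlying_graph :: "('v, 'h) fatgraph \<Rightarrow> ('v, 'h set) multigraph" where
  "underlying_graph F = \<lparr>mverts = verts F, medges = edges F, mends = (\<lambda>e. vert F ` e)\<rparr>"

definition fatgraph_isomorphic :: "('v, 'h) fatgraph \<Rightarrow> ('w, 'k) fatgraph \<Rightarrow> bool" where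
  "fatgraph_isomorphic F F' \<longleftrightarrow>
     (\<exists>f g. bij_betw f (verts F) (verts F') \<and> bij_betw g (halves F) (halves F') \<and>
        (\<forall>h\<in>halves F. vert F' (g h) = f (vert F h) \<and> nxt F' (g h) = g (nxt F h) \<and>
           opp F' (g h) = g (opp F h)))"

definition spanning_subgraph :: "('v, 'h) fatgraph \<Rightarrow> 'h set set \<Rightarrow> ('v, 'h) fatgraph" where
  "spanning_subgraph F W =
     F\<lparr>halves := \<Union>W, nxt := (\<lambda>h. (nxt F ^^ (LEAST n. n > 0 \<and> (nxt F ^^ n) h \<in> \<Union>W)) h)\<rparr>"

definition v_num :: "('v, 'h) fatgraph \<Rightarrow> nat" where
  "v_num F = card (verts F)"

definition e_num :: "('v, 'h) fatgraph \<Rightarrow> nat" where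
  "e_num F = card (edges F)"

definition k_num :: "('v, 'h) fatgraph \<Rightarrow> nat" where
  "k_num F = num_components (verts F) (edges F) (\<lambda>e. vert F ` e)"

text \<open>Starting along the half-edge \<^term>\<open>h\<close>, the boundary of the surface runs past the edge to its
  other end and leaves along the next half-edge there. An isolated vertex is a disc, whose boundary
  passes no half-edge.\<close>

datatype ('v, 'h) boundary = Isolated 'v | Cycle "'h set"

definition boundaries :: "('v, 'h) fatgraph \<Rightarrow> ('v, 'h) boundary set" where
  "boundaries F =
     Isolated ` (verts F - vert F ` halves F) \<union> (\<lambda>h. Cycle (orbit (nxt F \<circ> opp F) h)) ` halves F"

definition p_num :: "('v, 'h) fatgraph \<Rightarrow> nat" where
  "p_num F = card (boundaries F)"

text \<open>The surface has Euler characteristic \<open>v - e = 2 k - 2 g - p\<close>. Here \<open>g\<close> is the total genus of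
  all components.\<close>

definition genus :: "('v, 'h) fatgraph \<Rightarrow> nat" where
  "genus F = (2 * k_num F + e_num F - (v_num F + p_num F)) div 2"


section \<open>Graded groups, cochain complexes and Poincare polynomials\<close>

text \<open>The rank of an abelian group: the largest number of elements linearly independent over the
  integers. The value is only meaningful when these numbers are bounded.\<close>

definition int_independent :: "('a, 'm) monoid_scheme \<Rightarrow> 'a set \<Rightarrow> bool" where
  "int_independent G S \<longleftrightarrow> finite S \<and> S \<subseteq> carrier G \<and>
     (\<forall>c :: 'a \<Rightarrow> int. finprod G (\<lambda>x. x [^]\<^bsub>G\<^esub> c x) S = \<one>\<^bsub>G\<^esub> \<longrightarrow> (\<forall>x\<in>S. c x = 0))"

definition abelian_rank :: "('a, 'm) monoid_scheme \<Rightarrow> nat" where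
  "abelian_rank G = Sup {card S | S. int_independent G S}"

text \<open>Laurent polynomials with coefficients in \<open>'a\<close> are \<^typ>\<open>int \<Rightarrow>\<^sub>0 'a\<close> with its convolution
  product.\<close>

definition qdim :: "(int \<Rightarrow> 'a monoid) \<Rightarrow> int \<Rightarrow>\<^sub>0 int" where
  "qdim M = (\<Sum>j\<in>{j. abelian_rank (M j) \<noteq> 0}. Poly_Mapping.single j (int (abelian_rank (M j))))"

text \<open>A Laurent polynomial in \<open>t\<close> whose coefficients are Laurent polynomials in \<open>q\<close>.\<close>

definition poincare_polynomial :: "(int \<Rightarrow> int \<Rightarrow> 'a monoid) \<Rightarrow> int \<Rightarrow>\<^sub>0 int \<Rightarrow>\<^sub>0 int" where
  "poincare_polynomial H = (\<Sum>i\<in>{i. qdim (H i) \<noteq> 0}. Poly_Mapping.single i (qdim (H i)))"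

definition laurent_eval_neg1 :: "(int \<Rightarrow>\<^sub>0 'a::comm_ring_1) \<Rightarrow> 'a" where
  "laurent_eval_neg1 P = (\<Sum>i\<in>Poly_Mapping.keys P. (-1) ^ nat \<bar>i\<bar> * Poly_Mapping.lookup P i)"

definition euler_characteristic :: "(int \<Rightarrow> int \<Rightarrow> 'a monoid) \<Rightarrow> int \<Rightarrow>\<^sub>0 int" where
  "euler_characteristic H = laurent_eval_neg1 (poincare_polynomial H)"

abbreviation q_var :: "int \<Rightarrow>\<^sub>0 int" where
  "q_var \<equiv> Poly_Mapping.single 1 1"

abbreviation q_inv :: "int \<Rightarrow>\<^sub>0 int" where
  "q_inv \<equiv> Poly_Mapping.single (-1) 1"

text \<open>\<open>chains C i j\<close> is the part of degree \<open>j\<close> of the \<open>i\<close>-th cochain group. Differentials raise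
  \<open>i\<close> by one and preserve \<open>j\<close>.\<close>

record 'a graded_complex =
  chains :: "int \<Rightarrow> int \<Rightarrow> 'a monoid"
  diff :: "int \<Rightarrow> 'a \<Rightarrow> 'a"

definition height_shift :: "'a graded_complex \<Rightarrow> int \<Rightarrow> 'a graded_complex" where
  "height_shift C s = \<lparr>chains = (\<lambda>i. chains C (i - s)), diff = (\<lambda>i. diff C (i - s))\<rparr>"

definition homology :: "'a graded_complex \<Rightarrow> int \<Rightarrow> int \<Rightarrow> 'a set monoid" where
  "homology C i j =
     subgroup_generated (chains C i j) (kernel (chains C i j) (chains C (i + 1) j) (diff C i))
     Mod (diff C (i - 1) ` carrier (chains C (i - 1) j))"

definition bigraded_iso ::
  "(int \<Rightarrow> int \<Rightarrow> 'a monoid) \<Rightarrow> (int \<Rightarrow> int \<Rightarrow> 'b monoid) \<Rightarrow> bool" where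
  "bigraded_iso H H' \<longleftrightarrow> (\<forall>i j. H i j \<cong> H' i j)"


section \<open>The modules V and R and their structure maps\<close>

datatype vgen = VPlus | VMinus
datatype rgen = X0 | XMinus2

fun vdeg :: "vgen \<Rightarrow> int" where
  "vdeg VPlus = 1"
| "vdeg VMinus = -1"

fun rdeg :: "rgen \<Rightarrow> int" where
  "rdeg X0 = 0"
| "rdeg XMinus2 = -2"

fun v_merge :: "vgen \<Rightarrow> vgen \<Rightarrow> vgen \<Rightarrow>\<^sub>0 int" where
  "v_merge VPlus VPlus = frag_of VPlus"
| "v_merge VPlus VMinus = frag_of VMinus"
| "v_merge VMinus VPlus = frag_of VMinus"
| "v_merge VMinus VMinus = 0"

fun v_split :: "vgen \<Rightarrow> (vgen \<times> vgen) \<Rightarrow>\<^sub>0 int" where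
  "v_split VPlus = frag_of (VPlus, VMinus) + frag_of (VMinus, VPlus)"
| "v_split VMinus = frag_of (VMinus, VMinus)"

text \<open>Basis tensors of \<open>V\<^sup>\<otimes>\<^sup>n\<close> and \<open>R\<^sup>\<otimes>\<^sup>n\<close> are lists of length \<open>n\<close>.\<close>

definition genus_drop :: "nat \<Rightarrow> vgen list \<Rightarrow> vgen list \<Rightarrow>\<^sub>0 int" where
  "genus_drop g xs =
     (\<Sum>ys\<in>{ys. length ys = 2 * (g - 1) \<and> sum_list (map vdeg ys) = sum_list (map vdeg xs)}.
        frag_of ys)"

definition r_comult :: "rgen list \<Rightarrow> rgen list \<Rightarrow>\<^sub>0 int" where
  "r_comult xs =
     (if xs = [] then frag_of [X0]
      else case last xs of
        X0 \<Rightarrow> frag_of (butlast xs @ [X0, X0])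
      | XMinus2 \<Rightarrow> frag_of (butlast xs @ [XMinus2, X0]) + frag_of (butlast xs @ [X0, XMinus2]))"


section \<open>The chromatic complex\<close>

text \<open>A basis tensor of \<open>A(H)\<close> together with the edge set of the state \<open>H\<close>. The factors over
  vertices and boundary components are indexed by these objects themselves.\<close>

datatype ('v, 'h) tensor_gen =
  Tensor (state_edges: "'h set set") (vpart: "'v \<Rightarrow> vgen")
    (bpart: "('v, 'h) boundary \<Rightarrow> vgen") (gpart: "vgen list") (rpart: "rgen list")

definition height :: "('v, 'h) fatgraph \<Rightarrow> 'h set set \<Rightarrow> nat" where
  "height F W = e_num F - e_num (spanning_subgraph F W)"

definition state_gens :: "('v, 'h) fatgraph \<Rightarrow> 'h set set \<Rightarrow> ('v, 'h) tensor_gen set" where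
  "state_gens F W = (let H = spanning_subgraph F W in
     {Tensor W a b gs rs | a b gs rs.
        a \<in> (verts H \<rightarrow>\<^sub>E UNIV) \<and> b \<in> (boundaries H \<rightarrow>\<^sub>E UNIV) \<and>
        length gs = 2 * genus H \<and> length rs = height F W})"

text \<open>The last summand is the degree shift \<open>{h(H)}\<close>.\<close>

definition gen_degree :: "('v, 'h) fatgraph \<Rightarrow> ('v, 'h) tensor_gen \<Rightarrow> int" where
  "gen_degree F x = (let H = spanning_subgraph F (state_edges x) in
     (\<Sum>v\<in>verts H. vdeg (vpart x v)) + (\<Sum>c\<in>boundaries H. vdeg (bpart x c)) +
     sum_list (map vdeg (gpart x)) + sum_list (map rdeg (rpart x)) +
     int (height F (state_edges x)))"

text \<open>The boundary components touched by passing from \<open>H\<close> to \<open>H'\<close> are those not common to both.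
  The order of \<open>c1\<close> and \<open>c2\<close> is irrelevant since both maps on \<open>V\<close> are symmetric.\<close>

definition merge_map ::
  "('v, 'h) fatgraph \<Rightarrow> ('v, 'h) fatgraph \<Rightarrow> (('v, 'h) boundary \<Rightarrow> vgen) \<Rightarrow>
   (('v, 'h) boundary \<Rightarrow> vgen) \<Rightarrow>\<^sub>0 int" where
  "merge_map H H' b =
     (let (c1, c2) = (SOME (c1, c2). c1 \<noteq> c2 \<and> boundaries H - boundaries H' = {c1, c2});
          c = the_elem (boundaries H' - boundaries H)
      in frag_extend (\<lambda>x. frag_of (restrict (b(c := x)) (boundaries H')))
           (v_merge (b c1) (b c2)))"

definition split_map ::
  "('v, 'h) fatgraph \<Rightarrow> ('v, 'h) fatgraph \<Rightarrow> (('v, 'h) boundary \<Rightarrow> vgen) \<Rightarrow>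
   (('v, 'h) boundary \<Rightarrow> vgen) \<Rightarrow>\<^sub>0 int" where
  "split_map H H' b =
     (let (c1, c2) = (SOME (c1, c2). c1 \<noteq> c2 \<and> boundaries H' - boundaries H = {c1, c2});
          c = the_elem (boundaries H - boundaries H')
      in frag_extend (\<lambda>(x, y). frag_of (restrict (b(c1 := x, c2 := y)) (boundaries H')))
           (v_split (b c)))"

definition boundary_map ::
  "('v, 'h) fatgraph \<Rightarrow> ('v, 'h) fatgraph \<Rightarrow> (('v, 'h) boundary \<Rightarrow> vgen) \<Rightarrow>
   (('v, 'h) boundary \<Rightarrow> vgen) \<Rightarrow>\<^sub>0 int" where
  "boundary_map H H' =
     (if card (boundaries H - boundaries H') = 2 then merge_map H H' else split_map H H')"

definition genus_map ::
  "('v, 'h) fatgraph \<Rightarrow> ('v, 'h) fatgraph \<Rightarrow> vgen list \<Rightarrow> vgen list \<Rightarrow>\<^sub>0 int" where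
  "genus_map H H' gs = (if genus H' = genus H then frag_of gs else genus_drop (genus H) gs)"

text \<open>The unsigned per-edge map on a basis tensor; the nested extensions form the tensor product
  of the maps on the separate factors.\<close>

definition edge_map ::
  "('v, 'h) fatgraph \<Rightarrow> 'h set \<Rightarrow> ('v, 'h) tensor_gen \<Rightarrow> ('v, 'h) tensor_gen \<Rightarrow>\<^sub>0 int" where
  "edge_map F e x =
     (let W = state_edges x; W' = W - {e};
          H = spanning_subgraph F W; H' = spanning_subgraph F W'
      in frag_extend (\<lambda>b. frag_extend (\<lambda>gs. frag_extend (\<lambda>rs.
           frag_of (Tensor W' (vpart x) b gs rs))
           (r_comult (rpart x))) (genus_map H H' (gpart x))) (boundary_map H H' (bpart x)))"

definition edge_numbering :: "('v, 'h) fatgraph \<Rightarrow> 'h set list \<Rightarrow> bool" where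
  "edge_numbering F es \<longleftrightarrow> distinct es \<and> set es = edges F"

definition gen_diff ::
  "('v, 'h) fatgraph \<Rightarrow> 'h set list \<Rightarrow> ('v, 'h) tensor_gen \<Rightarrow> ('v, 'h) tensor_gen \<Rightarrow>\<^sub>0 int" where
  "gen_diff F es x =
     (\<Sum>j\<in>{j. j < length es \<and> es ! j \<in> state_edges x}.
        frag_cmul ((-1) ^ card {i. i < j \<and> es ! i \<notin> state_edges x}) (edge_map F (es ! j) x))"

definition unshifted_complex ::
  "('v, 'h) fatgraph \<Rightarrow> 'h set list \<Rightarrow> (('v, 'h) tensor_gen \<Rightarrow>\<^sub>0 int) graded_complex" where
  "unshifted_complex F es =
     \<lparr>chains = (\<lambda>i j. free_Abelian_group
        {x. \<exists>W\<subseteq>edges F. x \<in> state_gens F W \<and> int (height F W) = i \<and> gen_degree F x = j}),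
      diff = (\<lambda>i. frag_extend (gen_diff F es))\<rparr>"

definition chromatic_complex ::
  "('v, 'h) fatgraph \<Rightarrow> 'h set list \<Rightarrow> (('v, 'h) tensor_gen \<Rightarrow>\<^sub>0 int) graded_complex" where
  "chromatic_complex F es = height_shift (unshifted_complex F es) (- int (e_num F))"

abbreviation chromatic_homology ::
  "('v, 'h) fatgraph \<Rightarrow> 'h set list \<Rightarrow> int \<Rightarrow> int \<Rightarrow> (('v, 'h) tensor_gen \<Rightarrow>\<^sub>0 int) set monoid" where
  "chromatic_homology F es \<equiv> homology (chromatic_complex F es)"

end

theory Submission
  imports Defs
    "HOL-Library.Function_Algebras"
begin


text \<open>The boundary components of a state are the cycles of a permutation of all half-edges, and deleting
  an edge composes it with a transposition, which joins or splits cycles. With \<open>V = \<int>[X]/(X\<^sup>2)\<close>, where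
  \<open>v\<^sub>+ = 1\<close> and \<open>v\<^sub>- = X\<close>, the maps on the boundary factors commute with multiplication by \<open>X\<close> at any
  point, so two composites of edge maps agree as soon as they agree on \<open>1\<close>; hence \<open>d\<^sup>2 = 0\<close>.

  A state with \<open>k\<close> components contributes \<open>(q + q\<^sup>-\<^sup>1)\<close> to the power
  \<open>v + p + 2 g + h = 2 k + e(F)\<close> to the Euler characteristic, by Euler's formula.

  The Euler characteristic determines the chromatic polynomial once the number of edges is known, and,
  unless it is zero, the parity of that number. The homology vanishes below degree \<open>- e(F)\<close>, and is nonzero in
  one of the degrees \<open>- e(F)\<close> or \<open>1 - e(F)\<close>: if the first differential maps \<open>u\<close> to \<open>w \<otimes> x\<^sub>0 \<noteq> 0\<close>, then
  \<open>w \<otimes> x\<^sub>-\<^sub>2\<close> is a cocycle that is not a coboundary. So homology and Euler characteristic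
  together determine the number of edges, unless the chromatic polynomial is zero.

  A single and a double edge have the same chromatic polynomial but different numbers of edges.\<close>

section \<open>Orbits and transpositions\<close>

text \<open>Boundary components of different states are sets of different half-edges, so they cannot
  be compared directly. Each state is therefore described by a function \<open>curve F W\<close> on
  the fixed set \<open>points F\<close>; \<open>joins\<close> relates the functions before and after
  a deletion, and a split is a join read backwards. Naming curves by points on them also lets
  multiplication by X be followed through several deletions. Exchanging two deletions can change
  joins into splits. Counting curves leaves five patterns; on the unit, each composite is a
  polynomial in the operators X of the last state, and the two polynomials agree in every pattern.
  The genus is defined by truncated subtraction and division, so Euler's formula has to be proved
  exact, edge by edge, before graded ranks can be computed. For the number of edges, the highest
  exponent e(F) + 2 deg M of Z fixes its parity, while the lowest nonzero degree fixes it up to 1.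
  Invariance has to cover the choice of numbering too: the sign of a deletion counts missing edges
  only, so renumbering can be undone by one sign for each state.\<close>

lemma orbit_equiv:
  assumes "f permutes A" "finite A"
  shows "x \<in> orbit f x"
    and "x \<in> orbit f y \<longleftrightarrow> orbit f x = orbit f y"
    and "x \<in> orbit f y \<longleftrightarrow> y \<in> orbit f x"
proof -
  have c: "cyclic_on f (orbit f z)" for z
    by (rule cyclic_on_orbit[OF assms])
  have s: "z \<in> orbit f z" for z
    using assms by (intro permutation_self_in_orbit) (auto simp: permutation_permutes)
  show "x \<in> orbit f x" by (rule s)
  show "x \<in> orbit f y \<longleftrightarrow> orbit f x = orbit f y"
    using orbit_cyclic_eq3[OF c, of x y] s[of x] by blast
  show "x \<in> orbit f y \<longleftrightarrow> y \<in> orbit f x"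
    using orbit_cyclic_eq3[OF c, of x y] orbit_cyclic_eq3[OF c, of y x] s by blast
qed

text \<open>Let \<open>n\<close> be the first time at which \<open>f\<close> carries
  \<open>a\<close> to \<open>b\<close>. The composite sends \<open>b\<close> to \<open>f a\<close>
  and then follows \<open>f\<close> up to the n-th image \<open>b\<close>, so its cycle through
  \<open>b\<close> closes before reaching \<open>a\<close>.\<close>

lemma orbit_transpose_separates:
  assumes f: "f permutes A" "finite A" and "a \<noteq> b" and ab: "b \<in> orbit f a"
  shows "a \<notin> orbit (f \<circ> transpose a b) b"
proof -
  define g where "g = f \<circ> transpose a b"
  define n where "n = (LEAST n. 0 < n \<and> (f ^^ n) a = b)"
  have n: "0 < n" "(f ^^ n) a = b"
    using LeastI_ex[of "\<lambda>n. 0 < n \<and> (f ^^ n) a = b"] ab unfolding n_def orbit_altdef by auto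
  have least: "(f ^^ m) a \<noteq> b" if "0 < m" "m < n" for m
    using not_less_Least[of m "\<lambda>n. 0 < n \<and> (f ^^ n) a = b"] that unfolding n_def by auto
  \<comment> \<open>A return to \<open>a\<close> before time \<open>n\<close> would make
    \<open>b\<close> appear earlier than its first time.\<close>
  have not_a: "(f ^^ m) a \<noteq> a" if "0 < m" "m \<le> n" for m
  proof
    assume m: "(f ^^ m) a = a"
    then have "m < n" using that n \<open>a \<noteq> b\<close> by (metis le_neq_implies_less)
    have "(f ^^ (n - m)) ((f ^^ m) a) = (f ^^ n) a"
      using that by (metis add.commute funpow_add le_add_diff_inverse2 comp_apply)
    then have "(f ^^ (n - m)) a = b" using m n by simp
    then show False using least[of "n - m"] that \<open>m < n\<close> by auto
  qed
  have "y \<in> (\<lambda>m. (f ^^ m) a) ` {0<..n}" if "y \<in> orbit g b" for y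
    using that
  proof induction
    case base
    have "g b = (f ^^ 1) a" by (simp add: g_def)
    then show ?case using n by (intro image_eqI[where x=1]) auto
  next
    case (step y)
    then obtain m where m: "y = (f ^^ m) a" "0 < m" "m \<le> n" by auto
    show ?case
    proof (cases "m = n")
      case True
      then have "g y = (f ^^ 1) a" using m n by (simp add: g_def)
      then show ?thesis using n by (intro image_eqI[where x=1]) auto
    next
      case False
      then have "y \<noteq> a" "y \<noteq> b" using m least not_a by auto
      then have "g y = (f ^^ Suc m) a" using m by (simp add: g_def transpose_def)
      then show ?thesis using m False by (intro image_eqI[where x="Suc m"]) auto
    qed
  qed
  note this[of a]
  moreover have "a \<notin> (\<lambda>m. (f ^^ m) a) ` {0<..n}"
  proof
    assume "a \<in> (\<lambda>m. (f ^^ m) a) ` {0<..n}"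
    then obtain m where "a = (f ^^ m) a" "m \<in> {0<..n}" by (rule imageE)
    then show False using not_a[of m] by simp
  qed
  ultimately show ?thesis unfolding g_def[symmetric] by (rule contrapos_nn[rotated])
qed

text \<open>The composite sends \<open>a\<close> to \<open>f b\<close> and then agrees with
  \<open>f\<close> along the cycle of \<open>b\<close>, which avoids \<open>a\<close>, until that
  cycle closes at \<open>b\<close>.\<close>

lemma orbit_transpose_joins:
  assumes f: "f permutes A" "finite A" and ab: "b \<notin> orbit f a"
  shows "b \<in> orbit (f \<circ> transpose a b) a"
proof -
  define g where "g = f \<circ> transpose a b"
  define n where "n = (LEAST n. 0 < n \<and> (f ^^ n) b = b)"
  have "b \<in> orbit f b" using orbit_equiv[OF f] by blast
  then obtain k where "0 < k" "(f ^^ k) b = b" by (auto simp: orbit_altdef)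
  then have n: "0 < n" "(f ^^ n) b = b"
    using LeastI[of "\<lambda>n. 0 < n \<and> (f ^^ n) b = b" k] unfolding n_def by auto
  have least: "(f ^^ m) b \<noteq> b" if "0 < m" "m < n" for m
    using not_less_Least[of m "\<lambda>n. 0 < n \<and> (f ^^ n) b = b"] that unfolding n_def by auto
  have not_a: "(f ^^ m) b \<noteq> a" if "0 < m" for m
  proof
    assume "(f ^^ m) b = a"
    then have "a \<in> orbit f b" using that by (auto simp: orbit_altdef)
    then show False using ab orbit_equiv(3)[OF f] by blast
  qed
  have "0 < m \<Longrightarrow> m \<le> n \<Longrightarrow> (f ^^ m) b \<in> orbit g a" for m
  proof (induction m)
    case (Suc m)
    show ?case
    proof (cases "m = 0")
      case True
      have "g a = f b" by (simp add: g_def)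
      then show ?thesis using True orbit.base[of g a] by simp
    next
      case False
      then have "(f ^^ m) b \<noteq> a" "(f ^^ m) b \<noteq> b" using Suc not_a least by auto
      then have "g ((f ^^ m) b) = (f ^^ Suc m) b" by (simp add: g_def transpose_def)
      then show ?thesis using Suc False orbit.step[of "(f ^^ m) b" g a] by simp
    qed
  qed simp
  then show ?thesis using n unfolding g_def by (metis order_refl)
qed

text \<open>The composite differs from \<open>f\<close> only at \<open>a\<close> and
  \<open>b\<close>, whose cycles it links into one; everywhere else a step of the composite is a
  step of \<open>f\<close>.\<close>

lemma orbit_transpose_merge:
  assumes f: "f permutes A" "finite A" and A: "a \<in> A" "b \<in> A" and ab: "b \<notin> orbit f a"
  shows "p \<in> orbit (f \<circ> transpose a b) q \<longleftrightarrow>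
    p \<in> orbit f q \<or> (p \<in> orbit f a \<union> orbit f b \<and> q \<in> orbit f a \<union> orbit f b)"
proof -
  define g where "g = f \<circ> transpose a b"
  have g: "g permutes A" unfolding g_def using f A by (intro permutes_compose permutes_swap_id)
  note ef = orbit_equiv[OF f] and eg = orbit_equiv[OF g f(2)]
  have gab: "orbit g a = orbit g b" using orbit_transpose_joins[OF f ab] eg unfolding g_def by metis
  let ?M = "orbit f a \<union> orbit f b"
  have M: "orbit f q \<subseteq> ?M" if "q \<in> ?M" for q
    using that orbit_trans[of _ f q a] orbit_trans[of _ f q b] by blast
  have st: "g p \<in> orbit f p \<or> (p \<in> ?M \<and> g p \<in> ?M)" for p
  proof -
    have "g p = f p \<or> (p = a \<and> g p = f b) \<or> (p = b \<and> g p = f a)"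
      by (auto simp: g_def transpose_def)
    then show ?thesis using ef(1) orbit.base[of f] by auto
  qed
  have 1: "p \<in> orbit f q \<or> (p \<in> ?M \<and> q \<in> ?M)" if "p \<in> orbit g q" for p q
    using that
  proof induction
    case base then show ?case using st by blast
  next
    case (step y)
    show ?case using st[of y] step.IH M[of y] ef(3)[of y q] orbit_trans[of "g y" f y q] by blast
  qed
  \<comment> \<open>\<open>f p\<close> is the image under \<open>g\<close> of a point in the same
    \<open>g\<close>-cycle as \<open>p\<close>, because \<open>a\<close> and \<open>b\<close> share
    one.\<close>
  have stepg: "f p \<in> orbit g p" for p
  proof -
    have "f p = g (transpose a b p)" by (simp add: g_def)
    moreover have "g (transpose a b p) \<in> orbit g (transpose a b p)" by (rule orbit.base)
    moreover have "orbit g (transpose a b p) = orbit g p" using gab by (simp add: transpose_def)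
    ultimately show ?thesis by simp
  qed
  have 2: "p \<in> orbit g q" if "p \<in> orbit f q" for p q
    using that by induction (blast intro: stepg orbit_trans)+
  have 3: "p \<in> orbit g a" if "p \<in> ?M" for p
    using that 2[of p a] 2[of p b] gab by blast
  show ?thesis using 1[of p q] 2[of p q] 3[of p] 3[of q] eg(2,3) unfolding g_def[symmetric]
    by metis
qed

text \<open>A transposition is its own inverse, so the split case is the join case with
  \<open>f\<close> and \<open>g\<close> exchanged.\<close>

lemma orbit_transpose:
  assumes f: "f permutes A" "finite A" and A: "a \<in> A" "b \<in> A" "a \<noteq> b"
    and g_def: "g = f \<circ> transpose a b"
  shows "b \<in> orbit f a \<longleftrightarrow> b \<notin> orbit g a"
    and "orbit g a \<union> orbit g b = orbit f a \<union> orbit f b"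
    and "k \<notin> orbit f a \<union> orbit f b \<Longrightarrow> orbit g k = orbit f k"
proof -
  have g: "g permutes A" unfolding g_def using f A by (intro permutes_compose permutes_swap_id)
  have fg: "f = g \<circ> transpose a b" by (auto simp: g_def)
  note ef = orbit_equiv[OF f] and eg = orbit_equiv[OF g f(2)]
  show 1: "b \<in> orbit f a \<longleftrightarrow> b \<notin> orbit g a"
    using orbit_transpose_separates[OF f \<open>a \<noteq> b\<close>] orbit_transpose_joins[OF f, of b a] eg(3)
    unfolding g_def by blast
  have "orbit g a \<union> orbit g b = orbit f a \<union> orbit f b \<and>
      (\<forall>k. k \<notin> orbit f a \<union> orbit f b \<longrightarrow> orbit g k = orbit f k)"
  proof (cases "b \<in> orbit f a")
    case False
    note m = orbit_transpose_merge[OF f A(1,2) False, folded g_def]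
    have "x \<in> orbit g a \<longleftrightarrow> x \<in> orbit f a \<union> orbit f b" 
      "x \<in> orbit g b \<longleftrightarrow> x \<in> orbit f a \<union> orbit f b" for x
      using m[of x a] m[of x b] ef(1) by blast+
    moreover have "orbit g k = orbit f k" if "k \<notin> orbit f a \<union> orbit f b" for k
      using m[of _ k] that by blast
    ultimately show ?thesis by blast
  next
    case True
    then have "b \<notin> orbit g a" using 1 by blast
    note m = orbit_transpose_merge[OF g f(2) A(1,2) this, folded fg]
    have *: "x \<in> orbit f a \<longleftrightarrow> x \<in> orbit g a \<union> orbit g b" 
      "x \<in> orbit f b \<longleftrightarrow> x \<in> orbit g a \<union> orbit g b" for x
      using m[of x a] m[of x b] eg(1) by blast+
    moreover have "orbit g k = orbit f k" if "k \<notin> orbit f a \<union> orbit f b" for k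
      using m[of _ k] that * by blast
    ultimately show ?thesis by blast
  qed
  then show "orbit g a \<union> orbit g b = orbit f a \<union> orbit f b"
    and "k \<notin> orbit f a \<union> orbit f b \<Longrightarrow> orbit g k = orbit f k" by blast+
qed


section \<open>Boundary curves of a state\<close>

text \<open>On all half-edges of \<open>F\<close>, the half-edges missing from the state are merely passed by at
  their vertex. Deleting an edge then composes the permutation with a transposition.\<close>

definition state_perm :: "('v, 'h) fatgraph \<Rightarrow> 'h set set \<Rightarrow> 'h \<Rightarrow> 'h" where
  "state_perm F W h =
     (if h \<in> halves F then nxt F (if h \<in> \<Union>W then opp F h else h) else h)"

text \<open>One set for all states of \<open>F\<close>, so that the curves of different states
  become functions on a common domain. A vertex without half-edges is a disc whose boundary no
  half-edge can name, hence the second summand.\<close>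

definition points :: "('v, 'h) fatgraph \<Rightarrow> ('h + 'v) set" where
  "points F = Inl ` halves F \<union> Inr ` (verts F - vert F ` halves F)"

text \<open>The cycle is cut down to the half-edges of the state because these are what a boundary
  component of the spanning subgraph records. A cycle containing none of them runs around a vertex
  that is isolated in the state.\<close>

fun curve :: "('v, 'h) fatgraph \<Rightarrow> 'h set set \<Rightarrow> 'h + 'v \<Rightarrow> ('v, 'h) boundary" where
  "curve F W (Inl h) = (let S = orbit (state_perm F W) h \<inter> \<Union>W in
     if S = {} then Isolated (vert F h) else Cycle S)"
| "curve F W (Inr v) = Isolated v"

context fatgraph
begin

lemma nxt_in: "h \<in> halves F \<Longrightarrow> nxt F h \<in> halves F"
  using nxt_orbit[of h] orbit.base[of "nxt F" h] by auto

lemma vert_nxt: "h \<in> halves F \<Longrightarrow> vert F (nxt F h) = vert F h"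
  using nxt_orbit[of h] orbit.base[of "nxt F" h] by auto

text \<open>A half-edge lies in its own orbit and hence is a successor; surjectivity on a finite set
  gives injectivity.\<close>

lemma nxt_bij: "bij_betw (nxt F) (halves F) (halves F)"
proof -
  have "h \<in> nxt F ` halves F" if "h \<in> halves F" for h
  proof -
    have "h \<in> orbit (nxt F) h" using nxt_orbit[OF that] that by auto
    then show ?thesis
    proof cases
      case base then show ?thesis using that by blast
    next
      case (step y)
      then have "y \<in> halves F" using nxt_orbit[OF that] by auto
      then show ?thesis using step by blast
    qed
  qed
  then have "nxt F ` halves F = halves F" using nxt_in by blast
  then show ?thesis
    using finite_halves by (simp add: bij_betw_def eq_card_imp_inj_on)
qed

lemma edge_cases: "e \<in> edges F \<Longrightarrow> h \<in> e \<Longrightarrow> h \<in> halves F \<and> e = {h, opp F h}"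
  using opp_in opp_opp by (auto simp: edges_def)

lemma edge_obtain:
  assumes "e \<in> edges F"
  obtains a where "a \<in> halves F" "e = {a, opp F a}"
  using assms by (auto simp: edges_def)

lemma Union_state: "W \<subseteq> edges F \<Longrightarrow> \<Union>W \<subseteq> halves F"
  using edge_cases by blast

lemma opp_state: "W \<subseteq> edges F \<Longrightarrow> h \<in> \<Union>W \<Longrightarrow> opp F h \<in> \<Union>W"
proof -
  assume "W \<subseteq> edges F" "h \<in> \<Union>W"
  then obtain e where e: "e \<in> W" "e \<in> edges F" "h \<in> e" by blast
  then have "opp F h \<in> e" using edge_cases[of e h] by simp
  then show ?thesis using e by blast
qed

lemma finite_edges: "finite (edges F)"
  using finite_halves edge_cases by (intro finite_subset[of "edges F" "Pow (halves F)"]) auto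

lemma Union_delete:
  assumes "W \<subseteq> edges F" "{a, opp F a} \<in> W"
  shows "\<Union>(W - {{a, opp F a}}) = \<Union>W - {a, opp F a}"
proof -
  have "e = {a, opp F a}" if "e \<in> W" "a \<in> e \<or> opp F a \<in> e" for e
    using edge_cases[of e] edge_cases[of "{a, opp F a}"] assms that by blast
  then show ?thesis by blast
qed

lemma state_perm_permutes:
  assumes "W \<subseteq> edges F"
  shows "state_perm F W permutes halves F"
proof (rule bij_imp_permutes)
  define t where "t = (\<lambda>h. if h \<in> \<Union>W then opp F h else h)"
  have t: "t h \<in> halves F" "t (t h) = h" if "h \<in> halves F" for h
    using that opp_in opp_opp opp_state[OF assms] by (auto simp: t_def)
  have "bij_betw t (halves F) (halves F)"
    using t by (intro bij_betw_byWitness[where f' = t]) auto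
  from bij_betw_trans[OF this nxt_bij]
  have "bij_betw (nxt F \<circ> t) (halves F) (halves F)" .
  then show "bij_betw (state_perm F W) (halves F) (halves F)"
    by (rule bij_betw_cong[THEN iffD1, rotated]) (simp add: state_perm_def t_def)
qed (simp add: state_perm_def)

lemmas state_orbit = orbit_equiv[OF state_perm_permutes finite_halves]

text \<open>With its edge present, \<open>a\<close> goes to \<open>nxt F (opp F a)\<close>; with the
  edge absent, to \<open>nxt F a\<close>. The deletion thus swaps the images of \<open>a\<close> and
  \<open>opp F a\<close>.\<close>

lemma state_perm_delete:
  assumes "W \<subseteq> edges F" "{a, opp F a} \<in> W"
  shows "state_perm F (W - {{a, opp F a}}) = state_perm F W \<circ> transpose a (opp F a)"
proof
  fix h
  have a: "a \<in> halves F" "a \<in> \<Union>W" "opp F a \<in> \<Union>W" using assms edge_cases[of "{a, opp F a}" a] by auto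
  have U: "x \<in> \<Union>(W - {{a, opp F a}}) \<longleftrightarrow> x \<in> \<Union>W \<and> x \<noteq> a \<and> x \<noteq> opp F a" for x
    unfolding Union_delete[OF assms] by blast
  show "state_perm F (W - {{a, opp F a}}) h = (state_perm F W \<circ> transpose a (opp F a)) h"
    unfolding state_perm_def U comp_apply using a opp_in[OF a(1)] opp_opp[OF a(1)]
    by (auto simp: transpose_def)
qed

text \<open>Away from the half-edges of the state the permutation is \<open>nxt F\<close>, whose
  cycles are the vertices.\<close>

lemma orbit_at_isolated:
  assumes W: "W \<subseteq> edges F" and h: "h \<in> halves F" and "orbit (state_perm F W) h \<inter> \<Union>W = {}"
  shows "orbit (state_perm F W) h = {k \<in> halves F. vert F k = vert F h}"
proof -
  have "state_perm F W x = nxt F x" if "x \<in> orbit (state_perm F W) h" for x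
  proof -
    have "x \<notin> \<Union>W" using assms that by blast
    moreover have "x \<in> halves F"
      using permutes_orbit_subset[OF state_perm_permutes[OF W] h] that by blast
    ultimately show ?thesis by (simp add: state_perm_def)
  qed
  then have "orbit (nxt F) h = orbit (state_perm F W) h"
    by (intro orbit_cong state_orbit(1)[OF W]) auto
  then show ?thesis using nxt_orbit[OF h] by simp
qed

lemma orbit_in_halves: "W \<subseteq> edges F \<Longrightarrow> h \<in> halves F \<Longrightarrow> orbit (state_perm F W) h \<subseteq> halves F"
  by (rule permutes_orbit_subset[OF state_perm_permutes])

text \<open>Allowing two states makes this serve twice: for a single state it shows that different
  cycles have different curves, and for a deletion that the affected curves are new. A nonempty
  trace is shared by both cycles; with empty traces both are the full cycle of the same
  vertex.\<close>

lemma curve_eq_meet: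
  assumes "W \<subseteq> edges F" "W' \<subseteq> edges F" "h \<in> halves F" "k \<in> halves F"
    and "curve F W (Inl h) = curve F W' (Inl k)"
  shows "orbit (state_perm F W) h \<inter> orbit (state_perm F W') k \<noteq> {}"
    and "orbit (state_perm F W) h \<inter> \<Union>W = orbit (state_perm F W') k \<inter> \<Union>W'"
proof -
  let ?A = "orbit (state_perm F W) h" and ?B = "orbit (state_perm F W') k"
  consider "?A \<inter> \<Union>W \<noteq> {}" "?A \<inter> \<Union>W = ?B \<inter> \<Union>W'"
    | "?A \<inter> \<Union>W = {}" "?B \<inter> \<Union>W' = {}" "vert F h = vert F k"
    using assms(5) by (auto simp: Let_def split: if_splits)
  then have "?A \<inter> ?B \<noteq> {} \<and> ?A \<inter> \<Union>W = ?B \<inter> \<Union>W'"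
  proof cases
    case 1 then show ?thesis by blast
  next
    case 2
    have "?A = ?B"
      unfolding orbit_at_isolated[OF assms(1,3) 2(1)] orbit_at_isolated[OF assms(2,4) 2(2)] 2(3) ..
    then show ?thesis using 2 orbit_nonempty[of _ k] by simp
  qed
  then show "?A \<inter> ?B \<noteq> {}" "?A \<inter> \<Union>W = ?B \<inter> \<Union>W'" by auto
qed

lemma curve_eq_iff:
  assumes W: "W \<subseteq> edges F" and h: "h \<in> halves F" "k \<in> halves F"
  shows "curve F W (Inl h) = curve F W (Inl k) \<longleftrightarrow> h \<in> orbit (state_perm F W) k"
proof
  assume "curve F W (Inl h) = curve F W (Inl k)"
  from curve_eq_meet(1)[OF W W h this] obtain x
    where "x \<in> orbit (state_perm F W) h" "x \<in> orbit (state_perm F W) k" by blast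
  then show "h \<in> orbit (state_perm F W) k" using state_orbit[OF W] by metis
next
  assume *: "h \<in> orbit (state_perm F W) k"
  then have eq: "orbit (state_perm F W) h = orbit (state_perm F W) k" using state_orbit[OF W] by metis
  have "vert F h = vert F k" if "orbit (state_perm F W) k \<inter> \<Union>W = {}"
    using orbit_at_isolated[OF W h(2) that] * by simp
  then show "curve F W (Inl h) = curve F W (Inl k)" by (simp add: eq Let_def)
qed

lemma curve_Inl_neq_Inr:
  assumes "h \<in> halves F" "Inr v \<in> points F"
  shows "curve F W (Inl h) \<noteq> curve F W' (Inr v)"
  using assms by (auto simp: Let_def points_def)

end



section \<open>Deleting an edge of a state\<close>

text \<open>The functions \<open>c\<close> and \<open>c'\<close> send a point to the curve on which it lies before and after the distinct
  curves through \<open>a\<close> and \<open>b\<close> are joined.\<close>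

definition joins :: "'p set \<Rightarrow> ('p \<Rightarrow> 'c) \<Rightarrow> ('p \<Rightarrow> 'c) \<Rightarrow> 'p \<Rightarrow> 'p \<Rightarrow> bool" where
  "joins P c c' a b \<longleftrightarrow> a \<in> P \<and> b \<in> P \<and> c a \<noteq> c b \<and> c' a \<notin> c ` P \<and> c a \<notin> c' ` P \<and> c b \<notin> c' ` P \<and>
     (\<forall>p\<in>P. c' p = (if c p \<in> {c a, c b} then c' a else c p))"

definition surgery :: "'p set \<Rightarrow> ('p \<Rightarrow> 'c) \<Rightarrow> ('p \<Rightarrow> 'c) \<Rightarrow> 'p \<Rightarrow> 'p \<Rightarrow> bool" where
  "surgery P c c' a b \<longleftrightarrow> joins P c c' a b \<or> joins P c' c a b"

lemma joinsD:
  assumes "joins P c c' a b"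
  shows "a \<in> P" "b \<in> P" "c a \<noteq> c b" "c' a = c' b" "c' a \<notin> c ` P" "c a \<notin> c' ` P" "c b \<notin> c' ` P"
    and "p \<in> P \<Longrightarrow> c p \<noteq> c a \<Longrightarrow> c p \<noteq> c b \<Longrightarrow> c' p = c p"
    and "p \<in> P \<Longrightarrow> c p = c a \<or> c p = c b \<Longrightarrow> c' p = c' a"
    and "p \<in> P \<Longrightarrow> c' p = c' a \<Longrightarrow> c p = c a \<or> c p = c b"
proof -
  from assms have A: "a \<in> P" "b \<in> P" "c a \<noteq> c b" "c' a \<notin> c ` P" "c a \<notin> c' ` P" "c b \<notin> c' ` P"
    and E: "\<forall>p\<in>P. c' p = (if c p \<in> {c a, c b} then c' a else c p)"
    unfolding joins_def by blast+
  show "a \<in> P" "b \<in> P" "c a \<noteq> c b" "c' a \<notin> c ` P" "c a \<notin> c' ` P" "c b \<notin> c' ` P"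
    by fact+
  have in_: "c' p = c' a" if "p \<in> P" "c p = c a \<or> c p = c b" for p
    using bspec[OF E that(1)] that(2) by (metis insertCI)
  have out: "c' p = c p" if "p \<in> P" "c p \<noteq> c a" "c p \<noteq> c b" for p
    using bspec[OF E that(1)] that(2,3) by (metis insertE singletonD)
  show "c' a = c' b" using in_[OF A(2)] by metis
  show "p \<in> P \<Longrightarrow> c p \<noteq> c a \<Longrightarrow> c p \<noteq> c b \<Longrightarrow> c' p = c p" by (rule out)
  show "p \<in> P \<Longrightarrow> c p = c a \<or> c p = c b \<Longrightarrow> c' p = c' a" by (rule in_)
  show "p \<in> P \<Longrightarrow> c' p = c' a \<Longrightarrow> c p = c a \<or> c p = c b"
    using out[of p] A(4) by (metis image_eqI)
qed

lemma joins_images: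
  assumes "joins P c c' a b"
  shows "c ` P - c' ` P = {c a, c b}" "c' ` P - c ` P = {c' a}"
    "c' ` P = insert (c' a) (c ` P - {c a, c b})" "c ` P = insert (c a) (insert (c b) (c' ` P - {c' a}))"
proof -
  note j = joinsD[OF assms]
  show 1: "c' ` P = insert (c' a) (c ` P - {c a, c b})" (is "?A = ?B")
  proof
    show "?A \<subseteq> ?B"
    proof (rule image_subsetI)
      fix p assume "p \<in> P"
      then show "c' p \<in> ?B" using j(8)[of p] j(9)[of p] by (metis DiffI image_eqI insert_iff empty_iff)
    qed
    show "?B \<subseteq> ?A"
    proof
      fix x assume "x \<in> ?B"
      then consider "x = c' a" | p where "p \<in> P" "x = c p" "c p \<noteq> c a" "c p \<noteq> c b" by blast
      then show "x \<in> ?A" using j(1) j(8) by cases (auto intro: rev_image_eqI)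
    qed
  qed
  have ab: "c a \<in> c ` P" "c b \<in> c ` P" using j(1,2) by blast+
  show "c ` P - c' ` P = {c a, c b}" "c' ` P - c ` P = {c' a}"
    "c ` P = insert (c a) (insert (c b) (c' ` P - {c' a}))"
  proof -
    have "A - insert z (A - {x, y}) = {x, y}" "insert z (A - {x, y}) - A = {z}"
      "A = insert x (insert y (insert z (A - {x, y}) - {z}))"
      if "x \<in> A" "y \<in> A" "z \<notin> A" for A and x y z :: 'b
      using that by auto
    from this[OF ab j(5), folded 1] show "c ` P - c' ` P = {c a, c b}" "c' ` P - c ` P = {c' a}"
      "c ` P = insert (c a) (insert (c b) (c' ` P - {c' a}))" .
  qed
qed

lemma joins_card:
  assumes "joins P c c' a b" "finite P"
  shows "card (c ` P) = Suc (card (c' ` P))"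
proof -
  note j = joinsD[OF assms(1)]
  have "card (c ` P) = card {c a, c b} + card (c' ` P - {c' a})"
  proof (subst card_Un_disjoint[symmetric])
    show "{c a, c b} \<inter> (c' ` P - {c' a}) = {}" using j(6,7) by blast
    show "card (c ` P) = card ({c a, c b} \<union> (c' ` P - {c' a}))"
      unfolding joins_images(4)[OF assms(1)] by (metis insert_is_Un Un_assoc)
  qed (use assms(2) in simp_all)
  moreover have "card (c' ` P) = Suc (card (c' ` P - {c' a}))"
    using j(1) assms(2) by (intro card.remove) auto
  ultimately show ?thesis using j(3) by simp
qed

lemma surgery_joins:
  assumes "surgery P c c' a b"
  shows "c a \<noteq> c b \<Longrightarrow> joins P c c' a b" and "c a = c b \<Longrightarrow> joins P c' c a b"
  using assms joinsD(3,4)[of P c c' a b] joinsD(3,4)[of P c' c a b] unfolding surgery_def by auto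

text \<open>The two orders of the surgeries at \<open>a, b\<close> and at \<open>p, q\<close> change the number of curves by the same
  amount, which leaves only these patterns of joins and splits.\<close>

lemma surgery_square:
  assumes "finite P"
    and s: "surgery P c c1 a b" "surgery P c1 c3 p q" "surgery P c c2 p q" "surgery P c2 c3 a b"
  obtains (same) "c a = c b \<longleftrightarrow> c2 a = c2 b" "c p = c q \<longleftrightarrow> c1 p = c1 q"
  | (split_join) "c a = c b" "c1 p \<noteq> c1 q" "c p = c q" "c2 a \<noteq> c2 b"
      "c3 a = c3 b" "c3 p = c3 q" "c3 a = c3 p"
  | (join_split) "c a \<noteq> c b" "c1 p = c1 q" "c p \<noteq> c q" "c2 a = c2 b" "{c3 a, c3 b} = {c3 p, c3 q}"
  | (both) "c a = c b" "c1 p = c1 q" "c p = c q" "c2 a = c2 b"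
  | (none) "c a \<noteq> c b" "c1 p \<noteq> c1 q" "c p \<noteq> c q" "c2 a \<noteq> c2 b"
proof -
  have card: "int (card (y ` P)) = int (card (x ` P)) + (if x a = x b then 1 else - 1)"
    if "surgery P x y a b" for x y :: "'a \<Rightarrow> 'b" and a b
    using surgery_joins[OF that] joins_card[OF _ \<open>finite P\<close>] by force
  \<comment> \<open>Each surgery changes the number of curves by one, up for a split and down for a
    join, and the two routes start and end alike.\<close>
  have "(if c a = c b then 1 else - 1 :: int) + (if c1 p = c1 q then 1 else - 1) =
      (if c p = c q then 1 else - 1) + (if c2 a = c2 b then 1 else - 1)"
    using card[OF s(1)] card[OF s(2)] card[OF s(3)] card[OF s(4)] by linarith
  then have n: "(c a = c b \<longleftrightarrow> c1 p \<noteq> c1 q) \<and> (c p = c q \<longleftrightarrow> c2 a \<noteq> c2 b) \<or>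
      (c a = c b \<and> c1 p = c1 q \<and> c p = c q \<and> c2 a = c2 b) \<or>
      (c a \<noteq> c b \<and> c1 p \<noteq> c1 q \<and> c p \<noteq> c q \<and> c2 a \<noteq> c2 b)"
    by (simp split: if_splits)
  consider (both) "c a = c b" "c1 p = c1 q" "c p = c q" "c2 a = c2 b"
    | (none) "c a \<noteq> c b" "c1 p \<noteq> c1 q" "c p \<noteq> c q" "c2 a \<noteq> c2 b"
    | (same) "c a = c b \<longleftrightarrow> c2 a = c2 b" "c p = c q \<longleftrightarrow> c1 p = c1 q"
    | (sj) "c a = c b" "c1 p \<noteq> c1 q" "c p = c q" "c2 a \<noteq> c2 b"
    | (js) "c a \<noteq> c b" "c1 p = c1 q" "c p \<noteq> c q" "c2 a = c2 b"
    using n by argo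
  then show thesis
  proof cases
    case sj
    from surgery_joins(2)[OF s(1) sj(1)] have j1: "joins P c1 c a b" .
    from surgery_joins(1)[OF s(2) sj(2)] have j2: "joins P c1 c3 p q" .
    from surgery_joins(1)[OF s(4) sj(4)] have j3: "joins P c2 c3 a b" .
    note d1 = joinsD[OF j1] and d2 = joinsD[OF j2] and d3 = joinsD[OF j3]
    \<comment> \<open>The join at \<open>p\<close> and \<open>q\<close> undoes the split at
      \<open>a\<close> and \<open>b\<close>: since the common curve of \<open>p\<close> and
      \<open>q\<close> has come apart, they lie on the two curves that the split produced.\<close>
    have "c1 p \<noteq> c a" "c1 q \<noteq> c a"
      using d1(5) imageI[OF d2(1), of c1] imageI[OF d2(2), of c1] by metis+
    then have "c1 p = c1 a \<or> c1 p = c1 b" "c1 q = c1 a \<or> c1 q = c1 b"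
      using d1(8)[OF d2(1)] d1(8)[OF d2(2)] d1(9)[OF d2(1)] d1(9)[OF d2(2)] sj(2,3) by metis+
    then have "c1 a = c1 p \<or> c1 a = c1 q" using sj(2) d1(3) by auto
    then have "c3 a = c3 p" using d2(9)[of a] d1(1) by blast
    then show thesis using split_join sj d2(4) d3(4) by blast
  next
    case js
    from surgery_joins(1)[OF s(1) js(1)] have j1: "joins P c c1 a b" .
    from surgery_joins(2)[OF s(2) js(2)] have j2: "joins P c3 c1 p q" .
    from surgery_joins(2)[OF s(4) js(4)] have j3: "joins P c3 c2 a b" .
    note d1 = joinsD[OF j1] and d2 = joinsD[OF j2] and d3 = joinsD[OF j3]
    \<comment> \<open>The mirror image: the curves of \<open>p\<close> and \<open>q\<close> became
      one only through the join at \<open>a\<close> and \<open>b\<close>, so the last split, made at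
      either pair, yields the same two curves.\<close>
    have "c p \<noteq> c1 a" "c q \<noteq> c1 a"
      using d1(5) imageI[OF d2(1), of c] imageI[OF d2(2), of c] by metis+
    then have "c p = c a \<or> c p = c b"
      using d1(8)[OF d2(1)] d1(8)[OF d2(2)] d1(9)[OF d2(1)] d1(9)[OF d2(2)] js(2,3) by metis
    then have "c1 p = c1 a" using d1(9)[of p] d2(1) by simp
    then have "c3 a = c3 p \<or> c3 a = c3 q" "c3 b = c3 p \<or> c3 b = c3 q"
      using d2(10)[of a] d2(10)[of b] d1(1,2,4) by simp_all
    then show thesis using join_split js d3(3) d2(3) by (metis insert_commute)
  qed (use both none same in blast)+
qed

context fatgraph
begin

lemma finite_points: "finite (points F)"
  using finite_halves finite_verts by (simp add: points_def)

text \<open>Deletion multiplies the permutation by a transposition, so exactly the cycles through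
  \<open>a\<close> and \<open>opp F a\<close> are joined or split. The care goes into names, since
  \<open>joins\<close> compares curves as values: unaffected curves keep their names, and affected
  ones have names that the other state does not use.\<close>

lemma surgery_delete:
  assumes W: "W \<subseteq> edges F" and e: "{a, opp F a} \<in> W"
  shows "surgery (points F) (curve F W) (curve F (W - {{a, opp F a}})) (Inl a) (Inl (opp F a))"
proof -
  define b where "b = opp F a"
  define W' where "W' = W - {{a, b}}"
  have W': "W' \<subseteq> edges F" using W by (auto simp: W'_def)
  have a: "a \<in> halves F" using edge_cases[of "{a, opp F a}" a] W e by blast
  then have ab: "a \<in> halves F" "b \<in> halves F" "a \<noteq> b" "a \<in> \<Union>W" "b \<in> \<Union>W"
    using e opp_in[OF a] opp_neq[OF a, symmetric] unfolding b_def by auto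
  define f where "f = state_perm F W"
  define g where "g = state_perm F W'"
  have g: "g = f \<circ> transpose a b"
    unfolding f_def g_def W'_def b_def by (rule state_perm_delete[OF W e])
  have f: "f permutes halves F" and gp: "g permutes halves F"
    unfolding f_def g_def by (rule state_perm_permutes[OF W] state_perm_permutes[OF W'])+
  note t = orbit_transpose[OF f finite_halves ab(1-3) g]
  note ef = orbit_equiv[OF f finite_halves] and eg = orbit_equiv[OF gp finite_halves]
  define M where "M = orbit f a \<union> orbit f b"
  have U: "\<Union>W' = \<Union>W - {a, b}" unfolding W'_def b_def by (rule Union_delete[OF W e])
  define c where "c = curve F W"
  define c' where "c' = curve F W'"
  have cc: "c (Inl h) = c (Inl k) \<longleftrightarrow> h \<in> orbit f k" "c' (Inl h) = c' (Inl k) \<longleftrightarrow> h \<in> orbit g k"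
    if "h \<in> halves F" "k \<in> halves F" for h k
    unfolding c_def c'_def f_def g_def using curve_eq_iff[OF W that] curve_eq_iff[OF W' that] by auto
  have M1: "h \<in> M \<longleftrightarrow> c (Inl h) = c (Inl a) \<or> c (Inl h) = c (Inl b)"
    and M2: "h \<in> M \<longleftrightarrow> c' (Inl h) = c' (Inl a) \<or> c' (Inl h) = c' (Inl b)" if "h \<in> halves F" for h
    using cc[OF that ab(1)] cc[OF that ab(2)] t(2) unfolding M_def by blast+
  have same: "c (Inl h) = c' (Inl h)" if h: "h \<in> halves F" "h \<notin> M" for h
  proof -
    have "orbit g h = orbit f h" using t(3)[of h] h(2) unfolding M_def by blast
    moreover have "a \<notin> orbit f h" "b \<notin> orbit f h" using ef(3)[of _ h] h(2) unfolding M_def by blast+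
    then have "orbit f h \<inter> \<Union>W = orbit f h \<inter> \<Union>W'" unfolding U by blast
    ultimately show ?thesis by (simp add: c_def c'_def f_def g_def)
  qed
  \<comment> \<open>A curve common to both states would have a trace without \<open>a\<close> and
    \<open>b\<close>, so \<open>h\<close> lies outside \<open>M\<close>; its cycle then cannot meet
    that of \<open>k\<close>, which lies inside.\<close>
  have differ: "c (Inl h) \<noteq> c' (Inl k)" if hk: "h \<in> halves F" "k \<in> halves F" "h \<in> M \<or> k \<in> M" for h k
  proof
    assume "c (Inl h) = c' (Inl k)"
    note m = curve_eq_meet[OF W W' hk(1,2) this[unfolded c_def c'_def], folded f_def g_def]
    from m(2) have "a \<notin> orbit f h" "b \<notin> orbit f h" using ab(4,5) U by blast+
    then have h: "h \<notin> M" using ef(3)[of _ h] unfolding M_def by blast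
    from m(1) obtain x where x: "x \<in> orbit f h" "x \<in> orbit g k" by blast
    have "k \<in> M" using h hk by blast
    then have "x \<in> M" using x(2) eg(2) unfolding M_def t(2)[symmetric] by (metis Un_iff)
    then show False using x(1) h ef(2) unfolding M_def by (metis Un_iff)
  qed
  have outside: "c (Inl h) \<noteq> c' (Inr v)" "c' (Inl h) \<noteq> c (Inr v)" if "h \<in> halves F" "Inr v \<in> points F" for h v
    using curve_Inl_neq_Inr[OF that] unfolding c_def c'_def by blast+
  have lone: "c (Inr v) = c' (Inr v)" for v by (simp add: c_def c'_def)
  have P: "\<And>p. p \<in> points F \<Longrightarrow> (\<exists>h\<in>halves F. p = Inl h) \<or> (\<exists>v. p = Inr v)"
    "\<And>h. h \<in> halves F \<Longrightarrow> Inl h \<in> points F" by (auto simp: points_def)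
  have abM: "a \<in> M" "b \<in> M" using ef(1) unfolding M_def by blast+
  have mixed: "c (Inl a) \<notin> c' ` points F" "c (Inl b) \<notin> c' ` points F"
    "c' (Inl a) \<notin> c ` points F" "c' (Inl b) \<notin> c ` points F"
  proof -
    have "c (Inl k) \<notin> c' ` points F" "c' (Inl k) \<notin> c ` points F" if k: "k \<in> halves F" "k \<in> M" for k
    proof -
      have "c (Inl k) \<noteq> c' p \<and> c' (Inl k) \<noteq> c p" if "p \<in> points F" for p
        using P(1)[OF that]
      proof (elim disjE bexE exE)
        fix h assume "h \<in> halves F" "p = Inl h"
        then show ?thesis using differ[of k h] differ[of h k] k by metis
      next
        fix v assume "p = Inr v"
        then show ?thesis using outside[OF k(1), of v] that by metis
      qed
      then show "c (Inl k) \<notin> c' ` points F" "c' (Inl k) \<notin> c ` points F" by auto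
    qed
    then show "c (Inl a) \<notin> c' ` points F" "c (Inl b) \<notin> c' ` points F"
      "c' (Inl a) \<notin> c ` points F" "c' (Inl b) \<notin> c ` points F" using ab abM by simp_all
  qed
  have "joins (points F) c c' (Inl a) (Inl b)" if "c (Inl a) \<noteq> c (Inl b)"
  proof -
    have eq: "c' (Inl a) = c' (Inl b)" using that t(1) cc ab by metis
    have "c' p = (if c p \<in> {c (Inl a), c (Inl b)} then c' (Inl a) else c p)" if p: "p \<in> points F" for p
    proof -
      consider h where "h \<in> halves F" "p = Inl h" | v where "p = Inr v" using P(1)[OF p] by blast
      then show ?thesis
      proof cases
        case 1 then show ?thesis using M1[of h] M2[of h] same[of h] eq by auto
      next
        case 2
        then have eq: "c p = c' p" using lone by blast
        have "c p \<in> c' ` points F" "c' p \<in> c ` points F"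
          using imageI[OF p, of c] imageI[OF p, of c'] unfolding eq by blast+
        then have "c p \<noteq> c (Inl a)" "c p \<noteq> c (Inl b)" "c' p \<noteq> c' (Inl a)" "c' p \<noteq> c' (Inl b)"
          using mixed by metis+
        note this eq
        then show ?thesis by simp
      qed
    qed
    then show ?thesis unfolding joins_def using that mixed P(2) ab by blast
  qed
  moreover have "joins (points F) c' c (Inl a) (Inl b)" if "c (Inl a) = c (Inl b)"
  proof -
    have eq: "c' (Inl a) \<noteq> c' (Inl b)" using that t(1) cc ab by metis
    have "c p = (if c' p \<in> {c' (Inl a), c' (Inl b)} then c (Inl a) else c' p)" if p: "p \<in> points F" for p
    proof -
      consider h where "h \<in> halves F" "p = Inl h" | v where "p = Inr v" using P(1)[OF p] by blast
      then show ?thesis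
      proof cases
        case 1 then show ?thesis using M1[of h] M2[of h] same[of h] \<open>c (Inl a) = c (Inl b)\<close> by auto
      next
        case 2
        then have eq: "c p = c' p" using lone by blast
        have "c p \<in> c' ` points F" "c' p \<in> c ` points F"
          using imageI[OF p, of c] imageI[OF p, of c'] unfolding eq by blast+
        then have "c p \<noteq> c (Inl a)" "c p \<noteq> c (Inl b)" "c' p \<noteq> c' (Inl a)" "c' p \<noteq> c' (Inl b)"
          using mixed by metis+
        note this eq
        then show ?thesis by simp
      qed
    qed
    then show ?thesis unfolding joins_def using eq mixed P(2) ab by blast
  qed
  ultimately show ?thesis unfolding surgery_def c_def c'_def W'_def b_def by blast
qed

end



section \<open>Components, boundary components and genus\<close>

lemma rtrancl_insert_edge:
  assumes "sym r" "(x, y) \<in> (r \<union> {(u, v), (v, u)})\<^sup>*"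
  shows "(x, y) \<in> r\<^sup>* \<or> (x \<in> r\<^sup>* `` {u} \<union> r\<^sup>* `` {v} \<and> y \<in> r\<^sup>* `` {u} \<union> r\<^sup>* `` {v})"
  using assms(2)
proof induction
  case base then show ?case by blast
next
  case (step y z)
  have s: "(a, b) \<in> r\<^sup>* \<longleftrightarrow> (b, a) \<in> r\<^sup>*" for a b
    using sym_rtrancl[OF assms(1)] by (meson symD)
  from step.hyps(2) have "(y, z) \<in> r\<^sup>* \<or> (y = u \<and> z = v) \<or> (y = v \<and> z = u)" by blast
  then show ?case
  proof (elim disjE conjE)
    assume "(y, z) \<in> r\<^sup>*"
    then show ?thesis using step.IH rtrancl_trans[of _ y r z] by blast
  next
    assume "y = u" "z = v"
    then show ?thesis using step.IH s[of x u] by blast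
  next
    assume "y = v" "z = u"
    then show ?thesis using step.IH s[of x v] by blast
  qed
qed

text \<open>If the ends are not yet connected, the class maps before and after the insertion are
  related by \<open>joins\<close>, so the counting device for boundary curves applies to components
  as well.\<close>

lemma card_quotient_insert_edge:
  assumes "finite V" "sym r" and uv: "u \<in> V" "v \<in> V" and r'_def: "r' = r \<union> {(u, v), (v, u)}"
  shows "(u, v) \<in> r\<^sup>* \<Longrightarrow> V // (r'\<^sup>* \<inter> V \<times> V) = V // (r\<^sup>* \<inter> V \<times> V)"
    and "(u, v) \<notin> r\<^sup>* \<Longrightarrow> card (V // (r\<^sup>* \<inter> V \<times> V)) = Suc (card (V // (r'\<^sup>* \<inter> V \<times> V)))"
proof -
  have s: "(a, b) \<in> r\<^sup>* \<longleftrightarrow> (b, a) \<in> r\<^sup>*" for a b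
    using sym_rtrancl[OF assms(2)] by (meson symD)
  have mono: "r\<^sup>* \<subseteq> r'\<^sup>*" unfolding r'_def by (intro rtrancl_mono) blast
  have uv': "(u, v) \<in> r'\<^sup>*" "(v, u) \<in> r'\<^sup>*" unfolding r'_def by auto
  show "V // (r'\<^sup>* \<inter> V \<times> V) = V // (r\<^sup>* \<inter> V \<times> V)" if "(u, v) \<in> r\<^sup>*"
  proof -
    have "r' \<subseteq> r\<^sup>*" using that s[of u v] by (auto simp: r'_def)
    then have "r'\<^sup>* = r\<^sup>*" using mono rtrancl_subset_rtrancl by blast
    then show ?thesis by simp
  qed
  assume not: "(u, v) \<notin> r\<^sup>*"
  define c where "c = (\<lambda>x. (r\<^sup>* \<inter> V \<times> V) `` {x})"
  define c' where "c' = (\<lambda>x. (r'\<^sup>* \<inter> V \<times> V) `` {x})"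
  have img: "V // (r\<^sup>* \<inter> V \<times> V) = c ` V" "V // (r'\<^sup>* \<inter> V \<times> V) = c' ` V"
    by (auto simp: quotient_def c_def c'_def)
  have c: "y \<in> c x \<longleftrightarrow> y \<in> V \<and> (x, y) \<in> r\<^sup>*" if "x \<in> V" for x y using that by (auto simp: c_def)
  have ceq: "c x = c y \<longleftrightarrow> (x, y) \<in> r\<^sup>*" if "x \<in> V" "y \<in> V" for x y
  proof
    assume "c x = c y"
    moreover have "y \<in> c y" using c that by simp
    ultimately show "(x, y) \<in> r\<^sup>*" using c that by blast
  next
    assume "(x, y) \<in> r\<^sup>*"
    then show "c x = c y" using c[OF that(1)] c[OF that(2)] s[of x y] rtrancl_trans[of _ _ r] by blast
  qed
  have c': "c' x = (if c x \<in> {c u, c v} then c u \<union> c v else c x)" if x: "x \<in> V" for x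
  proof -
    have "y \<in> c' x \<longleftrightarrow> y \<in> V \<and> (x, y) \<in> r'\<^sup>*" for y using x by (auto simp: c'_def)
    moreover have "(x, y) \<in> r'\<^sup>* \<longleftrightarrow> (x, y) \<in> r\<^sup>* \<or>
       ((x, u) \<in> r\<^sup>* \<or> (x, v) \<in> r\<^sup>*) \<and> ((u, y) \<in> r\<^sup>* \<or> (v, y) \<in> r\<^sup>*)" for y
    proof
      assume "(x, y) \<in> r'\<^sup>*"
      from rtrancl_insert_edge[OF assms(2) this[unfolded r'_def]]
      show "(x, y) \<in> r\<^sup>* \<or> ((x, u) \<in> r\<^sup>* \<or> (x, v) \<in> r\<^sup>*) \<and> ((u, y) \<in> r\<^sup>* \<or> (v, y) \<in> r\<^sup>*)"
        using s[of x] by blast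
    next
      assume "(x, y) \<in> r\<^sup>* \<or> ((x, u) \<in> r\<^sup>* \<or> (x, v) \<in> r\<^sup>*) \<and> ((u, y) \<in> r\<^sup>* \<or> (v, y) \<in> r\<^sup>*)"
      then show "(x, y) \<in> r'\<^sup>*"
        using mono uv' by (meson rtrancl_trans subsetD)
    qed
    ultimately have y: "y \<in> c' x \<longleftrightarrow> y \<in> V \<and> ((x, y) \<in> r\<^sup>* \<or>
       ((x, u) \<in> r\<^sup>* \<or> (x, v) \<in> r\<^sup>*) \<and> ((u, y) \<in> r\<^sup>* \<or> (v, y) \<in> r\<^sup>*))" for y by blast
    have C: "c x \<in> {c u, c v} \<longleftrightarrow> (x, u) \<in> r\<^sup>* \<or> (x, v) \<in> r\<^sup>*" using ceq x uv by blast
    have tr: "(x, y) \<in> r\<^sup>* \<Longrightarrow> (x, z) \<in> r\<^sup>* \<Longrightarrow> (z, y) \<in> r\<^sup>*" for y z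
      using s[of x z] rtrancl_trans by metis
    show ?thesis
    proof (cases "c x \<in> {c u, c v}")
      case True
      then have "y \<in> c' x \<longleftrightarrow> y \<in> V \<and> ((u, y) \<in> r\<^sup>* \<or> (v, y) \<in> r\<^sup>*)" for y
        using y[of y] C tr by blast
      then show ?thesis using True c[OF uv(1)] c[OF uv(2)] by auto
    next
      case False
      then have "y \<in> c' x \<longleftrightarrow> y \<in> V \<and> (x, y) \<in> r\<^sup>*" for y
        using y[of y] C by blast
      then show ?thesis using False c[OF x] by auto
    qed
  qed
  have cself: "x \<in> c x" if "x \<in> V" for x using c that by simp
  have cu: "c u \<noteq> c v" using not ceq uv by blast
  have c'u: "c' u = c u \<union> c v" using c'[OF uv(1)] by simp
  \<comment> \<open>No class contains both \<open>u\<close> and \<open>v\<close>, so the united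
    class is a new one.\<close>
  have un: "c u \<union> c v \<noteq> c x" if "x \<in> V" for x
  proof
    assume *: "c u \<union> c v = c x"
    then have "u \<in> c x" "v \<in> c x" using cself uv by blast+
    then show False using cu c[OF that] ceq[OF that] uv by metis
  qed
  have notin: "c u \<noteq> c' x \<and> c v \<noteq> c' x" if "x \<in> V" for x
    using c'[OF that] un[OF uv(1)] un[OF uv(2)] by (auto split: if_splits)
  have "joins V c c' u v"
    unfolding joins_def c'u using uv cu un notin c' by blast
  then show "card (V // (r\<^sup>* \<inter> V \<times> V)) = Suc (card (V // (r'\<^sup>* \<inter> V \<times> V)))"
    unfolding img by (rule joins_card[OF _ \<open>finite V\<close>])
qed

lemma num_components_empty: "finite V \<Longrightarrow> num_components V {} ends = card V"
proof -
  have "V // ({}\<^sup>* \<inter> V \<times> V) = (\<lambda>x. {x}) ` V" by (auto simp: quotient_def)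
  then show ?thesis by (simp add: num_components_def card_image)
qed

definition adjacent :: "('v, 'h) fatgraph \<Rightarrow> 'h set set \<Rightarrow> ('v \<times> 'v) set" where
  "adjacent F W = {(u, v). u \<in> verts F \<and> v \<in> verts F \<and> (\<exists>e\<in>W. vert F ` e = {u, v})}"

abbreviation state_components :: "('v, 'h) fatgraph \<Rightarrow> 'h set set \<Rightarrow> nat" where
  "state_components F W \<equiv> num_components (verts F) W (\<lambda>e. vert F ` e)"

lemma state_components_alt:
  "state_components F W = card (verts F // ((adjacent F W)\<^sup>* \<inter> verts F \<times> verts F))"
  by (simp add: num_components_def adjacent_def)

lemma sym_adjacent: "sym (adjacent F W)"
  by (auto simp: sym_def adjacent_def insert_commute)

lemma adjacent_insert:
  "u \<in> verts F \<Longrightarrow> v \<in> verts F \<Longrightarrow> vert F ` e = {u, v} \<Longrightarrow>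
    adjacent F (insert e W) = adjacent F W \<union> {(u, v), (v, u)}"
  by (auto simp: adjacent_def doubleton_eq_iff)

context fatgraph
begin

lemma state_perm_connected:
  assumes "W \<subseteq> edges F" "h \<in> halves F"
  shows "(vert F h, vert F (state_perm F W h)) \<in> (adjacent F W)\<^sup>*"
proof (cases "h \<in> \<Union>W")
  case True
  then obtain e where e: "e \<in> W" "h \<in> e" by blast
  then have "e = {h, opp F h}" using edge_cases assms by blast
  then have "vert F ` e = {vert F h, vert F (opp F h)}" by blast
  then have "(vert F h, vert F (opp F h)) \<in> adjacent F W"
    using e vert_in opp_in assms(2) unfolding adjacent_def by blast
  then show ?thesis using True assms opp_in vert_nxt by (auto simp: state_perm_def)
next
  case False then show ?thesis using assms vert_nxt by (simp add: state_perm_def)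
qed

text \<open>A boundary curve stays within one component; this will show that a deletion joining two
  curves does not disconnect.\<close>

lemma curve_connected:
  assumes W: "W \<subseteq> edges F" and h: "h \<in> halves F" and "k \<in> orbit (state_perm F W) h"
  shows "(vert F h, vert F k) \<in> (adjacent F W)\<^sup>*"
  using assms(3)
proof induction
  case base show ?case by (rule state_perm_connected[OF W h])
next
  case (step y)
  then have "y \<in> halves F" using orbit_in_halves[OF W h] by blast
  then show ?case using step.IH state_perm_connected[OF W, of y] by (meson rtrancl_trans)
qed

lemma adjacent_delete:
  assumes W: "W \<subseteq> edges F" and e: "{a, opp F a} \<in> W"
  shows "adjacent F W = adjacent F (W - {{a, opp F a}}) \<union>
    {(vert F a, vert F (opp F a)), (vert F (opp F a), vert F a)}"
proof -
  have "a \<in> halves F" using W e edge_cases by blast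
  then have v: "vert F a \<in> verts F" "vert F (opp F a) \<in> verts F" using vert_in opp_in by auto
  have "W = insert {a, opp F a} (W - {{a, opp F a}})" using e by blast
  then have "adjacent F W = adjacent F (insert {a, opp F a} (W - {{a, opp F a}}))" by (rule arg_cong)
  also have "\<dots> = adjacent F (W - {{a, opp F a}}) \<union>
    {(vert F a, vert F (opp F a)), (vert F (opp F a), vert F a)}"
    by (rule adjacent_insert[OF v]) simp
  finally show ?thesis .
qed

text \<open>When two curves are joined, both ends of the deleted edge lie on one curve afterwards,
  hence in one component, and the number of components is unchanged. A split leaves two
  possibilities: either the edge was separating, or the genus falls.\<close>

lemma state_step:
  assumes W: "W \<subseteq> edges F" and e: "{a, opp F a} \<in> W" and W'_def: "W' = W - {{a, opp F a}}"
  shows "curve F W (Inl a) \<noteq> curve F W (Inl (opp F a)) \<Longrightarrow>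
      state_components F W' = state_components F W \<and>
      card (curve F W ` points F) = Suc (card (curve F W' ` points F))"
    and "curve F W (Inl a) = curve F W (Inl (opp F a)) \<Longrightarrow>
      (state_components F W' = state_components F W \<or>
       state_components F W' = Suc (state_components F W)) \<and>
      card (curve F W' ` points F) = Suc (card (curve F W ` points F))"
proof -
  have W': "W' \<subseteq> edges F" using W by (auto simp: W'_def)
  have a: "a \<in> halves F" "opp F a \<in> halves F" using W e edge_cases by blast+
  then have v: "vert F a \<in> verts F" "vert F (opp F a) \<in> verts F" using vert_in by auto
  note s = surgery_delete[OF W e, folded W'_def]
  note q = card_quotient_insert_edge[OF finite_verts sym_adjacent v adjacent_delete[OF W e], folded W'_def]
  have k: "state_components F W' = state_components F W \<or>
       (state_components F W' = Suc (state_components F W) \<and> 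
        (vert F a, vert F (opp F a)) \<notin> (adjacent F W')\<^sup>*)"
    unfolding state_components_alt using q by metis
  {
    assume ne: "curve F W (Inl a) \<noteq> curve F W (Inl (opp F a))"
    note j = surgery_joins(1)[OF s ne]
    have "curve F W' (Inl (opp F a)) = curve F W' (Inl a)" using joinsD(4)[OF j] by simp
    then have "opp F a \<in> orbit (state_perm F W') a" using curve_eq_iff[OF W' a(2,1)] by blast
    then have "(vert F a, vert F (opp F a)) \<in> (adjacent F W')\<^sup>*" by (rule curve_connected[OF W' a(1)])
    then show "state_components F W' = state_components F W \<and>
      card (curve F W ` points F) = Suc (card (curve F W' ` points F))"
      using k joins_card[OF j finite_points] by blast
  next
    assume eq: "curve F W (Inl a) = curve F W (Inl (opp F a))"
    show "(state_components F W' = state_components F W \<or>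
       state_components F W' = Suc (state_components F W)) \<and>
      card (curve F W' ` points F) = Suc (card (curve F W ` points F))"
      using k joins_card[OF surgery_joins(2)[OF s eq] finite_points] by blast
  }
qed

lemma curve_empty: "curve F {} ` points F = Isolated ` verts F"
proof -
  have "curve F {} ` points F =
      (\<lambda>h. Isolated (vert F h)) ` halves F \<union> Isolated ` (verts F - vert F ` halves F)"
    unfolding points_def image_Un image_image by simp
  also have "\<dots> = Isolated ` (vert F ` halves F \<union> (verts F - vert F ` halves F))"
    unfolding image_Un image_image ..
  also have "vert F ` halves F \<union> (verts F - vert F ` halves F) = verts F" using vert_in by blast
  finally show ?thesis .
qed

text \<open>The witness \<open>g\<close> shows at once that the subtraction in \<open>genus\<close>
  is not truncated and that the division by 2 is exact.\<close>

lemma euler_formula_aux: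
  assumes "W \<subseteq> edges F"
  shows "\<exists>g. 2 * state_components F W + card W = v_num F + card (curve F W ` points F) + 2 * g"
proof -
  have "finite W" using assms finite_edges finite_subset by blast
  then show ?thesis using assms
  proof (induction W)
    case empty
    have "card (curve F {} ` points F) = card (verts F)"
      unfolding curve_empty by (rule card_image) (auto simp: inj_on_def)
    then show ?case by (simp add: num_components_empty[OF finite_verts] v_num_def)
  next
    case (insert e W)
    obtain a where a: "e = {a, opp F a}" using insert.prems by (auto elim: edge_obtain)
    have W: "W = insert e W - {{a, opp F a}}" using insert.hyps a by auto
    note st = state_step[OF insert.prems _ W, unfolded a, OF insertI1]
    from insert obtain g where
      g: "2 * state_components F W + card W = v_num F + card (curve F W ` points F) + 2 * g" by auto
    have c: "card (insert e W) = Suc (card W)" using insert.hyps by simp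
    show ?case
    proof (cases "curve F (insert e W) (Inl a) = curve F (insert e W) (Inl (opp F a))")
      case False
      then show ?thesis using st(1) g c unfolding a by (intro exI[of _ g]) auto
    next
      case True
      from st(2)[OF this[unfolded a]] show ?thesis
      proof (elim conjE disjE)
        assume "state_components F W = state_components F (insert {a, opp F a} W)"
          "card (curve F W ` points F) = Suc (card (curve F (insert {a, opp F a} W) ` points F))"
        \<comment> \<open>The only case in which the larger state has one more handle: the deletion
          splits a curve without disconnecting.\<close>
        then show ?thesis using g c unfolding a by (intro exI[of _ "Suc g"]) auto
      next
        assume "state_components F W = Suc (state_components F (insert {a, opp F a} W))"
          "card (curve F W ` points F) = Suc (card (curve F (insert {a, opp F a} W) ` points F))"
        then show ?thesis using g c unfolding a by (intro exI[of _ g]) auto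
      qed
    qed
  qed
qed

section \<open>Boundary components of a state as curves of its permutation\<close>

lemma edges_spanning: "W \<subseteq> edges F \<Longrightarrow> edges (spanning_subgraph F W) = W"
proof -
  assume W: "W \<subseteq> edges F"
  have "{h, opp F h} \<in> W" if "h \<in> e" "e \<in> W" for h e
    using edge_cases[of e h] that W by auto
  moreover have "\<exists>h\<in>\<Union>W. e = {h, opp F h}" if "e \<in> W" for e
  proof -
    have "e \<in> edges F" using that W by blast
    then obtain a where "a \<in> halves F" "e = {a, opp F a}" by (rule edge_obtain)
    then show ?thesis using that by blast
  qed
  ultimately show ?thesis unfolding edges_def spanning_subgraph_def by (simp, blast)
qed

text \<open>After crossing its edge, \<open>state_perm\<close> walks around the vertex with
  \<open>nxt F\<close> until it meets a half-edge of the state; this first return is the successor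
  in the spanning subgraph.\<close>

lemma spanning_nxt:
  assumes W: "W \<subseteq> edges F" and h: "h \<in> \<Union>W"
  defines "H \<equiv> spanning_subgraph F W"
  obtains n where "0 < n" "nxt H (opp H h) = (state_perm F W ^^ n) h" "(state_perm F W ^^ n) h \<in> \<Union>W"
    "\<And>m. 0 < m \<Longrightarrow> m < n \<Longrightarrow> (state_perm F W ^^ m) h \<notin> \<Union>W"
proof -
  define k where "k = opp F h"
  have hk: "h \<in> halves F" "k \<in> halves F" "k \<in> \<Union>W"
    using Union_state[OF W] h opp_in opp_state[OF W h] by (auto simp: k_def)
  \<comment> \<open>The same least number as in \<open>spanning_subgraph\<close>, taken at the far
    end \<open>k\<close> of the edge.\<close>
  define n where "n = (LEAST n. n > 0 \<and> (nxt F ^^ n) k \<in> \<Union>W)"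
  have "k \<in> orbit (nxt F) k" using nxt_orbit[OF hk(2)] hk(2) by simp
  then obtain j where j: "0 < j" "(nxt F ^^ j) k = k" by (auto simp: orbit_altdef)
  then have n: "0 < n" "(nxt F ^^ n) k \<in> \<Union>W"
    using LeastI[of "\<lambda>n. n > 0 \<and> (nxt F ^^ n) k \<in> \<Union>W" j] hk(3) unfolding n_def by auto
  have least: "(nxt F ^^ m) k \<notin> \<Union>W" if "0 < m" "m < n" for m
    using not_less_Least[of m "\<lambda>n. n > 0 \<and> (nxt F ^^ n) k \<in> \<Union>W"] that unfolding n_def by auto
  have "0 < m \<Longrightarrow> m \<le> n \<Longrightarrow> (state_perm F W ^^ m) h = (nxt F ^^ m) k \<and> (nxt F ^^ m) k \<in> halves F" for m
  proof (induction m)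
    case (Suc m)
    show ?case
    proof (cases "m = 0")
      case True then show ?thesis using h hk nxt_in by (simp add: state_perm_def k_def)
    next
      case False then show ?thesis using Suc least[of m] nxt_in by (simp add: state_perm_def)
    qed
  qed simp
  then have eq: "(state_perm F W ^^ m) h = (nxt F ^^ m) k" if "0 < m" "m \<le> n" for m using that by blast
  show thesis
  proof (rule that[OF n(1)])
    have "nxt H (opp H h) = (nxt F ^^ n) k"
      by (simp add: H_def spanning_subgraph_def n_def k_def)
    then show "nxt H (opp H h) = (state_perm F W ^^ n) h" using eq n by simp
    show "(state_perm F W ^^ n) h \<in> \<Union>W" using eq n by simp
    show "(state_perm F W ^^ m) h \<notin> \<Union>W" if "0 < m" "m < n" for m using eq least that by simp
  qed
qed

text \<open>The boundary walk of the subgraph is the first-return map of \<open>state_perm\<close>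
  to the half-edges of the state, and a cycle of such a map is the trace of a cycle.\<close>

lemma spanning_orbit:
  assumes W: "W \<subseteq> edges F" and h: "h \<in> \<Union>W"
  defines "H \<equiv> spanning_subgraph F W"
  shows "orbit (nxt H \<circ> opp H) h = orbit (state_perm F W) h \<inter> \<Union>W"
proof -
  let ?s = "state_perm F W" and ?r = "nxt H \<circ> opp H"
  have 1: "y \<in> orbit ?s h \<inter> \<Union>W" if "y \<in> orbit ?r h" for y
    using that
  proof induction
    case base
    obtain n where "0 < n" "?r h = (?s ^^ n) h" "(?s ^^ n) h \<in> \<Union>W"
      using spanning_nxt[OF W h] unfolding H_def comp_def by metis
    then show ?case by (auto simp: orbit_altdef)
  next
    case (step y)
    then have y: "y \<in> \<Union>W" "y \<in> orbit ?s h" by auto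
    obtain n where n: "0 < n" "?r y = (?s ^^ n) y" "(?s ^^ n) y \<in> \<Union>W"
      using spanning_nxt[OF W y(1)] unfolding H_def comp_def by metis
    then show ?case using funpow_in_orbit[OF y(2), of n] by simp
  qed
  \<comment> \<open>A return at time \<open>m\<close> is reached by successive first returns, whence
    the induction on \<open>m\<close>.\<close>
  have 2: "(?s ^^ m) x \<in> orbit ?r x" if "0 < m" "x \<in> \<Union>W" "(?s ^^ m) x \<in> \<Union>W" for m x
    using that
  proof (induction m arbitrary: x rule: less_induct)
    case (less m)
    obtain n where n: "0 < n" "?r x = (?s ^^ n) x" "(?s ^^ n) x \<in> \<Union>W"
        "\<And>m. 0 < m \<Longrightarrow> m < n \<Longrightarrow> (?s ^^ m) x \<notin> \<Union>W"
      using spanning_nxt[OF W less.prems(2)] unfolding H_def comp_def by metis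
    consider "m < n" | "m = n" | "n < m" by linarith
    then show ?case
    proof cases
      case 1 then show ?thesis using n(4) less.prems by blast
    next
      case 2 then show ?thesis using n(2) orbit.base[of ?r x] unfolding comp_apply by metis
    next
      case 3
      have "(?s ^^ (m - n)) ((?s ^^ n) x) = (?s ^^ m) x"
        using 3 by (metis add_diff_inverse_nat add.commute funpow_add comp_apply less_imp_le_nat not_less)
      moreover have "(?s ^^ (m - n)) ((?s ^^ n) x) \<in> orbit ?r ((?s ^^ n) x)"
        using n(1,3) 3 less.prems(3) calculation by (intro less.IH) auto
      ultimately have "(?s ^^ m) x \<in> orbit ?r (?r x)" unfolding n(2) by metis
      then show ?thesis by (rule orbit_subset)
    qed
  qed
  have "y \<in> orbit ?r h" if y: "y \<in> orbit ?s h" "y \<in> \<Union>W" for y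
  proof -
    obtain m where "y = (?s ^^ m) h" "0 < m" using y(1) unfolding orbit_altdef by blast
    then show ?thesis using 2[of m h] h y(2) by metis
  qed
  then show ?thesis using 1 by blast
qed

text \<open>This links the definition to the permutations. A vertex isolated in the state appears as
  a cycle that misses the state if it has half-edges in \<open>F\<close>, and as a point
  \<open>Inr v\<close> otherwise.\<close>

lemma boundaries_spanning:
  assumes W: "W \<subseteq> edges F"
  shows "boundaries (spanning_subgraph F W) = curve F W ` points F"
proof -
  let ?H = "spanning_subgraph F W" and ?s = "state_perm F W"
  have HH: "halves ?H = \<Union>W" "verts ?H = verts F" "vert ?H = vert F" by (simp_all add: spanning_subgraph_def)
  have cyc: "curve F W (Inl h) = Cycle (orbit (nxt ?H \<circ> opp ?H) h)" if "h \<in> \<Union>W" for h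
  proof -
    have "h \<in> orbit ?s h" using state_orbit(1)[OF W] .
    then have "orbit ?s h \<inter> \<Union>W \<noteq> {}" using that by blast
    then show ?thesis unfolding spanning_orbit[OF W that] by simp
  qed
  have iso: "\<exists>v\<in>verts F - vert F ` \<Union>W. curve F W (Inl h) = Isolated v"
    if h: "h \<in> halves F" "orbit ?s h \<inter> \<Union>W = {}" for h
  proof -
    have "vert F h \<notin> vert F ` \<Union>W"
      using orbit_at_isolated[OF W h] h(2) Union_state[OF W] by fastforce
    then show ?thesis using h vert_in by simp
  qed
  have meet: "\<exists>k\<in>\<Union>W. curve F W (Inl h) = curve F W (Inl k)"
    if h: "h \<in> halves F" "orbit ?s h \<inter> \<Union>W \<noteq> {}" for h
  proof -
    obtain k where "k \<in> orbit ?s h" "k \<in> \<Union>W" using h(2) by blast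
    then show ?thesis using curve_eq_iff[OF W _ h(1), of k] Union_state[OF W] by (metis subsetD)
  qed
  show ?thesis
  proof
    show "boundaries ?H \<subseteq> curve F W ` points F"
    proof
      fix b assume "b \<in> boundaries ?H"
      then consider v where "v \<in> verts F" "v \<notin> vert F ` \<Union>W" "b = Isolated v"
        | h where "h \<in> \<Union>W" "b = Cycle (orbit (nxt ?H \<circ> opp ?H) h)"
        unfolding boundaries_def HH by blast
      then show "b \<in> curve F W ` points F"
      proof cases
        case (1 v)
        show ?thesis
        proof (cases "v \<in> vert F ` halves F")
          case True
          then obtain h where h: "h \<in> halves F" "vert F h = v" by blast
          have "orbit ?s h \<inter> \<Union>W = {}"
          proof (rule ccontr)
            have n: "k \<in> halves F \<and> vert F k = v" if "k \<in> orbit ?s h" for k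
              using that
            proof induction
              case base
              then show ?case using h 1 vert_nxt nxt_in by (auto simp: state_perm_def)
            next
              case (step y)
              then have "y \<notin> \<Union>W" using 1 by blast
              then show ?case using step.IH vert_nxt nxt_in by (auto simp: state_perm_def)
            qed
            assume "orbit ?s h \<inter> \<Union>W \<noteq> {}"
            then show False using n 1(2) by blast
          qed
          then have "curve F W (Inl h) = b" using h 1 by simp
          moreover have "Inl h \<in> points F" using h by (simp add: points_def)
          ultimately show ?thesis by blast
        next
          case False
          then have "Inr v \<in> points F" "curve F W (Inr v) = b" using 1 by (auto simp: points_def)
          then show ?thesis by blast
        qed
      next
        case (2 h)
        then have "Inl h \<in> points F" using Union_state[OF W] by (auto simp: points_def)
        moreover have "curve F W (Inl h) = b" using cyc[OF 2(1)] 2(2) by metis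
        ultimately show ?thesis by blast
      qed
    qed
    show "curve F W ` points F \<subseteq> boundaries ?H"
    proof (rule image_subsetI)
      fix p assume "p \<in> points F"
      then consider h where "h \<in> halves F" "p = Inl h" | v where "v \<in> verts F" "v \<notin> vert F ` halves F" "p = Inr v"
        by (auto simp: points_def)
      then show "curve F W p \<in> boundaries ?H"
      proof cases
        case 1
        show ?thesis
        proof (cases "orbit ?s h \<inter> \<Union>W = {}")
          case True
          from iso[OF 1(1) this] show ?thesis unfolding boundaries_def HH 1(2) by blast
        next
          case False
          then obtain k where k: "k \<in> \<Union>W" "curve F W p = curve F W (Inl k)"
            using meet[OF 1(1)] 1(2) by blast
          show ?thesis unfolding k(2) cyc[OF k(1)] boundaries_def HH using k(1) by blast
        qed
      next
        case 2
        then have "v \<in> verts F - vert F ` \<Union>W" using Union_state[OF W] by blast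
        then show ?thesis using 2(3) unfolding boundaries_def HH by simp
      qed
    qed
  qed
qed

lemma height_state: "W \<subseteq> edges F \<Longrightarrow> height F W = e_num F - card W"
  by (simp add: height_def e_num_def edges_spanning)

lemma height_delete:
  assumes "W \<subseteq> edges F" "e \<in> W"
  shows "height F (W - {e}) = Suc (height F W)"
proof -
  have "finite W" using assms finite_edges finite_subset by blast
  then have "card W = Suc (card (W - {e}))" using assms(2) by (intro card.remove)
  moreover have "card W \<le> e_num F" using assms finite_edges by (simp add: e_num_def card_mono)
  moreover have "W - {e} \<subseteq> edges F" using assms by blast
  ultimately show ?thesis using height_state assms(1) by simp
qed

lemma euler_formula:
  assumes "W \<subseteq> edges F"
  shows "2 * state_components F W + card W =
    v_num F + card (curve F W ` points F) + 2 * genus (spanning_subgraph F W)"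
proof -
  obtain g where g: "2 * state_components F W + card W = v_num F + card (curve F W ` points F) + 2 * g"
    using euler_formula_aux[OF assms] by blast
  have "k_num (spanning_subgraph F W) = state_components F W"
    unfolding k_num_def edges_spanning[OF assms] by (simp add: spanning_subgraph_def)
  then have "genus (spanning_subgraph F W) = g"
    unfolding genus_def p_num_def boundaries_spanning[OF assms] e_num_def edges_spanning[OF assms]
    using g by (simp add: v_num_def spanning_subgraph_def)
  then show ?thesis using g by simp
qed

text \<open>By Euler's formula, the genus falls exactly when a curve is split and the number of
  components stays the same; otherwise it is unchanged.\<close>

lemma genus_delete:
  assumes W: "W \<subseteq> edges F" and e: "e \<in> W"
  shows "genus (spanning_subgraph F (W - {e})) = genus (spanning_subgraph F W) \<or>
    genus (spanning_subgraph F W) = Suc (genus (spanning_subgraph F (W - {e})))"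
proof -
  obtain a where a: "e = {a, opp F a}" using W e by (auto elim: edge_obtain)
  have "finite W" using assms finite_edges finite_subset by blast
  then have "card W = Suc (card (W - {e}))" using e by (intro card.remove)
  moreover have "W - {e} \<subseteq> edges F" using W by blast
  ultimately have eq: "2 * state_components F W + Suc (card (W - {e})) =
      v_num F + card (curve F W ` points F) + 2 * genus (spanning_subgraph F W)"
    "2 * state_components F (W - {e}) + card (W - {e}) =
      v_num F + card (curve F (W - {e}) ` points F) + 2 * genus (spanning_subgraph F (W - {e}))"
    using euler_formula[OF W] euler_formula[of "W - {e}"] by simp_all
  note st = state_step[OF W e[unfolded a] refl, folded a]
  show ?thesis
  proof (cases "curve F W (Inl a) = curve F W (Inl (opp F a))")
    case True
    from st(2)[OF True] show ?thesis by (elim conjE disjE) (use eq in linarith)+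
  next
    case False
    from st(1)[OF False] show ?thesis using eq by linarith
  qed
qed

end



section \<open>Linear extension\<close>

lemma frag_extend_extend:
  "frag_extend f (frag_extend g z) = frag_extend (\<lambda>x. frag_extend f (g x)) z"
  using subset_UNIV by (induction z rule: frag_induction) (auto simp: frag_extend_diff)

lemma frag_extend_diff_fun: "frag_extend (\<lambda>x. f x - g x) z = frag_extend f z - frag_extend g z"
  using subset_UNIV by (induction z rule: frag_induction) (auto simp: frag_extend_diff)

lemma frag_extend_zero_fun [simp]: "frag_extend (\<lambda>x. 0) z = 0"
  by (simp add: frag_extend_eq_0)

lemma frag_extend_swap:
  "frag_extend (\<lambda>x. frag_extend (\<lambda>y. f x y) Y) X = frag_extend (\<lambda>y. frag_extend (\<lambda>x. f x y) X) Y"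
  using subset_UNIV
  by (induction X rule: frag_induction) (auto simp: frag_extend_diff frag_extend_diff_fun)

lemma frag_extend_frag_of: "frag_extend frag_of z = z"
  by (metis frag_expansion)

lemma keys_frag_extend_subset:
  "(\<And>x. x \<in> Poly_Mapping.keys z \<Longrightarrow> Poly_Mapping.keys (f x) \<subseteq> S) \<Longrightarrow>
    Poly_Mapping.keys (frag_extend f z) \<subseteq> S"
  using keys_frag_extend[of f z] by blast


section \<open>Merging and splitting labels of curves\<close>

text \<open>The merging of the definition with its curves as explicit arguments, free of the choice
  made by \<open>SOME\<close>; \<open>split_labels\<close> does the same for splitting.\<close>

definition merge_labels :: "'c set \<Rightarrow> 'c \<Rightarrow> 'c \<Rightarrow> 'c \<Rightarrow> ('c \<Rightarrow> vgen) \<Rightarrow> ('c \<Rightarrow> vgen) \<Rightarrow>\<^sub>0 int" where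
  "merge_labels B k k1 k2 x =
     frag_extend (\<lambda>y. frag_of (restrict (x(k := y)) B)) (v_merge (x k1) (x k2))"

definition split_labels :: "'c set \<Rightarrow> 'c \<Rightarrow> 'c \<Rightarrow> 'c \<Rightarrow> ('c \<Rightarrow> vgen) \<Rightarrow> ('c \<Rightarrow> vgen) \<Rightarrow>\<^sub>0 int" where
  "split_labels B k k1 k2 x =
     frag_extend (\<lambda>(y, z). frag_of (restrict (x(k1 := y, k2 := z)) B)) (v_split (x k))"

text \<open>Multiplication by \<open>X\<close> in the factor of the curve \<open>k\<close>, for \<open>V = \<int>[X]/(X\<^sup>2)\<close>.\<close>

definition lower :: "'c \<Rightarrow> ('c \<Rightarrow> vgen) \<Rightarrow> ('c \<Rightarrow> vgen) \<Rightarrow>\<^sub>0 int" where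
  "lower k x = (if x k = VPlus then frag_of (x(k := VMinus)) else 0)"

text \<open>The unit of the tensor power of the algebra V indexed by \<open>B\<close>.\<close>

definition all_plus :: "'c set \<Rightarrow> 'c \<Rightarrow> vgen" where
  "all_plus B = restrict (\<lambda>_. VPlus) B"

lemma vgen_neq [simp]: "y \<noteq> VPlus \<longleftrightarrow> y = VMinus" "y \<noteq> VMinus \<longleftrightarrow> y = VPlus"
  by (cases y; simp)+

lemma v_merge_commute: "v_merge y z = v_merge z y"
  by (cases y; cases z) simp_all

lemma lower_commute: "frag_extend (lower k) (lower l x) = frag_extend (lower l) (lower k x)"
  by (cases "k = l") (auto simp: lower_def fun_upd_twist)

lemma lower_commute_frag:
  "frag_extend (lower k) (frag_extend (lower l) z) = frag_extend (lower l) (frag_extend (lower k) z)"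
  by (simp add: frag_extend_extend lower_commute)

text \<open>Multiplication in V is linear over X in each factor. The curve \<open>l'\<close> keeps
  track of the factor: one that takes part in the merge continues as \<open>k\<close>.\<close>

lemma merge_labels_lower:
  assumes "k1 \<noteq> k2" "k \<notin> B" "k1 \<in> B" "k2 \<in> B" "B' = insert k (B - {k1, k2})" "l \<in> B"
    and "l' = (if l = k1 \<or> l = k2 then k else l)"
  shows "frag_extend (merge_labels B' k k1 k2) (lower l x) =
    frag_extend (lower l') (merge_labels B' k k1 k2 x)"
proof -
  have "k \<noteq> k1" "k \<noteq> k2" "k \<noteq> l" using assms by auto
  then show ?thesis
    using assms(1,6) unfolding assms(5,7)
    by (cases "x k1"; cases "x k2"; cases "x l"; cases "l = k1"; cases "l = k2")
      (auto simp: merge_labels_def lower_def frag_of_eq fun_eq_iff restrict_def)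
qed

text \<open>The map with 1 to X (x) 1 + 1 (x) X and X to X (x) X commutes with multiplication by X,
  taken in the input and in either output.\<close>

lemma split_labels_lower:
  assumes "k1 \<noteq> k2" "k1 \<notin> B" "k2 \<notin> B" "k \<in> B" "B' = insert k1 (insert k2 (B - {k}))" "l' \<in> B'"
    and "l = (if l' = k1 \<or> l' = k2 then k else l')"
  shows "frag_extend (split_labels B' k k1 k2) (lower l x) =
    frag_extend (lower l') (split_labels B' k k1 k2 x)"
proof -
  have *: "k \<noteq> k1" "k \<noteq> k2" using assms by auto
  consider "l' = k1" "l = k" | "l' = k2" "l = k" | "l' \<noteq> k1" "l' \<noteq> k2" "l = l'" "l' \<in> B" "l' \<noteq> k"
    using assms by auto
  then show ?thesis
  proof cases
    case 1
    then show ?thesis using * assms(1)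
      by (cases "x k") (auto simp: split_labels_def lower_def frag_of_eq fun_eq_iff restrict_def
          assms(5) frag_extend_add)
  next
    case 2
    then show ?thesis using * assms(1)
      by (cases "x k") (auto simp: split_labels_def lower_def frag_of_eq fun_eq_iff restrict_def
          assms(5) frag_extend_add)
  next
    case 3
    have upd: "restrict ((x(l' := w))(k1 := y, k2 := z)) B' = (restrict (x(k1 := y, k2 := z)) B')(l' := w)"
      for w y z using 3 assms(6) by (auto simp: restrict_def fun_eq_iff)
    show ?thesis using * assms(1,6) 3
      by (cases "x k"; cases "x l'") (simp_all add: split_labels_def lower_def frag_extend_add upd)
  qed
qed

lemma merge_labels_all_plus:
  assumes "k \<notin> B" "k1 \<in> B" "k2 \<in> B" "B' = insert k (B - {k1, k2})"
  shows "merge_labels B' k k1 k2 (all_plus B) = frag_of (all_plus B')"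
  using assms by (auto simp: merge_labels_def all_plus_def frag_of_eq fun_eq_iff restrict_def)

lemma split_labels_all_plus:
  assumes "k1 \<noteq> k2" "k1 \<notin> B" "k2 \<notin> B" "k \<in> B" "B' = insert k1 (insert k2 (B - {k}))"
  shows "split_labels B' k k1 k2 (all_plus B) = lower k1 (all_plus B') + lower k2 (all_plus B')"
proof -
  have "restrict ((all_plus B)(k1 := VPlus, k2 := VMinus)) B' = (all_plus B')(k2 := VMinus)"
    "restrict ((all_plus B)(k1 := VMinus, k2 := VPlus)) B' = (all_plus B')(k1 := VMinus)"
    using assms by (auto simp: all_plus_def fun_eq_iff restrict_def)
  moreover have "all_plus B k = VPlus" "all_plus B' k1 = VPlus" "all_plus B' k2 = VPlus"
    using assms by (auto simp: all_plus_def)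
  ultimately show ?thesis by (simp add: split_labels_def lower_def frag_extend_add add.commute)
qed

text \<open>The degree falls by one here and likewise in a split; the shift by the height, which
  grows by one, makes up for it.\<close>

lemma keys_merge_labels:
  assumes "k1 \<noteq> k2" "k \<notin> B" "k1 \<in> B" "k2 \<in> B" "B' = insert k (B - {k1, k2})" "finite B"
    and y: "y \<in> Poly_Mapping.keys (merge_labels B' k k1 k2 x)"
  shows "y \<in> B' \<rightarrow>\<^sub>E UNIV" and "(\<Sum>l\<in>B'. vdeg (y l)) = (\<Sum>l\<in>B. vdeg (x l)) - 1"
proof -
  obtain w where w: "w \<in> Poly_Mapping.keys (v_merge (x k1) (x k2))" "y = restrict (x(k := w)) B'"
    using y keys_frag_extend unfolding merge_labels_def by fastforce
  have "vdeg w = vdeg (x k1) + vdeg (x k2) - 1"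
    using w(1) by (cases "x k1"; cases "x k2") auto
  moreover have "(\<Sum>l\<in>B. vdeg (x l)) = vdeg (x k1) + vdeg (x k2) + (\<Sum>l\<in>B-{k1,k2}. vdeg (x l))"
    using assms(1,3,4,6) by (simp add: sum.remove[of B k1] sum.remove[of "B - {k1}" k2] Diff_insert2[symmetric])
  moreover have "(\<Sum>l\<in>B'. vdeg (y l)) = vdeg w + (\<Sum>l\<in>B-{k1,k2}. vdeg (x l))"
  proof -
    have "(\<Sum>l\<in>B-{k1,k2}. vdeg (y l)) = (\<Sum>l\<in>B-{k1,k2}. vdeg (x l))"
      using assms(2) by (intro sum.cong) (auto simp: w(2) assms(5))
    moreover have "y k = w" by (simp add: w(2) assms(5))
    ultimately show ?thesis using assms(2,6) unfolding assms(5) by simp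
  qed
  ultimately show "(\<Sum>l\<in>B'. vdeg (y l)) = (\<Sum>l\<in>B. vdeg (x l)) - 1" by simp
  show "y \<in> B' \<rightarrow>\<^sub>E UNIV" using w(2) by auto
qed

lemma keys_split_labels:
  assumes "k1 \<noteq> k2" "k1 \<notin> B" "k2 \<notin> B" "k \<in> B" "B' = insert k1 (insert k2 (B - {k}))" "finite B"
    and y: "y \<in> Poly_Mapping.keys (split_labels B' k k1 k2 x)"
  shows "y \<in> B' \<rightarrow>\<^sub>E UNIV" and "(\<Sum>l\<in>B'. vdeg (y l)) = (\<Sum>l\<in>B. vdeg (x l)) - 1"
proof -
  obtain w1 w2 where w: "(w1, w2) \<in> Poly_Mapping.keys (v_split (x k))" "y = restrict (x(k1 := w1, k2 := w2)) B'"
    using y keys_frag_extend unfolding split_labels_def by fastforce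
  have "vdeg w1 + vdeg w2 = vdeg (x k) - 1"
    using w(1) keys_add[of "frag_of (VPlus, VMinus)" "frag_of (VMinus, VPlus)"] by (cases "x k") auto
  moreover have "(\<Sum>l\<in>B. vdeg (x l)) = vdeg (x k) + (\<Sum>l\<in>B-{k}. vdeg (x l))"
    using assms(4,6) by (simp add: sum.remove)
  moreover have "(\<Sum>l\<in>B'. vdeg (y l)) = vdeg w1 + vdeg w2 + (\<Sum>l\<in>B-{k}. vdeg (x l))"
  proof -
    have "(\<Sum>l\<in>B-{k}. vdeg (y l)) = (\<Sum>l\<in>B-{k}. vdeg (x l))"
      using assms(2,3) by (intro sum.cong) (auto simp: w(2) assms(5))
    moreover have "y k1 = w1" "y k2 = w2" using assms(1) by (simp_all add: w(2) assms(5))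
    ultimately show ?thesis using assms(1,2,3,6) unfolding assms(5) by simp
  qed
  ultimately show "(\<Sum>l\<in>B'. vdeg (y l)) = (\<Sum>l\<in>B. vdeg (x l)) - 1" by simp
  show "y \<in> B' \<rightarrow>\<^sub>E UNIV" using w(2) by auto
qed

definition surgery_map :: "'p set \<Rightarrow> ('p \<Rightarrow> 'c) \<Rightarrow> ('p \<Rightarrow> 'c) \<Rightarrow> 'p \<Rightarrow> 'p \<Rightarrow>
    ('c \<Rightarrow> vgen) \<Rightarrow> ('c \<Rightarrow> vgen) \<Rightarrow>\<^sub>0 int" where
  "surgery_map P c c' a b = (if c a = c b then split_labels (c' ` P) (c a) (c' a) (c' b)
     else merge_labels (c' ` P) (c' a) (c a) (c b))"

lemma surgery_split_cond:
  assumes "joins P c' c a b"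
  shows "c' a \<noteq> c' b" "c' a \<notin> c ` P" "c' b \<notin> c ` P" "c a \<in> c ` P"
    "c' ` P = insert (c' a) (insert (c' b) (c ` P - {c a}))"
  using joinsD(1-7)[OF assms] joins_images[OF assms] by blast+

lemma surgery_merge_cond:
  assumes "joins P c c' a b"
  shows "c a \<noteq> c b" "c' a \<notin> c ` P" "c a \<in> c ` P" "c b \<in> c ` P"
    "c' ` P = insert (c' a) (c ` P - {c a, c b})"
  using joinsD(1-7)[OF assms] joins_images[OF assms] by blast+

text \<open>Indexing by a point \<open>p\<close> instead of a curve makes joins and splits alike:
  \<open>c p\<close> and \<open>c' p\<close> are the factor at \<open>p\<close> before and
  after.\<close>

lemma surgery_map_lower:
  assumes s: "surgery P c c' a b" and p: "p \<in> P"
  shows "frag_extend (surgery_map P c c' a b) (lower (c p) x) =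
    frag_extend (lower (c' p)) (surgery_map P c c' a b x)"
proof (cases "c a = c b")
  case True
  note j = surgery_joins(2)[OF s True]
  have "c p = (if c' p = c' a \<or> c' p = c' b then c a else c' p)"
    using joinsD(8,9)[OF j p] by auto
  from split_labels_lower[OF surgery_split_cond[OF j] _ this] show ?thesis
    using True p by (simp add: surgery_map_def)
next
  case False
  note j = surgery_joins(1)[OF s False]
  have "c' p = (if c p = c a \<or> c p = c b then c' a else c p)"
    using joinsD(8,9)[OF j p] by auto
  from merge_labels_lower[OF surgery_merge_cond[OF j] _ this] show ?thesis
    using False p by (simp add: surgery_map_def)
qed

lemma surgery_map_lower_frag:
  assumes "surgery P c c' a b" "p \<in> P"
  shows "frag_extend (surgery_map P c c' a b) (frag_extend (lower (c p)) z) =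
    frag_extend (lower (c' p)) (frag_extend (surgery_map P c c' a b) z)"
  by (simp add: frag_extend_extend surgery_map_lower[OF assms])

lemma surgery_map_all_plus:
  assumes s: "surgery P c c' a b"
  shows "surgery_map P c c' a b (all_plus (c ` P)) =
    (if c a = c b then lower (c' a) (all_plus (c' ` P)) + lower (c' b) (all_plus (c' ` P))
     else frag_of (all_plus (c' ` P)))"
proof (cases "c a = c b")
  case True
  note j = surgery_joins(2)[OF s True]
  show ?thesis using split_labels_all_plus[OF surgery_split_cond[OF j]] True
    by (simp add: surgery_map_def)
next
  case False
  note j = surgery_joins(1)[OF s False]
  show ?thesis using merge_labels_all_plus[OF surgery_merge_cond(2-)[OF j]] False
    by (simp add: surgery_map_def)
qed

lemma keys_surgery_map:
  assumes s: "surgery P c c' a b" and "finite P"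
    and y: "y \<in> Poly_Mapping.keys (surgery_map P c c' a b x)"
  shows "y \<in> c' ` P \<rightarrow>\<^sub>E UNIV"
    and "(\<Sum>l\<in>c' ` P. vdeg (y l)) = (\<Sum>l\<in>c ` P. vdeg (x l)) - 1"
proof -
  have "y \<in> c' ` P \<rightarrow>\<^sub>E UNIV \<and> (\<Sum>l\<in>c' ` P. vdeg (y l)) = (\<Sum>l\<in>c ` P. vdeg (x l)) - 1"
  proof (cases "c a = c b")
  case True
  note j = surgery_joins(2)[OF s True]
  note * = keys_split_labels[OF surgery_split_cond[OF j] finite_imageI[OF \<open>finite P\<close>], of y x]
  show ?thesis
    using * y True unfolding surgery_map_def by simp_all
next
  case False
  note j = surgery_joins(1)[OF s False]
  note * = keys_merge_labels[OF surgery_merge_cond[OF j] finite_imageI[OF \<open>finite P\<close>], of y x]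
  show ?thesis
    using * y False unfolding surgery_map_def by simp_all
qed
  then show "y \<in> c' ` P \<rightarrow>\<^sub>E UNIV"
    and "(\<Sum>l\<in>c' ` P. vdeg (y l)) = (\<Sum>l\<in>c ` P. vdeg (x l)) - 1" by blast+
qed

text \<open>Both composites commute with all \<^const>\<open>lower\<close> operators, so it suffices to compare them on the
  label that is \<open>v\<^sub>+\<close> everywhere.\<close>

lemma surgery_map_commute:
  assumes "finite P"
    and s: "surgery P c c1 a b" "surgery P c1 c3 p q" "surgery P c c2 p q" "surgery P c2 c3 a b"
    and x: "x \<in> c ` P \<rightarrow>\<^sub>E UNIV"
  shows "frag_extend (surgery_map P c1 c3 p q) (surgery_map P c c1 a b x) =
    frag_extend (surgery_map P c2 c3 a b) (surgery_map P c c2 p q x)"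
  using x
\<comment> \<open>The number of labels \<open>VMinus\<close> counts the multiplications by X that
  lead from the unit to \<open>x\<close>.\<close>
proof (induction "card {k \<in> c ` P. x k = VMinus}" arbitrary: x)
  case 0
  then have "{k \<in> c ` P. x k = VMinus} = {}" using \<open>finite P\<close> by simp
  then have "x = all_plus (c ` P)" using 0(2) by (fastforce simp: all_plus_def PiE_def extensional_def)
  have P: "a \<in> P" "b \<in> P" "p \<in> P" "q \<in> P" using s(1,2) joinsD(1,2) unfolding surgery_def by metis+
  \<comment> \<open>\<open>Y r\<close> multiplies by X in the final curve through \<open>r\<close>;
    both sides become polynomials in such operators applied to the unit \<open>u\<close>.\<close>
  define Y where "Y r = frag_extend (lower (c3 r))" for r
  define u where "u = frag_of (all_plus (c3 ` P))"
  have Yu: "lower (c3 r) (all_plus (c3 ` P)) = Y r u" for r by (simp add: Y_def u_def)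
  have Yc: "Y r (Y t z) = Y t (Y r z)" for r t z by (simp add: Y_def lower_commute_frag)
  have Ya: "Y r (z + w) = Y r z + Y r w" for r z w by (simp add: Y_def frag_extend_add)
  have low: "frag_extend (surgery_map P d c3 e f) (lower (d r) (all_plus (d ` P))) =
      Y r (surgery_map P d c3 e f (all_plus (d ` P)))" if "surgery P d c3 e f" "r \<in> P" for d e f r
    using surgery_map_lower[OF that] by (simp add: Y_def)
  define s1 where "s1 = (if c1 p = c1 q then Y p u + Y q u else u)"
  define s2 where "s2 = (if c2 a = c2 b then Y a u + Y b u else u)"
  have L: "frag_extend (surgery_map P c1 c3 p q) (surgery_map P c c1 a b x) =
      (if c a = c b then Y a s1 + Y b s1 else s1)"
    unfolding \<open>x = _\<close> surgery_map_all_plus[OF s(1)] s1_def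
    by (simp add: frag_extend_add low[OF s(2)] P surgery_map_all_plus[OF s(2)] Yu u_def[symmetric])
  have R: "frag_extend (surgery_map P c2 c3 a b) (surgery_map P c c2 p q x) =
      (if c p = c q then Y p s2 + Y q s2 else s2)"
    unfolding \<open>x = _\<close> surgery_map_all_plus[OF s(3)] s2_def
    by (simp add: frag_extend_add low[OF s(4)] P surgery_map_all_plus[OF s(4)] Yu u_def[symmetric])
  from \<open>finite P\<close> s show ?case
  proof (cases rule: surgery_square)
    case same
    then show ?thesis unfolding L R s1_def s2_def
      by (cases "c a = c b"; cases "c p = c q") (simp_all add: Ya Yc[of p] Yc[of q] algebra_simps)
  next
    case split_join
    \<comment> \<open>All four points end on one curve, so both sides are twice the same
      multiplication.\<close>
    then have "Y a = Y b" "Y p = Y q" "Y a = Y p" by (simp_all add: Y_def)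
    then show ?thesis unfolding L R s1_def s2_def using split_join by simp
  next
    case join_split
    \<comment> \<open>Both orders end with a split into the same two curves.\<close>
    have "Y a u + Y b u = Y p u + Y q u"
      using join_split(5) by (auto simp: doubleton_eq_iff Y_def add.commute)
    then show ?thesis unfolding L R s1_def s2_def using join_split by simp
  next
    case both
    then show ?thesis unfolding L R s1_def s2_def
      by (simp add: Ya Yc[of p] Yc[of q] algebra_simps)
  next
    case none
    then show ?thesis unfolding L R s1_def s2_def by simp
  qed
next
  case (Suc n)
  then have "{k \<in> c ` P. x k = VMinus} \<noteq> {}" by force
  then obtain r where r: "r \<in> P" "x (c r) = VMinus" by blast
  define y where "y = x(c r := VPlus)"
  have "{k \<in> c ` P. x k = VMinus} = insert (c r) {k \<in> c ` P. y k = VMinus}"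
    using r by (auto simp: y_def)
  moreover have "c r \<notin> {k \<in> c ` P. y k = VMinus}" by (simp add: y_def)
  ultimately have "n = card {k \<in> c ` P. y k = VMinus}" using Suc.hyps(2) \<open>finite P\<close> by simp
  moreover have "y \<in> c ` P \<rightarrow>\<^sub>E UNIV" using Suc.prems r by (auto simp: y_def PiE_def extensional_def)
  ultimately have IH: "frag_extend (surgery_map P c1 c3 p q) (surgery_map P c c1 a b y) =
    frag_extend (surgery_map P c2 c3 a b) (surgery_map P c c2 p q y)" by (rule Suc.hyps(1))
  \<comment> \<open>A label \<open>VMinus\<close> is X times \<open>VPlus\<close>.\<close>
  have xy: "frag_of x = lower (c r) y" using r by (simp add: lower_def y_def fun_upd_idem)
  have "frag_extend (surgery_map P d c3 e' f') (surgery_map P c d e f x) =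
      frag_extend (lower (c3 r)) (frag_extend (surgery_map P d c3 e' f') (surgery_map P c d e f y))"
    if "surgery P d c3 e' f'" "surgery P c d e f" for d e f e' f'
  proof -
    have "surgery_map P c d e f x = frag_extend (surgery_map P c d e f) (frag_of x)" by simp
    also have "\<dots> = frag_extend (lower (d r)) (surgery_map P c d e f y)"
      unfolding xy by (rule surgery_map_lower[OF that(2) r(1)])
    finally show ?thesis using surgery_map_lower_frag[OF that(1) r(1)] by simp
  qed
  from this[OF s(2,1)] this[OF s(4,3)] show ?case unfolding IH by simp
qed

section \<open>The boundary map of the complex as a surgery\<close>

lemma some_pair:
  assumes "k1 \<noteq> k2"
  shows "(SOME (c1, c2). c1 \<noteq> c2 \<and> {k1, k2} = {c1, c2}) \<in> {(k1, k2), (k2, k1)}"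
proof -
  let ?P = "\<lambda>(c1, c2). c1 \<noteq> c2 \<and> {k1, k2} = {c1, c2}"
  have "?P (k1, k2)" using assms by simp
  then have "?P (SOME z. ?P z)" by (rule someI)
  then show ?thesis by (auto simp: doubleton_eq_iff)
qed

lemma boundary_map_eq_merge:
  assumes "boundaries H - boundaries H' = {k1, k2}" "k1 \<noteq> k2" "boundaries H' - boundaries H = {k}"
  shows "boundary_map H H' = merge_labels (boundaries H') k k1 k2"
proof
  fix b
  have "boundary_map H H' b = merge_map H H' b" using assms by (simp add: boundary_map_def)
  also have "\<dots> = merge_labels (boundaries H') k k1 k2 b"
    using some_pair[OF assms(2)]
    by (auto simp: merge_map_def merge_labels_def assms(1,3) v_merge_commute split: prod.split)
  finally show "boundary_map H H' b = merge_labels (boundaries H') k k1 k2 b" .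
qed

lemma split_labels_commute:
  assumes "k1 \<noteq> k2" shows "split_labels B k k1 k2 = split_labels B k k2 k1"
proof
  fix x show "split_labels B k k1 k2 x = split_labels B k k2 k1 x"
    using assms by (cases "x k") (simp_all add: split_labels_def frag_extend_add fun_upd_twist add.commute)
qed

lemma boundary_map_eq_split:
  assumes "boundaries H' - boundaries H = {k1, k2}" "k1 \<noteq> k2" "boundaries H - boundaries H' = {k}"
  shows "boundary_map H H' = split_labels (boundaries H') k k1 k2"
proof
  fix b
  have "boundary_map H H' b = split_map H H' b" using assms by (simp add: boundary_map_def)
  also have "\<dots> = split_labels (boundaries H') k k1 k2 b \<or> \<dots> = split_labels (boundaries H') k k2 k1 b"
    using some_pair[OF assms(2)]
    by (auto simp: split_map_def split_labels_def assms(1,3) split: prod.split)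
  finally show "boundary_map H H' b = split_labels (boundaries H') k k1 k2 b"
    using split_labels_commute[OF assms(2)] by metis
qed

text \<open>\<open>boundary_map\<close> tells a merge from a split by counting the curves that
  disappear, \<open>surgery_map\<close> by whether both halves of the edge lie on one curve;
  \<open>joins_images\<close> translates between the two tests.\<close>

lemma (in fatgraph) boundary_map_eq_surgery:
  assumes W: "W \<subseteq> edges F" and e: "{a, opp F a} \<in> W" and W'_def: "W' = W - {{a, opp F a}}"
  shows "boundary_map (spanning_subgraph F W) (spanning_subgraph F W') =
    surgery_map (points F) (curve F W) (curve F W') (Inl a) (Inl (opp F a))"
proof -
  have W': "W' \<subseteq> edges F" using W W'_def by blast
  note s = surgery_delete[OF W e, folded W'_def]
  show ?thesis
  proof (cases "curve F W (Inl a) = curve F W (Inl (opp F a))")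
    case True
    note j = surgery_joins(2)[OF s True]
    show ?thesis
      using boundary_map_eq_split[of "spanning_subgraph F W'" "spanning_subgraph F W"]
        joins_images(1,2)[OF j] joinsD(3)[OF j] True
      by (simp add: boundaries_spanning[OF W] boundaries_spanning[OF W'] surgery_map_def)
  next
    case False
    note j = surgery_joins(1)[OF s False]
    show ?thesis
      using boundary_map_eq_merge[of "spanning_subgraph F W" "spanning_subgraph F W'"]
        joins_images(1,2)[OF j] joinsD(3)[OF j] False
      by (simp add: boundaries_spanning[OF W] boundaries_spanning[OF W'] surgery_map_def)
  qed
qed



section \<open>The differential squares to zero\<close>

text \<open>The tensor product of formal sums \<open>B\<close>, \<open>G\<close> and
  \<open>R\<close> over one state and one vertex label. Edge maps are the identity on vertex
  factors, so they send such a product to another one.\<close>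

definition tensor_frag :: "'h set set \<Rightarrow> ('v \<Rightarrow> vgen) \<Rightarrow> ((('v, 'h) boundary \<Rightarrow> vgen) \<Rightarrow>\<^sub>0 int) \<Rightarrow>
    (vgen list \<Rightarrow>\<^sub>0 int) \<Rightarrow> (rgen list \<Rightarrow>\<^sub>0 int) \<Rightarrow> ('v, 'h) tensor_gen \<Rightarrow>\<^sub>0 int" where
  "tensor_frag W a B G R =
     frag_extend (\<lambda>b. frag_extend (\<lambda>gs. frag_extend (\<lambda>rs. frag_of (Tensor W a b gs rs)) R) G) B"

abbreviation state_boundary_map :: "('v, 'h) fatgraph \<Rightarrow> 'h set \<Rightarrow> 'h set set \<Rightarrow>
    (('v, 'h) boundary \<Rightarrow> vgen) \<Rightarrow> (('v, 'h) boundary \<Rightarrow> vgen) \<Rightarrow>\<^sub>0 int" where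
  "state_boundary_map F e W \<equiv> boundary_map (spanning_subgraph F W) (spanning_subgraph F (W - {e}))"

abbreviation state_genus_map :: "('v, 'h) fatgraph \<Rightarrow> 'h set \<Rightarrow> 'h set set \<Rightarrow> vgen list \<Rightarrow> vgen list \<Rightarrow>\<^sub>0 int" where
  "state_genus_map F e W \<equiv> genus_map (spanning_subgraph F W) (spanning_subgraph F (W - {e}))"

lemma keys_tensor_frag:
  assumes "y \<in> Poly_Mapping.keys (tensor_frag W a B G R)"
  obtains b gs rs where "y = Tensor W a b gs rs" "b \<in> Poly_Mapping.keys B"
    "gs \<in> Poly_Mapping.keys G" "rs \<in> Poly_Mapping.keys R"
proof -
  obtain b where b: "b \<in> Poly_Mapping.keys B"
    "y \<in> Poly_Mapping.keys (frag_extend (\<lambda>gs. frag_extend (\<lambda>rs. frag_of (Tensor W a b gs rs)) R) G)"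
    using subsetD[OF keys_frag_extend assms[unfolded tensor_frag_def]] by blast
  then obtain gs where gs: "gs \<in> Poly_Mapping.keys G"
    "y \<in> Poly_Mapping.keys (frag_extend (\<lambda>rs. frag_of (Tensor W a b gs rs)) R)"
    using subsetD[OF keys_frag_extend b(2)] by blast
  then obtain rs where "rs \<in> Poly_Mapping.keys R" "y \<in> Poly_Mapping.keys (frag_of (Tensor W a b gs rs))"
    using subsetD[OF keys_frag_extend gs(2)] by blast
  then show thesis using that b(1) gs(1) by simp
qed

lemma frag_extend_sum_fun:
  "frag_extend (\<lambda>y. \<Sum>k\<in>K. frag_cmul (c k) (g k y)) z = (\<Sum>k\<in>K. frag_cmul (c k) (frag_extend (g k) z))"
proof -
  have d: "frag_cmul n (u - v) = frag_cmul n u - frag_cmul n v" for n and u v :: "'a \<Rightarrow>\<^sub>0 int"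
    by (rule poly_mapping_eqI) (simp add: lookup_minus algebra_simps)
  show ?thesis
    using subset_UNIV
    by (induction z rule: frag_induction) (simp_all add: frag_extend_diff sum_subtractf d)
qed

lemma edge_map_Tensor:
  "edge_map F e (Tensor W a b gs rs) =
     tensor_frag (W - {e}) a (state_boundary_map F e W b) (state_genus_map F e W gs) (r_comult rs)"
  by (simp add: edge_map_def tensor_frag_def Let_def)

text \<open>Interchanging the nested extensions brings each map next to the factor on which it acts;
  composites of edge maps can then be compared factor by factor.\<close>

lemma edge_map_tensor_frag:
  "frag_extend (edge_map F e) (tensor_frag W a B G R) =
     tensor_frag (W - {e}) a (frag_extend (state_boundary_map F e W) B)
       (frag_extend (state_genus_map F e W) G) (frag_extend r_comult R)"
proof -
  let ?bm = "state_boundary_map F e W" and ?gm = "state_genus_map F e W"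
  let ?T = "\<lambda>b gs rs. frag_of (Tensor (W - {e}) a b gs rs)"
  have "frag_extend (edge_map F e) (tensor_frag W a B G R) =
      frag_extend (\<lambda>b. frag_extend (\<lambda>gs. frag_extend (\<lambda>rs.
        frag_extend (\<lambda>b'. frag_extend (\<lambda>gs'. frag_extend (\<lambda>rs'. ?T b' gs' rs') (r_comult rs)) (?gm gs)) (?bm b))
        R) G) B"
    by (simp add: tensor_frag_def frag_extend_extend edge_map_Tensor)
  also have "\<dots> = frag_extend (\<lambda>b. frag_extend (\<lambda>gs. frag_extend (\<lambda>b'.
        frag_extend (\<lambda>rs. frag_extend (\<lambda>gs'. frag_extend (\<lambda>rs'. ?T b' gs' rs') (r_comult rs)) (?gm gs)) R)
        (?bm b)) G) B"
    by (subst frag_extend_swap) (rule refl)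
  also have "\<dots> = frag_extend (\<lambda>b. frag_extend (\<lambda>b'. frag_extend (\<lambda>gs.
        frag_extend (\<lambda>rs. frag_extend (\<lambda>gs'. frag_extend (\<lambda>rs'. ?T b' gs' rs') (r_comult rs)) (?gm gs)) R)
        G) (?bm b)) B"
    by (subst frag_extend_swap) (rule refl)
  also have "\<dots> = frag_extend (\<lambda>b. frag_extend (\<lambda>b'. frag_extend (\<lambda>gs.
        frag_extend (\<lambda>gs'. frag_extend (\<lambda>rs. frag_extend (\<lambda>rs'. ?T b' gs' rs') (r_comult rs)) R) (?gm gs))
        G) (?bm b)) B"
    by (subst frag_extend_swap) (rule refl)
  also have "\<dots> = tensor_frag (W - {e}) a (frag_extend ?bm B) (frag_extend ?gm G) (frag_extend r_comult R)"
    by (simp add: tensor_frag_def frag_extend_extend)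
  finally show ?thesis .
qed

lemma keys_genus_drop:
  "ys \<in> Poly_Mapping.keys (genus_drop g xs) \<Longrightarrow>
     length ys = 2 * (g - 1) \<and> sum_list (map vdeg ys) = sum_list (map vdeg xs)"
  using keys_sum[of frag_of "{ys. length ys = 2 * (g - 1) \<and> sum_list (map vdeg ys) = sum_list (map vdeg xs)}"]
  by (auto simp: genus_drop_def)

lemma keys_r_comult:
  "ys \<in> Poly_Mapping.keys (r_comult xs) \<Longrightarrow>
     length ys = Suc (length xs) \<and> sum_list (map rdeg ys) = sum_list (map rdeg xs)"
proof (cases xs rule: rev_cases)
  case (snoc zs z)
  assume "ys \<in> Poly_Mapping.keys (r_comult xs)"
  then show ?thesis
    using snoc keys_add[of "frag_of (zs @ [XMinus2, X0])" "frag_of (zs @ [X0, XMinus2])"]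
    by (cases z) (auto simp: r_comult_def)
qed (simp add: r_comult_def)

context fatgraph
begin

lemma boundary_map_commute:
  assumes W: "W \<subseteq> edges F" and e: "e \<in> W" "f \<in> W" "e \<noteq> f"
    and b: "b \<in> boundaries (spanning_subgraph F W) \<rightarrow>\<^sub>E UNIV"
  shows "frag_extend (state_boundary_map F f (W - {e})) (state_boundary_map F e W b) =
    frag_extend (state_boundary_map F e (W - {f})) (state_boundary_map F f W b)"
proof -
  obtain a where a: "e = {a, opp F a}" using W e(1) by (auto elim: edge_obtain)
  obtain c where c: "f = {c, opp F c}" using W e(2) by (auto elim: edge_obtain)
  have W': "W - {e} \<subseteq> edges F" "W - {f} \<subseteq> edges F" using W by blast+
  have in': "f \<in> W - {e}" "e \<in> W - {f}" using e by blast+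
  have comm: "W - {e} - {f} = W - {f} - {e}" by blast
  note s1 = surgery_delete[OF W e(1)[unfolded a], folded a]
  note s2 = surgery_delete[OF W'(1) in'(1)[unfolded c], folded c]
  note s3 = surgery_delete[OF W e(2)[unfolded c], folded c]
  note s4 = surgery_delete[OF W'(2) in'(2)[unfolded a], folded a, folded comm]
  note m1 = boundary_map_eq_surgery[OF W e(1)[unfolded a] refl, folded a]
  note m2 = boundary_map_eq_surgery[OF W'(1) in'(1)[unfolded c] refl, folded c]
  note m3 = boundary_map_eq_surgery[OF W e(2)[unfolded c] refl, folded c]
  note m4 = boundary_map_eq_surgery[OF W'(2) in'(2)[unfolded a] refl, folded a, folded comm]
  show ?thesis unfolding comm[symmetric] m1 m2 m3 m4
    by (rule surgery_map_commute[OF finite_points s1 s2 s3 s4 b[unfolded boundaries_spanning[OF W]]])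
qed

text \<open>A deletion lowers the genus by at most one, and the map depends only on the genera
  before and after. The composite is thus determined by the first and the last genus, whichever
  deletion causes a drop.\<close>

lemma genus_map_commute:
  assumes W: "W \<subseteq> edges F" and e: "e \<in> W" "f \<in> W" "e \<noteq> f"
  shows "frag_extend (state_genus_map F f (W - {e})) (state_genus_map F e W gs) =
    frag_extend (state_genus_map F e (W - {f})) (state_genus_map F f W gs)"
proof -
  have W': "W - {e} \<subseteq> edges F" "W - {f} \<subseteq> edges F" using W by blast+
  have in': "f \<in> W - {e}" "e \<in> W - {f}" using e by blast+
  have comm: "W - {e} - {f} = W - {f} - {e}" by blast
  define g g1 g2 g3 where gd: "g = genus (spanning_subgraph F W)" "g1 = genus (spanning_subgraph F (W - {e}))"
    "g2 = genus (spanning_subgraph F (W - {f}))" "g3 = genus (spanning_subgraph F (W - {f} - {e}))"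
  have "g1 = g \<or> g = Suc g1" "g2 = g \<or> g = Suc g2" "g3 = g1 \<or> g1 = Suc g3" "g3 = g2 \<or> g2 = Suc g3"
    using genus_delete[OF W e(1)] genus_delete[OF W e(2)] genus_delete[OF W'(1) in'(1)]
      genus_delete[OF W'(2) in'(2)] unfolding gd comm by simp_all
  then show ?thesis
    unfolding comm genus_map_def gd[symmetric]
    by (elim disjE) (simp_all add: frag_extend_frag_of)
qed

lemma edge_map_commute:
  assumes W: "W \<subseteq> edges F" and e: "e \<in> W" "f \<in> W" "e \<noteq> f" and x: "x \<in> state_gens F W"
  shows "frag_extend (edge_map F f) (edge_map F e x) = frag_extend (edge_map F e) (edge_map F f x)"
proof -
  have comm: "W - {e} - {f} = W - {f} - {e}" by blast
  obtain a b gs rs where x: "x = Tensor W a b gs rs" "b \<in> boundaries (spanning_subgraph F W) \<rightarrow>\<^sub>E UNIV"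
    using x by (auto simp: state_gens_def Let_def)
  show ?thesis
    unfolding x(1) edge_map_Tensor edge_map_tensor_frag
    unfolding boundary_map_commute[OF W e x(2)] genus_map_commute[OF W e] unfolding comm ..
qed

text \<open>The boundary factors lose one degree and the height shift gains one, while the genus and
  R factors keep theirs.\<close>

lemma keys_edge_map:
  assumes W: "W \<subseteq> edges F" and e: "e \<in> W" and x: "x \<in> state_gens F W"
    and y: "y \<in> Poly_Mapping.keys (edge_map F e x)"
  shows "y \<in> state_gens F (W - {e})" and "gen_degree F y = gen_degree F x"
proof -
  obtain a where a: "e = {a, opp F a}" using W e by (auto elim: edge_obtain)
  have W': "W - {e} \<subseteq> edges F" using W by blast
  note s = surgery_delete[OF W e[unfolded a], folded a]
  note m = boundary_map_eq_surgery[OF W e[unfolded a] refl, folded a]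
  let ?H = "spanning_subgraph F W" and ?H' = "spanning_subgraph F (W - {e})"
  obtain v b gs rs where x: "x = Tensor W v b gs rs" "v \<in> verts F \<rightarrow>\<^sub>E UNIV"
      "b \<in> boundaries ?H \<rightarrow>\<^sub>E UNIV" "length gs = 2 * genus ?H" "length rs = height F W"
    using x by (auto simp: state_gens_def Let_def spanning_subgraph_def)
  obtain b' gs' rs' where y: "y = Tensor (W - {e}) v b' gs' rs'"
    and b': "b' \<in> Poly_Mapping.keys (state_boundary_map F e W b)"
    and gs': "gs' \<in> Poly_Mapping.keys (state_genus_map F e W gs)"
    and rs': "rs' \<in> Poly_Mapping.keys (r_comult rs)"
    using y unfolding x(1) edge_map_Tensor by (rule keys_tensor_frag)
  have bb: "b' \<in> boundaries ?H' \<rightarrow>\<^sub>E UNIV"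
    "(\<Sum>l\<in>boundaries ?H'. vdeg (b' l)) = (\<Sum>l\<in>boundaries ?H. vdeg (b l)) - 1"
    using keys_surgery_map[OF s finite_points b'[unfolded m]]
    unfolding boundaries_spanning[OF W] boundaries_spanning[OF W'] by blast+
  have gg: "length gs' = 2 * genus ?H'" "sum_list (map vdeg gs') = sum_list (map vdeg gs)"
    using gs' keys_genus_drop[of gs' "genus ?H" gs] x(4) genus_delete[OF W e]
    by (auto simp: genus_map_def split: if_splits)
  have rr: "length rs' = height F (W - {e})" "sum_list (map rdeg rs') = sum_list (map rdeg rs)"
    using keys_r_comult[OF rs'] x(5) height_delete[OF W e] by auto
  show "y \<in> state_gens F (W - {e})"
    using bb(1) gg(1) rr(1) x(2) unfolding y state_gens_def Let_def by (simp add: spanning_subgraph_def)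
  show "gen_degree F y = gen_degree F x"
    using bb(2) gg(2) rr(2) height_delete[OF W e] unfolding y x(1) gen_degree_def Let_def
    by (simp add: spanning_subgraph_def)
qed

lemma state_gens_edges: "x \<in> state_gens F W \<Longrightarrow> state_edges x = W"
  by (auto simp: state_gens_def Let_def)

lemma keys_gen_diff:
  assumes W: "W \<subseteq> edges F" and x: "x \<in> state_gens F W" and es: "edge_numbering F es"
    and y: "y \<in> Poly_Mapping.keys (gen_diff F es x)"
  shows "\<exists>e\<in>W. y \<in> state_gens F (W - {e}) \<and> gen_degree F y = gen_degree F x"
proof -
  have "\<exists>j. es ! j \<in> W \<and> y \<in> Poly_Mapping.keys (edge_map F (es ! j) x)"
    using subsetD[OF keys_sum y[unfolded gen_diff_def state_gens_edges[OF x]]] by auto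
  then show ?thesis using keys_edge_map[OF W _ x] by blast
qed

text \<open>Terms are indexed by ordered pairs of deleted edges, and exchanging the two reverses the
  sign: removing the earlier edge adds one to the number of missing edges before the later one, but
  not conversely.\<close>

lemma gen_diff_gen_diff:
  assumes W: "W \<subseteq> edges F" and x: "x \<in> state_gens F W" and es: "edge_numbering F es"
  shows "frag_extend (gen_diff F es) (gen_diff F es x) = 0"
proof -
  have dist: "distinct es" using es by (simp add: edge_numbering_def)
  define J where "J = {j. j < length es \<and> es ! j \<in> W}"
  have finJ: "finite J" by (simp add: J_def)
  define n where "n U j = card {i. i < j \<and> es ! i \<notin> U}" for U j
  define t where "t j k = frag_cmul ((- 1) ^ n W j * (- 1) ^ n (W - {es ! j}) k)
      (frag_extend (edge_map F (es ! k)) (edge_map F (es ! j) x))" for j k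
  have idx: "es ! j = es ! k \<longleftrightarrow> j = k" if "j < length es" "k < length es" for j k
    using dist that nth_eq_iff_index_eq by blast
  have dd: "frag_extend (gen_diff F es) (edge_map F (es ! j) x) =
      (\<Sum>k\<in>J - {j}. frag_cmul ((- 1) ^ n (W - {es ! j}) k)
        (frag_extend (edge_map F (es ! k)) (edge_map F (es ! j) x)))" if j: "j \<in> J" for j
  proof -
    have "frag_extend (gen_diff F es) (edge_map F (es ! j) x) =
      frag_extend (\<lambda>y. \<Sum>k\<in>J - {j}. frag_cmul ((- 1) ^ n (W - {es ! j}) k) (edge_map F (es ! k) y))
        (edge_map F (es ! j) x)"
    proof (rule frag_extend_eq)
      fix y assume "y \<in> Poly_Mapping.keys (edge_map F (es ! j) x)"
      then have y: "state_edges y = W - {es ! j}"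
        using keys_edge_map(1)[OF W _ x] j state_gens_edges by (auto simp: J_def)
      have "{k. k < length es \<and> es ! k \<in> W - {es ! j}} = J - {j}"
        using j idx by (auto simp: J_def)
      then show "gen_diff F es y =
          (\<Sum>k\<in>J - {j}. frag_cmul ((- 1) ^ n (W - {es ! j}) k) (edge_map F (es ! k) y))"
        by (simp add: gen_diff_def y n_def)
    qed
    also have "\<dots> = (\<Sum>k\<in>J - {j}. frag_cmul ((- 1) ^ n (W - {es ! j}) k)
        (frag_extend (edge_map F (es ! k)) (edge_map F (es ! j) x)))"
      by (rule frag_extend_sum_fun)
    finally show ?thesis .
  qed
  have "frag_extend (gen_diff F es) (gen_diff F es x) = (\<Sum>j\<in>J. \<Sum>k\<in>J - {j}. t j k)"
    unfolding gen_diff_def[of F es x] state_gens_edges[OF x] J_def[symmetric] n_def[symmetric]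
    by (simp add: frag_extend_sum finJ frag_extend_cmul dd t_def frag_cmul_sum cong: sum.cong)
  also have "\<dots> = (\<Sum>(j, k)\<in>Sigma J (\<lambda>j. J - {j}). t j k)"
    using finJ by (simp add: sum.Sigma)
  finally have S: "frag_extend (gen_diff F es) (gen_diff F es x) = (\<Sum>(j, k)\<in>Sigma J (\<lambda>j. J - {j}). t j k)" .
  have sgn: "(- 1) ^ n W j * (- 1) ^ n (W - {es ! j}) k = - ((- 1 :: int) ^ n W k * (- 1) ^ n (W - {es ! k}) j)"
    if jk: "j \<in> J" "k \<in> J" "j < k" for j k
  proof -
    have "{i. i < k \<and> es ! i \<notin> W - {es ! j}} = insert j {i. i < k \<and> es ! i \<notin> W}"
      using jk idx by (auto simp: J_def)
    then have "n (W - {es ! j}) k = Suc (n W k)" using jk by (simp add: n_def J_def)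
    moreover have "{i. i < j \<and> es ! i \<notin> W - {es ! k}} = {i. i < j \<and> es ! i \<notin> W}"
      using jk idx by (auto simp: J_def)
    then have "n (W - {es ! k}) j = n W j" by (simp add: n_def)
    ultimately show ?thesis by simp
  qed
  have anti: "t j k = - t k j" if jk: "j \<in> J" "k \<in> J" "j \<noteq> k" for j k
  proof -
    have "frag_extend (edge_map F (es ! k)) (edge_map F (es ! j) x) =
        frag_extend (edge_map F (es ! j)) (edge_map F (es ! k) x)"
      using jk idx by (intro edge_map_commute[OF W _ _ _ x]) (auto simp: J_def)
    moreover have "(- 1) ^ n W j * (- 1) ^ n (W - {es ! j}) k = - ((- 1 :: int) ^ n W k * (- 1) ^ n (W - {es ! k}) j)"
      using sgn[of j k] sgn[of k j] jk by (cases "j < k") auto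
    ultimately show ?thesis by (simp add: t_def)
  qed
  have "(\<Sum>(j, k)\<in>Sigma J (\<lambda>j. J - {j}). t j k) = (\<Sum>(k, j)\<in>Sigma J (\<lambda>j. J - {j}). t j k)"
    by (rule sum.reindex_bij_witness[where i = prod.swap and j = prod.swap]) auto
  also have "\<dots> = - (\<Sum>(j, k)\<in>Sigma J (\<lambda>j. J - {j}). t j k)"
    unfolding sum_negf[symmetric] by (intro sum.cong) (auto intro: anti)
  finally have "(\<Sum>(j, k)\<in>Sigma J (\<lambda>j. J - {j}). t j k) = - (\<Sum>(j, k)\<in>Sigma J (\<lambda>j. J - {j}). t j k)" .
  \<comment> \<open>Coefficients are integers, so an element equal to its negative vanishes.\<close>
  moreover have "z = 0" if "z = - z" for z :: "('v, 'h) tensor_gen \<Rightarrow>\<^sub>0 int"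
  proof (rule poly_mapping_eqI)
    fix i
    have "z + z = 0" using that by (metis add.right_inverse)
    then have "Poly_Mapping.lookup z i + Poly_Mapping.lookup z i = 0" by (metis lookup_add lookup_zero)
    then show "Poly_Mapping.lookup z i = Poly_Mapping.lookup 0 i" by simp
  qed
  ultimately show ?thesis unfolding S by blast
qed

end



section \<open>Ranks of quotients of finitely generated free groups\<close>

text \<open>Groups of formal sums under addition with an arbitrary carrier: this covers the free
  groups and also the groups of cycles and images inside them.\<close>

definition frag_group :: "('a \<Rightarrow>\<^sub>0 int, 'm) monoid_scheme \<Rightarrow> bool" where
  "frag_group G \<longleftrightarrow> comm_group G \<and> monoid.mult G = (+) \<and> \<one>\<^bsub>G\<^esub> = 0"

text \<open>After clearing denominators, independence over the integers modulo a subgroup is linear independence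
  of rational coefficient vectors modulo the span of the subgroup, so ranks are dimensions.\<close>

definition rat_vec :: "('a \<Rightarrow>\<^sub>0 int) \<Rightarrow> 'a \<Rightarrow> rat" where
  "rat_vec x = (\<lambda>i. of_int (Poly_Mapping.lookup x i))"

interpretation rat_fun: vector_space "\<lambda>(r::rat) (f :: 'a \<Rightarrow> rat) i. r * f i"
  by unfold_locales (auto simp: fun_eq_iff algebra_simps)

definition rat_dim :: "('a \<Rightarrow>\<^sub>0 int) set \<Rightarrow> nat" where
  "rat_dim S = rat_fun.dim (rat_vec ` S)"

lemma rat_vec_simps [simp]:
  "rat_vec 0 = 0" "rat_vec (x + y) = rat_vec x + rat_vec y" "rat_vec (x - y) = rat_vec x - rat_vec y"
  "rat_vec (frag_cmul n x) = (\<lambda>i. of_int n * rat_vec x i)"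
  by (auto simp: rat_vec_def fun_eq_iff lookup_add lookup_minus)

lemma rat_vec_sum: "rat_vec (\<Sum>s\<in>S. f s) = (\<Sum>s\<in>S. rat_vec (f s))"
  by (induction S rule: infinite_finite_induct) simp_all

lemma sum_fun_apply: "(\<Sum>a\<in>A. f a) x = (\<Sum>a\<in>A. f a x)"
  by (induction A rule: infinite_finite_induct) simp_all

lemma inj_rat_vec: "inj rat_vec"
  by (rule injI) (auto simp: rat_vec_def fun_eq_iff intro: poly_mapping_eqI)

lemma rat_vec_eq_0_iff [simp]: "rat_vec x = 0 \<longleftrightarrow> x = 0"
  using inj_rat_vec by (metis injD rat_vec_simps(1))

lemma clear_denominators:
  fixes u :: "'a \<Rightarrow> rat"
  assumes "finite S"
  obtains D :: int and n :: "'a \<Rightarrow> int" where "D \<noteq> 0" "\<And>s. s \<in> S \<Longrightarrow> of_int D * u s = of_int (n s)"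
proof -
  have "\<exists>D::int. D \<noteq> 0 \<and> (\<forall>s\<in>S. of_int D * u s \<in> \<int>)"
    using assms
  proof (induction S)
    case empty then show ?case by (intro exI[of _ 1]) simp
  next
    case (insert s S)
    then obtain D :: int where D: "D \<noteq> 0" "\<forall>s\<in>S. of_int D * u s \<in> \<int>" by blast
    obtain a b where ab: "quotient_of (u s) = (a, b)" by fastforce
    then have b: "b > 0" "u s = of_int a / of_int b"
      using quotient_of_denom_pos quotient_of_div by blast+
    have "of_int (b * D) * u t \<in> \<int>" if "t \<in> S" for t
    proof -
      have "of_int (b * D) * u t = of_int b * (of_int D * u t)" by simp
      then show ?thesis using D(2) that by (metis Ints_mult Ints_of_int)
    qed
    moreover have "of_int (b * D) * u s = of_int (D * a)" using b by simp
    then have "of_int (b * D) * u s \<in> \<int>" by (metis Ints_of_int)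
    ultimately show ?case using D(1) b(1) by (intro exI[of _ "b * D"]) auto
  qed
  then obtain D :: int where D: "D \<noteq> 0" "\<forall>s\<in>S. of_int D * u s \<in> \<int>" by blast
  have "of_int D * u s = of_int \<lfloor>of_int D * u s\<rfloor>" if "s \<in> S" for s
    using D(2) that by (simp add: of_int_floor_cancel)
  then show thesis by (intro that[of D "\<lambda>s. \<lfloor>of_int D * u s\<rfloor>"] D(1))
qed

lemma frag_group_int_pow:
  assumes G: "frag_group G" and x: "x \<in> carrier G"
  shows "x [^]\<^bsub>G\<^esub> (n::int) = frag_cmul n x"
proof -
  interpret comm_group G using G by (simp add: frag_group_def)
  have nat: "x [^]\<^bsub>G\<^esub> (k::nat) = frag_cmul (int k) x" for k
    using G by (induction k) (simp_all add: frag_group_def frag_cmul_distrib add.commute)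
  have inv: "inv\<^bsub>G\<^esub> y = - y" if "y \<in> carrier G" for y
  proof -
    have "inv\<^bsub>G\<^esub> y + y = 0" using l_inv[OF that] G by (simp add: frag_group_def)
    then show ?thesis by (simp add: eq_neg_iff_add_eq_0)
  qed
  show ?thesis
  proof (cases "n \<ge> 0")
    case True
    then obtain k where "n = int k" using nonneg_int_cases by blast
    then show ?thesis using nat by (simp add: int_pow_int)
  next
    case False
    then obtain k where k: "n = - int k" by (metis int_cases2 of_nat_0_le_iff)
    have "x [^]\<^bsub>G\<^esub> n = inv\<^bsub>G\<^esub> (x [^]\<^bsub>G\<^esub> k)" unfolding k by (rule int_pow_neg_int[OF x])
    also have "\<dots> = - (x [^]\<^bsub>G\<^esub> k)" by (rule inv[OF nat_pow_closed[OF x]])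
    finally show ?thesis by (simp add: nat k)
  qed
qed

lemma frag_group_subgroup_closed:
  assumes G: "frag_group G" and I: "subgroup I G"
  shows "0 \<in> I" and "x \<in> I \<Longrightarrow> y \<in> I \<Longrightarrow> x + y \<in> I" and "x \<in> I \<Longrightarrow> frag_cmul n x \<in> I"
    and "(\<And>t. t \<in> T \<Longrightarrow> f t \<in> I) \<Longrightarrow> (\<Sum>t\<in>T. f t) \<in> I"
proof -
  interpret comm_group G using G by (simp add: frag_group_def)
  show z: "0 \<in> I" using subgroup.one_closed[OF I] G by (simp add: frag_group_def)
  have a: "x + y \<in> I" if "x \<in> I" "y \<in> I" for x y
    using subgroup.m_closed[OF I that] G by (simp add: frag_group_def)
  then show "x \<in> I \<Longrightarrow> y \<in> I \<Longrightarrow> x + y \<in> I" .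
  show "x \<in> I \<Longrightarrow> frag_cmul n x \<in> I"
    using subgroup_int_pow_closed[OF I] frag_group_int_pow[OF G] subgroup.mem_carrier[OF I] by metis
  show "(\<And>t. t \<in> T \<Longrightarrow> f t \<in> I) \<Longrightarrow> (\<Sum>t\<in>T. f t) \<in> I"
    by (induction T rule: infinite_finite_induct) (auto intro: z a)
qed

lemma frag_group_self: "frag_group G \<Longrightarrow> subgroup (carrier G) G"
  using comm_group.axioms(2) group.subgroup_self unfolding frag_group_def by blast

text \<open>Independence of classes in a quotient, expressed by representatives so that linear
  algebra applies.\<close>

definition independent_mod :: "('a \<Rightarrow>\<^sub>0 int) set \<Rightarrow> ('a \<Rightarrow>\<^sub>0 int) set \<Rightarrow> bool" where
  "independent_mod I S \<longleftrightarrow> finite S \<and>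
     (\<forall>c. (\<Sum>s\<in>S. frag_cmul (c s) s) \<in> I \<longrightarrow> (\<forall>s\<in>S. c s = 0))"

lemma coset_eq_self_iff:
  assumes G: "frag_group G" and I: "subgroup I G" and x: "x \<in> carrier G"
  shows "I #>\<^bsub>G\<^esub> x = I \<longleftrightarrow> x \<in> I"
proof -
  interpret G: comm_group G using G by (simp add: frag_group_def)
  show ?thesis using G.coset_join1[OF _ x I] G.coset_join2[OF x I] by blast
qed

lemma coset_eq_iff:
  assumes G: "frag_group G" and I: "subgroup I G" and x: "x \<in> carrier G" "y \<in> carrier G"
  shows "I #>\<^bsub>G\<^esub> x = I #>\<^bsub>G\<^esub> y \<Longrightarrow> x - y \<in> I"
proof -
  interpret G: comm_group G using G by (simp add: frag_group_def)
  assume "I #>\<^bsub>G\<^esub> x = I #>\<^bsub>G\<^esub> y"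
  then have "x \<in> I #>\<^bsub>G\<^esub> y" using G.rcos_self[OF x(1) I] by simp
  then obtain h where "h \<in> I" "x = h + y" using G by (auto simp: r_coset_def frag_group_def)
  then show ?thesis by simp
qed

lemma finprod_FactGroup:
  assumes G: "frag_group G" and I: "subgroup I G" and T: "finite T" "T \<subseteq> carrier G"
  shows "finprod (G Mod I) (\<lambda>t. (I #>\<^bsub>G\<^esub> t) [^]\<^bsub>G Mod I\<^esub> (c t :: int)) T =
    I #>\<^bsub>G\<^esub> (\<Sum>t\<in>T. frag_cmul (c t) t)"
proof -
  interpret G: comm_group G using G by (simp add: frag_group_def)
  interpret N: normal I G using I G.normal_iff_subgroup by blast
  interpret Q: comm_group "G Mod I" using G.abelian_FactGroup[OF I] .
  show ?thesis using T
  proof (induction T)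
    case empty
    have "I #>\<^bsub>G\<^esub> 0 = I"
      using coset_eq_self_iff[OF G I] frag_group_subgroup_closed(1)[OF G] I frag_group_self[OF G] by blast
    then show ?case by simp
  next
    case (insert t T)
    have c: "I #>\<^bsub>G\<^esub> t \<in> carrier (G Mod I)" if "t \<in> carrier G" for t
      using that unfolding carrier_FactGroup by blast
    have s: "(\<Sum>t\<in>T. frag_cmul (c t) t) \<in> carrier G" "frag_cmul (c t) t \<in> carrier G"
      using insert.prems by (auto intro!: frag_group_subgroup_closed(3,4)[OF G frag_group_self[OF G]])
    have "finprod (G Mod I) (\<lambda>t. (I #>\<^bsub>G\<^esub> t) [^]\<^bsub>G Mod I\<^esub> c t) (insert t T) =
      (I #>\<^bsub>G\<^esub> t) [^]\<^bsub>G Mod I\<^esub> c t \<otimes>\<^bsub>G Mod I\<^esub> (I #>\<^bsub>G\<^esub> (\<Sum>t\<in>T. frag_cmul (c t) t))"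
      using insert c by (subst Q.finprod_insert) auto
    also have "(I #>\<^bsub>G\<^esub> t) [^]\<^bsub>G Mod I\<^esub> c t = I #>\<^bsub>G\<^esub> frag_cmul (c t) t"
      using N.FactGroup_int_pow[of t "c t"] frag_group_int_pow[OF G] insert.prems by simp
    also have "(I #>\<^bsub>G\<^esub> frag_cmul (c t) t) \<otimes>\<^bsub>G Mod I\<^esub> (I #>\<^bsub>G\<^esub> (\<Sum>t\<in>T. frag_cmul (c t) t)) =
      I #>\<^bsub>G\<^esub> (frag_cmul (c t) t \<otimes>\<^bsub>G\<^esub> (\<Sum>t\<in>T. frag_cmul (c t) t))"
      using N.rcos_sum s by simp
    finally show ?case using insert.hyps G by (simp add: frag_group_def)
  qed
qed

text \<open>Together with the converse below, this matches the sizes of independent sets of cosets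
  with those of sets independent modulo \<open>I\<close>; sizes are all that the rank
  records.\<close>

lemma independent_mod_imp_quotient:
  assumes G: "frag_group G" and I: "subgroup I G" and S: "S \<subseteq> carrier G" "independent_mod I S"
  shows "int_independent (G Mod I) ((\<lambda>s. I #>\<^bsub>G\<^esub> s) ` S)" and "card ((\<lambda>s. I #>\<^bsub>G\<^esub> s) ` S) = card S"
proof -
  interpret G: comm_group G using G by (simp add: frag_group_def)
  interpret Q: comm_group "G Mod I" using G.abelian_FactGroup[OF I] .
  have fin: "finite S" using S(2) by (simp add: independent_mod_def)
  have ind: "c s = 0" if "(\<Sum>s\<in>S. frag_cmul (c s) s) \<in> I" "s \<in> S" for c s
    using S(2) that unfolding independent_mod_def by blast
  have inj: "inj_on (\<lambda>s. I #>\<^bsub>G\<^esub> s) S"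
  proof (rule inj_onI, rule ccontr)
    fix s t assume st: "s \<in> S" "t \<in> S" "I #>\<^bsub>G\<^esub> s = I #>\<^bsub>G\<^esub> t" "s \<noteq> t"
    \<comment> \<open>Two representatives of one coset would give a relation with coefficients 1 and
      -1.\<close>
    define c where "c r = (if r = s then 1 else if r = t then - 1 else 0 :: int)" for r
    have "(\<Sum>r\<in>S. frag_cmul (c r) r) = (\<Sum>r\<in>{s, t}. frag_cmul (c r) r)"
      using fin st by (intro sum.mono_neutral_right) (auto simp: c_def)
    also have "\<dots> = s - t" using st(4) by (simp add: c_def)
    finally have "c s = 0" using ind[of c s] coset_eq_iff[OF G I _ _ st(3)] st(1,2) S(1) by auto
    then show False by (simp add: c_def)
  qed
  then show "card ((\<lambda>s. I #>\<^bsub>G\<^esub> s) ` S) = card S" by (rule card_image)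
  show "int_independent (G Mod I) ((\<lambda>s. I #>\<^bsub>G\<^esub> s) ` S)"
    unfolding int_independent_def
  proof (intro conjI allI impI)
    show c: "(\<lambda>s. I #>\<^bsub>G\<^esub> s) ` S \<subseteq> carrier (G Mod I)" using S(1) unfolding carrier_FactGroup by blast
    fix c :: "('a \<Rightarrow>\<^sub>0 int) set \<Rightarrow> int"
    assume "finprod (G Mod I) (\<lambda>x. x [^]\<^bsub>G Mod I\<^esub> c x) ((\<lambda>s. I #>\<^bsub>G\<^esub> s) ` S) = \<one>\<^bsub>G Mod I\<^esub>"
    moreover have "finprod (G Mod I) (\<lambda>x. x [^]\<^bsub>G Mod I\<^esub> c x) ((\<lambda>s. I #>\<^bsub>G\<^esub> s) ` S) =
        finprod (G Mod I) (\<lambda>s. (I #>\<^bsub>G\<^esub> s) [^]\<^bsub>G Mod I\<^esub> c (I #>\<^bsub>G\<^esub> s)) S"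
      using c by (intro Q.finprod_reindex[OF _ inj]) auto
    ultimately have "I #>\<^bsub>G\<^esub> (\<Sum>s\<in>S. frag_cmul (c (I #>\<^bsub>G\<^esub> s)) s) = I"
      using finprod_FactGroup[OF G I fin S(1), of "\<lambda>s. c (I #>\<^bsub>G\<^esub> s)"] by simp
    moreover have "(\<Sum>s\<in>S. frag_cmul (c (I #>\<^bsub>G\<^esub> s)) s) \<in> carrier G"
      using S(1) by (intro frag_group_subgroup_closed(3,4)[OF G frag_group_self[OF G]]) auto
    ultimately have "(\<Sum>s\<in>S. frag_cmul (c (I #>\<^bsub>G\<^esub> s)) s) \<in> I"
      using coset_eq_self_iff[OF G I] by blast
    from ind[OF this] show "\<forall>x\<in>(\<lambda>s. I #>\<^bsub>G\<^esub> s) ` S. c x = 0" by blast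
  qed (use fin in simp)
qed

lemma quotient_imp_independent_mod:
  assumes G: "frag_group G" and I: "subgroup I G" and S: "int_independent (G Mod I) S"
  obtains S' where "S' \<subseteq> carrier G" "independent_mod I S'" "card S' = card S"
proof -
  interpret G: comm_group G using G by (simp add: frag_group_def)
  interpret Q: comm_group "G Mod I" using G.abelian_FactGroup[OF I] .
  let ?q = "\<lambda>s. I #>\<^bsub>G\<^esub> s"
  have "S \<subseteq> ?q ` carrier G" using S unfolding int_independent_def carrier_FactGroup by blast
  then obtain S' where S': "S' \<subseteq> carrier G" "inj_on ?q S'" "S = ?q ` S'"
    by (meson subset_image_inj)
  have "finite S" using S unfolding int_independent_def by blast
  then have fin: "finite S'" unfolding S'(3) using S'(2) by (rule finite_imageD)
  show thesis
  proof (rule that[OF S'(1)])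
    show "card S' = card S" unfolding S'(3) by (rule card_image[OF S'(2), symmetric])
    show "independent_mod I S'"
      unfolding independent_mod_def
    proof (intro conjI allI impI ballI)
      fix c s assume c: "(\<Sum>s\<in>S'. frag_cmul (c s) s) \<in> I" and s: "s \<in> S'"
      define d where "d x = c (the_inv_into S' ?q x)" for x
      have d: "d (?q s) = c s" if "s \<in> S'" for s
        using that S'(2) by (simp add: d_def the_inv_into_f_f)
      have sub: "?q ` S' \<subseteq> carrier (G Mod I)" using S'(1) unfolding carrier_FactGroup by blast
      have "finprod (G Mod I) (\<lambda>x. x [^]\<^bsub>G Mod I\<^esub> d x) S =
        finprod (G Mod I) (\<lambda>s. ?q s [^]\<^bsub>G Mod I\<^esub> d (?q s)) S'"
        unfolding S'(3) using sub by (intro Q.finprod_reindex[OF _ S'(2)]) auto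
      also have "\<dots> = finprod (G Mod I) (\<lambda>s. ?q s [^]\<^bsub>G Mod I\<^esub> c s) S'"
        using sub d by (intro Q.finprod_cong') auto
      also have "\<dots> = ?q (\<Sum>s\<in>S'. frag_cmul (c s) s)" by (rule finprod_FactGroup[OF G I fin S'(1)])
      also have "\<dots> = I" using coset_eq_self_iff[OF G I subgroup.mem_carrier[OF I c]] c by blast
      finally have "\<forall>x\<in>S. d x = 0" using S unfolding int_independent_def by simp
      then show "c s = 0" using d[OF s] s S'(3) by simp
    qed (rule fin)
  qed
qed

lemma rat_vec_in_span_units:
  assumes "Poly_Mapping.keys x \<subseteq> B" "finite B"
  shows "rat_vec x \<in> rat_fun.span ((\<lambda>b i. if i = b then 1 else 0) ` B)"
proof -
  have eq: "rat_vec x = (\<Sum>b\<in>B. (\<lambda>i. rat_vec x b * (if i = b then 1 else 0)))"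
  proof
    fix i
    have "rat_vec x i = (\<Sum>b\<in>B. rat_vec x b * (if i = b then 1 else 0))"
    proof -
      have "(\<Sum>b\<in>B. rat_vec x b * (if i = b then 1 else 0)) = (\<Sum>b\<in>B. if i = b then rat_vec x b else 0)"
        by (intro sum.cong) auto
      also have "\<dots> = (if i \<in> B then rat_vec x i else 0)" using assms(2) by simp
      also have "\<dots> = rat_vec x i" using assms(1) by (auto simp: rat_vec_def in_keys_iff)
      finally show ?thesis by simp
    qed
    then show "rat_vec x i = (\<Sum>b\<in>B. (\<lambda>i. rat_vec x b * (if i = b then 1 else 0))) i"
      by (simp add: sum_fun_apply)
  qed
  show ?thesis
    by (subst eq) (intro rat_fun.span_sum rat_fun.span_scale rat_fun.span_base imageI)
qed

text \<open>Choosing bases among the vectors of \<open>I\<close> and \<open>K\<close> themselves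
  keeps them integral; finiteness comes from the finite set \<open>B\<close> of coordinates.\<close>

lemma rat_basis:
  assumes "finite B" "\<And>x. x \<in> K \<Longrightarrow> Poly_Mapping.keys x \<subseteq> B" "I \<subseteq> K"
  obtains T S where "finite T" "finite S" "T \<inter> S = {}" "T \<subseteq> I" "S \<subseteq> K"
    "rat_fun.independent (rat_vec ` (T \<union> S))" "rat_vec ` I \<subseteq> rat_fun.span (rat_vec ` T)"
    "rat_vec ` K \<subseteq> rat_fun.span (rat_vec ` (T \<union> S))"
    "card T = rat_dim I" "card (T \<union> S) = rat_dim K"
proof -
  obtain T0 where T0: "T0 \<subseteq> rat_vec ` I" "rat_fun.independent T0" "rat_vec ` I \<subseteq> rat_fun.span T0"
    by (rule rat_fun.maximal_independent_subset)
  have "T0 \<subseteq> rat_vec ` K" using T0(1) assms(3) by blast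
  then obtain B0 where B0: "T0 \<subseteq> B0" "B0 \<subseteq> rat_vec ` K" "rat_fun.independent B0" "rat_vec ` K \<subseteq> rat_fun.span B0"
    using rat_fun.maximal_independent_subset_extend T0(2) by metis
  define T where "T = {x \<in> I. rat_vec x \<in> T0}"
  define S where "S = {x \<in> K. rat_vec x \<in> B0} - T"
  have im: "rat_vec ` T = T0" using T0(1) by (auto simp: T_def)
  have imB: "rat_vec ` (T \<union> S) = B0"
  proof -
    have "T \<union> S = {x \<in> K. rat_vec x \<in> B0}" using assms(3) B0(1) by (auto simp: T_def S_def)
    then show ?thesis using B0(2) by auto
  qed
  have "B0 \<subseteq> rat_fun.span ((\<lambda>b i. if i = b then 1 else 0) ` B)"
    using B0(2) rat_vec_in_span_units[OF assms(2) assms(1)] by blast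
  then have "finite B0"
    using rat_fun.independent_span_bound[OF _ B0(3)] assms(1) by blast
  then have fin: "finite (T \<union> S)"
    using imB inj_rat_vec by (metis finite_imageD inj_on_subset subset_UNIV)
  have c: "card (rat_vec ` X) = card X" for X :: "('a \<Rightarrow>\<^sub>0 int) set"
    by (intro card_image inj_on_subset[OF inj_rat_vec]) simp
  show thesis
  proof (rule that[of T S])
    show "card T = rat_dim I"
      using rat_fun.basis_card_eq_dim[OF T0(1,3,2)] c[of T] im by (simp add: rat_dim_def)
    show "card (T \<union> S) = rat_dim K"
      using rat_fun.basis_card_eq_dim[OF B0(2,4,3)] c[of "T \<union> S"] imB by (simp add: rat_dim_def)
  qed (use fin im imB T0 B0 in \<open>auto simp: T_def S_def\<close>)
qed

lemma rat_vec_independentD: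
  assumes "rat_fun.independent (rat_vec ` S)" "finite S" "(\<Sum>s\<in>S. (\<lambda>i. u s * rat_vec s i)) = 0" "s \<in> S"
  shows "u s = 0"
proof (rule ccontr)
  assume "u s \<noteq> 0"
  define w where "w v = u (the_inv rat_vec v)" for v
  have w: "w (rat_vec s) = u s" for s by (simp add: w_def the_inv_f_f[OF inj_rat_vec])
  have "(\<Sum>v\<in>rat_vec ` S. (\<lambda>i. w v * v i)) = (\<Sum>s\<in>S. (\<lambda>i. u s * rat_vec s i))"
    using inj_on_subset[OF inj_rat_vec] by (subst sum.reindex) (auto simp: w)
  moreover have "w (rat_vec s) \<noteq> 0" using w \<open>u s \<noteq> 0\<close> by simp
  ultimately have "\<exists>w. (\<exists>v\<in>rat_vec ` S. w v \<noteq> 0) \<and> (\<Sum>v\<in>rat_vec ` S. (\<lambda>i. w v * v i)) = 0"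
    using assms(3,4) by (intro exI[of _ w]) auto
  then have "rat_fun.dependent (rat_vec ` S)"
    using rat_fun.dependent_finite[OF finite_imageI[OF assms(2)], of rat_vec] by blast
  then show False using assms(1) by blast
qed

lemma rat_vec_independentI:
  assumes "finite S" "\<And>u s. (\<Sum>s\<in>S. (\<lambda>i. u s * rat_vec s i)) = 0 \<Longrightarrow> s \<in> S \<Longrightarrow> u s = 0"
  shows "rat_fun.independent (rat_vec ` S)"
proof
  assume "rat_fun.dependent (rat_vec ` S)"
  then obtain w where w: "\<exists>v\<in>rat_vec ` S. w v \<noteq> 0" "(\<Sum>v\<in>rat_vec ` S. (\<lambda>i. w v * v i)) = 0"
    using rat_fun.dependent_finite assms(1) by blast
  have "(\<Sum>v\<in>rat_vec ` S. (\<lambda>i. w v * v i)) = (\<Sum>s\<in>S. (\<lambda>i. w (rat_vec s) * rat_vec s i))"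
    using inj_on_subset[OF inj_rat_vec] by (subst sum.reindex) auto
  then show False using assms(2)[of "\<lambda>s. w (rat_vec s)"] w by auto
qed

text \<open>\<open>T\<close> spans \<open>I\<close> rationally, and \<open>S\<close> completes it to
  a basis for the whole group. Then \<open>S\<close> is independent modulo \<open>I\<close>, and any
  set independent modulo \<open>I\<close> stays independent when \<open>T\<close> is added, so it
  has at most \<open>card S\<close> elements.\<close>

lemma abelian_rank_quotient:
  assumes G: "frag_group G" and I: "subgroup I G" and B: "finite B"
    and K: "\<And>x. x \<in> carrier G \<Longrightarrow> Poly_Mapping.keys x \<subseteq> B"
  shows "abelian_rank (G Mod I) + rat_dim I = rat_dim (carrier G)"
proof -
  have "I \<subseteq> carrier G" using subgroup.subset[OF I] .
  from rat_basis[OF B K this] obtain T S where TS: "finite T" "finite S" "T \<inter> S = {}" "T \<subseteq> I" "S \<subseteq> carrier G"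
    "rat_fun.independent (rat_vec ` (T \<union> S))" "rat_vec ` I \<subseteq> rat_fun.span (rat_vec ` T)"
    "rat_vec ` carrier G \<subseteq> rat_fun.span (rat_vec ` (T \<union> S))"
    "card T = rat_dim I" "card (T \<union> S) = rat_dim (carrier G)" by metis
  note cl = frag_group_subgroup_closed[OF G I]
  have indS: "independent_mod I S"
    unfolding independent_mod_def
  proof (intro conjI allI impI ballI)
    fix c s assume c: "(\<Sum>s\<in>S. frag_cmul (c s) s) \<in> I" and s: "s \<in> S"
    have "rat_vec (\<Sum>s\<in>S. frag_cmul (c s) s) \<in> rat_fun.span (rat_vec ` T)" using c TS(7) by blast
    then obtain w where "rat_vec (\<Sum>s\<in>S. frag_cmul (c s) s) = (\<Sum>v\<in>rat_vec ` T. (\<lambda>i. w v * v i))"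
      using rat_fun.span_finite[of "rat_vec ` T"] TS(1) by auto
    also have "\<dots> = (\<Sum>t\<in>T. (\<lambda>i. w (rat_vec t) * rat_vec t i))"
      using inj_on_subset[OF inj_rat_vec] by (subst sum.reindex) auto
    finally have e: "(\<Sum>s\<in>S. (\<lambda>i. of_int (c s) * rat_vec s i)) = (\<Sum>t\<in>T. (\<lambda>i. w (rat_vec t) * rat_vec t i))"
      by (simp add: rat_vec_sum)
    \<comment> \<open>A combination of \<open>S\<close> lying in the span of \<open>T\<close>
      becomes a relation on the joint basis.\<close>
    define u where "u x = (if x \<in> T then - w (rat_vec x) else of_int (c x))" for x
    have "(\<Sum>x\<in>T \<union> S. (\<lambda>i. u x * rat_vec x i)) =
        (\<Sum>x\<in>T. (\<lambda>i. u x * rat_vec x i)) + (\<Sum>x\<in>S. (\<lambda>i. u x * rat_vec x i))"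
      using TS(1-3) by (rule sum.union_disjoint)
    also have "(\<Sum>x\<in>S. (\<lambda>i. u x * rat_vec x i)) = (\<Sum>s\<in>S. (\<lambda>i. of_int (c s) * rat_vec s i))"
      using TS(3) by (intro sum.cong) (auto simp: u_def)
    also have "(\<Sum>x\<in>T. (\<lambda>i. u x * rat_vec x i)) = - (\<Sum>t\<in>T. (\<lambda>i. w (rat_vec t) * rat_vec t i))"
      unfolding sum_negf[symmetric] by (intro sum.cong) (auto simp: u_def fun_eq_iff)
    finally have "(\<Sum>x\<in>T \<union> S. (\<lambda>i. u x * rat_vec x i)) = 0" unfolding e by (simp add: zero_fun_def)
    then have "u s = 0" using rat_vec_independentD[OF TS(6)] TS(1,2) s by blast
    moreover have "s \<notin> T" using s TS(3) by blast
    ultimately show "c s = 0" by (simp add: u_def)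
  qed (rule TS(2))
  have bound: "card S' \<le> card S" if S': "S' \<subseteq> carrier G" "independent_mod I S'" for S'
  proof -
    have fin: "finite S'" using S'(2) by (simp add: independent_mod_def)
    have ind: "c s = 0" if "(\<Sum>s\<in>S'. frag_cmul (c s) s) \<in> I" "s \<in> S'" for c s
      using S'(2) that unfolding independent_mod_def by blast
    have disj: "T \<inter> S' = {}"
    proof (rule ccontr)
      assume "T \<inter> S' \<noteq> {}"
      then obtain s where s: "s \<in> T" "s \<in> S'" by blast
      have "(\<Sum>r\<in>S'. frag_cmul (if r = s then 1 else 0) r) = (\<Sum>r\<in>{s}. frag_cmul (if r = s then 1 else 0) r)"
        using fin s by (intro sum.mono_neutral_right) auto
      also have "\<dots> \<in> I" using s TS(4) by auto
      finally show False using ind[of "\<lambda>r. if r = s then 1 else 0" s] s(2) by simp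
    qed
    have "rat_fun.independent (rat_vec ` (T \<union> S'))"
    proof (rule rat_vec_independentI)
      show fin': "finite (T \<union> S')" using TS(1) fin by simp
      fix u :: "('a \<Rightarrow>\<^sub>0 int) \<Rightarrow> rat" and x
      assume u: "(\<Sum>x\<in>T \<union> S'. (\<lambda>i. u x * rat_vec x i)) = 0" and x: "x \<in> T \<union> S'"
      \<comment> \<open>After multiplication by a common denominator the relation is integral; its
        \<open>T\<close> part lies in \<open>I\<close>, so its \<open>S'\<close> part does too and
        has zero coefficients.\<close>
      obtain D :: int and n where D: "D \<noteq> 0" "\<And>s. s \<in> T \<union> S' \<Longrightarrow> of_int D * u s = of_int (n s)"
        using clear_denominators[OF fin', of u] by metis
      have "rat_vec (\<Sum>x\<in>T \<union> S'. frag_cmul (n x) x) = 0"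
      proof
        fix i
        have "rat_vec (\<Sum>x\<in>T \<union> S'. frag_cmul (n x) x) i = (\<Sum>x\<in>T \<union> S'. of_int (n x) * rat_vec x i)"
          by (simp add: rat_vec_sum sum_fun_apply)
        also have "\<dots> = (\<Sum>x\<in>T \<union> S'. of_int D * (u x * rat_vec x i))"
          using D(2) by (intro sum.cong) (auto simp: mult.assoc[symmetric])
        also have "\<dots> = of_int D * (\<Sum>x\<in>T \<union> S'. (\<lambda>i. u x * rat_vec x i)) i"
          by (simp add: sum_distrib_left sum_fun_apply)
        finally show "rat_vec (\<Sum>x\<in>T \<union> S'. frag_cmul (n x) x) i = 0 i" unfolding u by simp
      qed
      then have z: "(\<Sum>x\<in>T. frag_cmul (n x) x) + (\<Sum>x\<in>S'. frag_cmul (n x) x) = 0"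
        unfolding rat_vec_eq_0_iff using TS(1) fin disj by (simp add: sum.union_disjoint)
      have "(\<Sum>x\<in>T. frag_cmul (n x) x) \<in> I" using TS(4) by (intro cl(3,4)) auto
      then have "frag_cmul (- 1) (\<Sum>x\<in>T. frag_cmul (n x) x) \<in> I" by (rule cl(3))
      moreover have "(\<Sum>x\<in>S'. frag_cmul (n x) x) = frag_cmul (- 1) (\<Sum>x\<in>T. frag_cmul (n x) x)"
        using z by (simp only: add_eq_0_iff frag_cmul_minus_one)
      ultimately have "(\<Sum>x\<in>S'. frag_cmul (n x) x) \<in> I" by (simp only:)
      then have n0: "n s = 0" if "s \<in> S'" for s by (rule ind[OF _ that])
      have uS: "u s = 0" if "s \<in> S'" for s using D(1) D(2)[of s] n0[OF that] that by simp
      have "(\<Sum>x\<in>T. (\<lambda>i. u x * rat_vec x i)) = (\<Sum>x\<in>T \<union> S'. (\<lambda>i. u x * rat_vec x i))"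
        using fin' uS by (intro sum.mono_neutral_left) (auto simp: fun_eq_iff)
      then have "u t = 0" if "t \<in> T" for t
        using rat_vec_independentD[of T u t] TS(1) that u
          rat_fun.independent_mono[OF TS(6), of "rat_vec ` T"] by auto
      then show "u x = 0" using uS x by blast
    qed
    moreover have "rat_vec ` (T \<union> S') \<subseteq> rat_fun.span (rat_vec ` (T \<union> S))"
      using TS(4,8) S'(1) \<open>I \<subseteq> carrier G\<close> by blast
    ultimately have "card (rat_vec ` (T \<union> S')) \<le> card (rat_vec ` (T \<union> S))"
      using rat_fun.independent_span_bound[of "rat_vec ` (T \<union> S)"] TS(1,2) by simp
    then have "card (T \<union> S') \<le> card (T \<union> S)"
      by (simp only: card_image[OF inj_on_subset[OF inj_rat_vec subset_UNIV]])
    then show ?thesis using TS(1-3) fin disj by (simp add: card_Un_disjoint)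
  qed
  have "abelian_rank (G Mod I) = card S"
    unfolding abelian_rank_def
  proof (rule cSup_eq_maximum)
    show "card S \<in> {card S |S. int_independent (G Mod I) S}"
      using independent_mod_imp_quotient[OF G I TS(5) indS] by (metis (mono_tags, lifting) mem_Collect_eq)
    fix k assume "k \<in> {card S |S. int_independent (G Mod I) S}"
    then obtain Q where Q: "int_independent (G Mod I) Q" "k = card Q" by blast
    from quotient_imp_independent_mod[OF G I Q(1)] obtain S'
      where "S' \<subseteq> carrier G" "independent_mod I S'" "card S' = card Q" .
    then show "k \<le> card S" using bound[of S'] Q(2) by simp
  qed
  then show ?thesis using TS(1,2,3,9,10) by (simp add: card_Un_disjoint)
qed

lemma abelian_rank_iso:
  assumes "group G" "group H" "comm_group G" "comm_group H" "G \<cong> H"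
  shows "abelian_rank G = abelian_rank H"
proof -
  have le: "{card S | S. int_independent G S} \<subseteq> {card S | S. int_independent H S}"
    if G: "comm_group G" and H: "comm_group H" and iso: "h \<in> iso G H"
    for G :: "('x, 'y) monoid_scheme" and H :: "('z, 'w) monoid_scheme" and h
  proof
    interpret G: comm_group G by (rule G)
    interpret H: comm_group H by (rule H)
    interpret group_hom G H h using iso by unfold_locales (auto simp: iso_def)
    have inj: "inj_on h (carrier G)" using iso by (simp add: iso_def bij_betw_def)
    fix k assume "k \<in> {card S | S. int_independent G S}"
    then obtain S where S: "int_independent G S" "k = card S" by blast
    then have fS: "finite S" "S \<subseteq> carrier G" by (auto simp: int_independent_def)
    have injS: "inj_on h S" using inj fS(2) by (rule inj_on_subset)
    have "int_independent H (h ` S)"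
      unfolding int_independent_def
    proof (intro conjI allI impI)
      show sub: "h ` S \<subseteq> carrier H" using fS(2) by auto
      fix c :: "'z \<Rightarrow> int" assume c: "finprod H (\<lambda>x. x [^]\<^bsub>H\<^esub> c x) (h ` S) = \<one>\<^bsub>H\<^esub>"
      have fin: "finprod H (\<lambda>s. h s [^]\<^bsub>H\<^esub> c (h s)) T = h (finprod G (\<lambda>s. s [^]\<^bsub>G\<^esub> c (h s)) T)"
        if "finite T" "T \<subseteq> carrier G" for T
        using that
      proof (induction T)
        case (insert t T)
        have cl: "finprod G (\<lambda>s. s [^]\<^bsub>G\<^esub> c (h s)) T \<in> carrier G"
          using insert.prems by (intro G.finprod_closed) auto
        have "finprod H (\<lambda>s. h s [^]\<^bsub>H\<^esub> c (h s)) (insert t T) =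
            h t [^]\<^bsub>H\<^esub> c (h t) \<otimes>\<^bsub>H\<^esub> finprod H (\<lambda>s. h s [^]\<^bsub>H\<^esub> c (h s)) T"
          using insert by (intro H.finprod_insert) auto
        also have "\<dots> = h (t [^]\<^bsub>G\<^esub> c (h t) \<otimes>\<^bsub>G\<^esub> finprod G (\<lambda>s. s [^]\<^bsub>G\<^esub> c (h s)) T)"
          using insert cl by (simp add: hom_int_pow)
        also have "t [^]\<^bsub>G\<^esub> c (h t) \<otimes>\<^bsub>G\<^esub> finprod G (\<lambda>s. s [^]\<^bsub>G\<^esub> c (h s)) T =
            finprod G (\<lambda>s. s [^]\<^bsub>G\<^esub> c (h s)) (insert t T)"
          using insert by (intro G.finprod_insert[symmetric]) auto
        finally show ?case .
      qed simp
      have "finprod H (\<lambda>x. x [^]\<^bsub>H\<^esub> c x) (h ` S) = finprod H (\<lambda>s. h s [^]\<^bsub>H\<^esub> c (h s)) S"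
        using sub by (intro H.finprod_reindex[OF _ injS]) auto
      then have "h (finprod G (\<lambda>s. s [^]\<^bsub>G\<^esub> c (h s)) S) = h \<one>\<^bsub>G\<^esub>" using c fin[OF fS] by simp
      moreover have "finprod G (\<lambda>s. s [^]\<^bsub>G\<^esub> c (h s)) S \<in> carrier G"
        using fS(2) by (intro G.finprod_closed) auto
      ultimately have "finprod G (\<lambda>s. s [^]\<^bsub>G\<^esub> c (h s)) S = \<one>\<^bsub>G\<^esub>"
        using inj G.one_closed by (meson inj_onD)
      then have "\<forall>s\<in>S. c (h s) = 0" using S(1) unfolding int_independent_def
        by (elim conjE) (erule allE[of _ "\<lambda>s. c (h s)"], simp)
      then show "\<forall>x\<in>h ` S. c x = 0" by blast
    qed (use fS in simp)
    then show "k \<in> {card S | S. int_independent H S}" using S(2) card_image[OF injS] by force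
  qed
  obtain h where h: "h \<in> iso G H" using assms(5) by (auto simp: is_iso_def)
  then have "inv_into (carrier G) h \<in> iso H G" by (rule group.iso_set_sym[OF assms(1)])
  from le[OF assms(3,4) h] le[OF assms(4,3) this] show ?thesis unfolding abelian_rank_def by simp
qed

section \<open>Dimensions of free groups, kernels and images\<close>

lemma rat_dim_zero: "rat_dim {0} = 0"
proof -
  have "rat_fun.dim {0 :: 'a \<Rightarrow> rat} = card ({} :: ('a \<Rightarrow> rat) set)"
    by (intro rat_fun.dim_eq_card) (auto simp: rat_fun.independent_empty)
  then show ?thesis by (simp add: rat_dim_def)
qed

lemma rat_dim_free:
  assumes "finite B"
  shows "rat_dim (carrier (free_Abelian_group B)) = card B"
proof -
  have ind: "rat_fun.independent (rat_vec ` frag_of ` B)"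
  proof (rule rat_vec_independentI)
    fix u :: "('a \<Rightarrow>\<^sub>0 int) \<Rightarrow> rat" and s
    assume u: "(\<Sum>s\<in>frag_of ` B. (\<lambda>i. u s * rat_vec s i)) = 0" and "s \<in> frag_of ` B"
    then obtain b where b: "b \<in> B" "s = frag_of b" by blast
    have "(\<Sum>s\<in>frag_of ` B. u s * rat_vec s b) = (\<Sum>s\<in>{frag_of b}. u s * rat_vec s b)"
      using assms b by (intro sum.mono_neutral_right) (auto simp: rat_vec_def frag_of_eq)
    moreover have "(\<Sum>s\<in>frag_of ` B. u s * rat_vec s b) = 0" using fun_cong[OF u, of b] by (simp add: sum_fun_apply)
    ultimately show "u s = 0" using b by (simp add: rat_vec_def)
  qed (use assms in simp)
  have unit: "rat_vec (frag_of b) = (\<lambda>i. if i = b then 1 else 0)" for b :: 'a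
    by (auto simp: rat_vec_def)
  have "rat_vec ` carrier (free_Abelian_group B) \<subseteq> rat_fun.span (rat_vec ` frag_of ` B)"
    using rat_vec_in_span_units[OF _ assms] by (auto simp: image_image unit)
  moreover have "rat_vec ` frag_of ` B \<subseteq> rat_vec ` carrier (free_Abelian_group B)" by auto
  ultimately have "card (rat_vec ` frag_of ` B) = rat_dim (carrier (free_Abelian_group B))"
    unfolding rat_dim_def using ind by (intro rat_fun.basis_card_eq_dim)
  moreover have "card (rat_vec ` frag_of ` B) = card B"
    by (simp only: card_image[OF inj_on_subset[OF inj_rat_vec subset_UNIV]])
      (auto intro!: card_image simp: inj_on_def frag_of_eq)
  ultimately show ?thesis by simp
qed

lemma frag_group_free: "frag_group (free_Abelian_group B)"
  using abelian_free_Abelian_group[of B] by (auto simp: frag_group_def fun_eq_iff)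

lemma frag_group_generated: "frag_group G \<Longrightarrow> frag_group (subgroup_generated G K)"
  using group.abelian_subgroup_generated[of G K] comm_group.axioms(2)[of G] by (auto simp: frag_group_def)

text \<open>The quotient by the kernel is isomorphic to the image, and
  \<open>abelian_rank_quotient\<close> evaluates both ranks.\<close>

lemma rat_dim_rank_nullity:
  assumes B: "finite B" "finite B'" and d: "d \<in> hom (free_Abelian_group B) (free_Abelian_group B')"
  shows "rat_dim (kernel (free_Abelian_group B) (free_Abelian_group B') d) +
    rat_dim (d ` carrier (free_Abelian_group B)) = card B"
proof -
  let ?C = "free_Abelian_group B" and ?D = "free_Abelian_group B'"
  interpret C: comm_group ?C by (rule abelian_free_Abelian_group)
  interpret D: comm_group ?D by (rule abelian_free_Abelian_group)
  interpret h: group_hom ?C ?D d using d by unfold_locales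
  define M where "M = d ` carrier ?C"
  define H where "H = subgroup_generated ?D M"
  have subM: "subgroup M ?D" unfolding M_def by (rule h.img_is_subgroup)
  have cH: "carrier H = M" unfolding H_def by (rule subgroup.carrier_subgroup_generated_subgroup[OF subM])
  have fH: "frag_group H" unfolding H_def by (rule frag_group_generated[OF frag_group_free])
  then interpret H: comm_group H by (simp add: frag_group_def)
  have hom: "d \<in> hom ?C H" using d cH by (auto simp: hom_def M_def H_def)
  interpret h': group_hom ?C H d using hom by unfold_locales
  have ker: "kernel ?C H d = kernel ?C ?D d" unfolding H_def kernel_def by simp
  have kB: "Poly_Mapping.keys x \<subseteq> B'" if "x \<in> carrier H" for x
    using subsetD[OF subgroup.subset[OF subM] that[unfolded cH]] by simp
  have "abelian_rank (?C Mod kernel ?C H d) + rat_dim (kernel ?C H d) = card B"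
    using abelian_rank_quotient[OF frag_group_free h'.subgroup_kernel B(1)] rat_dim_free[OF B(1)] by simp
  moreover have "?C Mod kernel ?C H d \<cong> H"
    by (rule h'.FactGroup_iso) (simp add: cH M_def)
  then have "abelian_rank (?C Mod kernel ?C H d) = abelian_rank H"
    using C.abelian_FactGroup[OF h'.subgroup_kernel] comm_group.axioms(2) H.comm_group_axioms H.is_group
    by (intro abelian_rank_iso) blast+
  \<comment> \<open>The image is written as a quotient by the trivial subgroup so that the same rank
    formula applies.\<close>
  moreover have "abelian_rank (H Mod {0}) + rat_dim {0 :: 'b \<Rightarrow>\<^sub>0 int} = rat_dim (carrier H)"
    using H.triv_subgroup fH by (intro abelian_rank_quotient[OF fH _ B(2) kB]) (auto simp: frag_group_def)
  moreover have "abelian_rank (H Mod {0}) = abelian_rank H"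
  proof (rule abelian_rank_iso)
    show "H Mod {0} \<cong> H" using H.trivial_factor_iso fH unfolding frag_group_def is_iso_def by auto
    show c: "comm_group (H Mod {0})" using H.abelian_FactGroup[OF H.triv_subgroup] fH by (simp add: frag_group_def)
    then show "group (H Mod {0})" by (rule comm_group.axioms(2))
  qed (unfold_locales)
  ultimately show ?thesis unfolding ker by (simp add: rat_dim_zero cH M_def)
qed



section \<open>Euler characteristics\<close>

definition free_complex :: "(int \<Rightarrow> int \<Rightarrow> 'a set) \<Rightarrow> ('a \<Rightarrow> 'a \<Rightarrow>\<^sub>0 int) \<Rightarrow> ('a \<Rightarrow>\<^sub>0 int) graded_complex" where
  "free_complex B d = \<lparr>chains = (\<lambda>i j. free_Abelian_group (B i j)), diff = (\<lambda>i. frag_extend d)\<rparr>"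

locale free_cochain_complex =
  fixes B :: "int \<Rightarrow> int \<Rightarrow> 'a set" and d :: "'a \<Rightarrow> 'a \<Rightarrow>\<^sub>0 int"
  assumes d_keys: "x \<in> B i j \<Longrightarrow> Poly_Mapping.keys (d x) \<subseteq> B (i + 1) j"
    and d_d: "x \<in> B i j \<Longrightarrow> frag_extend d (d x) = 0"
begin

abbreviation cycles :: "int \<Rightarrow> int \<Rightarrow> ('a \<Rightarrow>\<^sub>0 int) set" where
  "cycles i j \<equiv> kernel (free_Abelian_group (B i j)) (free_Abelian_group (B (i + 1) j)) (frag_extend d)"

abbreviation bounds :: "int \<Rightarrow> int \<Rightarrow> ('a \<Rightarrow>\<^sub>0 int) set" where
  "bounds i j \<equiv> frag_extend d ` carrier (free_Abelian_group (B (i - 1) j))"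

lemma d_hom: "frag_extend d \<in> hom (free_Abelian_group (B i j)) (free_Abelian_group (B (i + 1) j))"
proof (rule homI)
  fix x assume x: "x \<in> carrier (free_Abelian_group (B i j))"
  have "Poly_Mapping.keys (d y) \<subseteq> B (i + 1) j" if "y \<in> Poly_Mapping.keys x" for y
    using that x by (intro d_keys) auto
  then have "Poly_Mapping.keys (frag_extend d x) \<subseteq> B (i + 1) j" by (rule keys_frag_extend_subset)
  then show "frag_extend d x \<in> carrier (free_Abelian_group (B (i + 1) j))" by simp
qed (simp add: frag_extend_add)

lemma homology_free:
  "homology (free_complex B d) i j =
     subgroup_generated (free_Abelian_group (B i j)) (cycles i j) Mod bounds i j"
  by (simp add: homology_def free_complex_def)

lemma subgroup_cycles: "subgroup (cycles i j) (free_Abelian_group (B i j))"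
  using d_hom by (intro group_hom.subgroup_kernel) (auto simp: group_hom_def group_hom_axioms_def)

lemma carrier_cycles: "carrier (subgroup_generated (free_Abelian_group (B i j)) (cycles i j)) = cycles i j"
  by (rule subgroup.carrier_subgroup_generated_subgroup[OF subgroup_cycles])

lemma bounds_cycles: "bounds i j \<subseteq> cycles i j"
proof
  fix y assume "y \<in> bounds i j"
  then obtain x where x: "Poly_Mapping.keys x \<subseteq> B (i - 1) j" "y = frag_extend d x" by auto
  have "frag_extend d (d z) = 0" if "z \<in> Poly_Mapping.keys x" for z
    using that x(1) by (intro d_d) auto
  then have "frag_extend d y = 0" unfolding frag_extend_extend x(2) by (rule frag_extend_eq_0)
  moreover have "y \<in> carrier (free_Abelian_group (B i j))"
    using hom_in_carrier[OF d_hom[of "i - 1" j], of x] x by simp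
  ultimately show "y \<in> cycles i j" by (simp add: kernel_def)
qed

lemma subgroup_bounds: "subgroup (bounds i j) (subgroup_generated (free_Abelian_group (B i j)) (cycles i j))"
proof -
  have "subgroup (bounds i j) (free_Abelian_group (B i j))"
    using d_hom[of "i - 1" j] by (intro group_hom.img_is_subgroup) (auto simp: group_hom_def group_hom_axioms_def)
  then show ?thesis
    using bounds_cycles by (intro group.subgroup_of_subgroup_generated) auto
qed

lemma group_homology: "comm_group (homology (free_complex B d) i j)"
  unfolding homology_free
  using frag_group_generated[OF frag_group_free, of "B i j" "cycles i j"] subgroup_bounds
  by (intro comm_group.abelian_FactGroup) (auto simp: frag_group_def)

lemma rank_homology:
  assumes "finite (B i j)"
  shows "abelian_rank (homology (free_complex B d) i j) + rat_dim (bounds i j) = rat_dim (cycles i j)"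
proof -
  have "Poly_Mapping.keys x \<subseteq> B i j"
    if "x \<in> carrier (subgroup_generated (free_Abelian_group (B i j)) (cycles i j))" for x
    using that unfolding carrier_cycles by (simp add: kernel_def)
  from abelian_rank_quotient[OF frag_group_generated[OF frag_group_free] subgroup_bounds assms this]
  show ?thesis unfolding homology_free carrier_cycles by simp
qed

lemma rank_chains:
  assumes "finite (B i j)" "finite (B (i + 1) j)"
  shows "rat_dim (cycles i j) + rat_dim (bounds (i + 1) j) = card (B i j)"
  using rat_dim_rank_nullity[OF assms d_hom] by simp

lemma rank_homology_empty:
  assumes "B i j = {}"
  shows "abelian_rank (homology (free_complex B d) i j) = 0"
proof -
  have "cycles i j \<subseteq> {0}" using assms by (auto simp: kernel_def)
  then have "cycles i j = {0}" using frag_group_subgroup_closed(1)[OF frag_group_free subgroup_cycles] by blast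
  then show ?thesis using rank_homology[of i j] assms by (simp add: rat_dim_zero)
qed

text \<open>With \<open>m i\<close> the rank of the coboundaries in degree \<open>i\<close>, the
  rank of the homology is the number of generators minus \<open>m i\<close> and
  \<open>m (i + 1)\<close>; in the alternating sum these corrections telescope.\<close>

lemma alternating_rank_sum:
  assumes fin: "\<And>i. finite (B i j)" and empty: "\<And>i. i < a \<or> i > b \<Longrightarrow> B i j = {}"
  shows "(\<Sum>i\<in>{a..b}. (- 1) ^ nat \<bar>i\<bar> * int (abelian_rank (homology (free_complex B d) i j))) =
    (\<Sum>i\<in>{a..b}. (- 1) ^ nat \<bar>i\<bar> * int (card (B i j)))"
proof -
  let ?s = "\<lambda>i::int. (- 1 :: int) ^ nat \<bar>i\<bar>"
  have sgn: "?s (i + 1) = - ?s i" for i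
  proof (cases "i \<ge> 0")
    case True
    then have "nat \<bar>i + 1\<bar> = Suc (nat \<bar>i\<bar>)" by simp
    then show ?thesis by (simp only: power_Suc mult_minus1 minus_minus)
  next
    case False
    then have "nat \<bar>i\<bar> = Suc (nat \<bar>i + 1\<bar>)" by simp
    then show ?thesis by (simp only: power_Suc mult_minus1 minus_minus)
  qed
  define m where "m i = int (rat_dim (bounds i j))" for i
  \<comment> \<open>Coboundaries vanish already in degree \<open>a\<close>, as there are no chains
    below it; the shifted sum may therefore be extended to start at \<open>a\<close>.\<close>
  have m0: "m i = 0" if "i \<le> a \<or> i > b" for i
  proof -
    have "bounds i j \<subseteq> {0}"
    proof
      fix y assume "y \<in> bounds i j"
      then obtain x where x: "Poly_Mapping.keys x \<subseteq> B (i - 1) j" "y = frag_extend d x" by auto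
      show "y \<in> {0}"
      proof (cases "i \<le> a")
        case True
        then show ?thesis using x empty[of "i - 1"] by simp
      next
        case False
        then have "Poly_Mapping.keys y \<subseteq> B i j"
          using d_keys[of _ "i - 1" j] x by (auto intro!: keys_frag_extend_subset)
        then show ?thesis using that False empty[of i] by simp
      qed
    qed
    moreover have "0 \<in> bounds i j" by (rule image_eqI[of _ _ 0]) simp_all
    ultimately have "bounds i j = {0}" by blast
    then show ?thesis by (simp add: m_def rat_dim_zero)
  qed
  have rank: "int (abelian_rank (homology (free_complex B d) i j)) = int (card (B i j)) - m (i + 1) - m i" for i
    using rank_homology[OF fin, of i] rank_chains[OF fin fin, of i] by (simp add: m_def)
  have "(\<Sum>i\<in>{a..b}. ?s i * m (i + 1)) = (\<Sum>i\<in>{a+1..b+1}. ?s (i - 1) * m i)"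
    by (rule sum.reindex_bij_witness[where i = "\<lambda>i. i - 1" and j = "\<lambda>i. i + 1"]) auto
  also have "\<dots> = (\<Sum>i\<in>{a..b+1}. ?s (i - 1) * m i)"
    using m0 by (intro sum.mono_neutral_left) auto
  also have "\<dots> = - (\<Sum>i\<in>{a..b+1}. ?s i * m i)"
    unfolding sum_negf[symmetric]
  proof (intro sum.cong refl)
    fix i show "?s (i - 1) * m i = - (?s i * m i)"
      using sgn[of "i - 1"] unfolding diff_add_cancel by (metis minus_minus minus_mult_left)
  qed
  also have "(\<Sum>i\<in>{a..b+1}. ?s i * m i) = (\<Sum>i\<in>{a..b}. ?s i * m i)"
    using m0 by (intro sum.mono_neutral_right) auto
  finally have "(\<Sum>i\<in>{a..b}. ?s i * m (i + 1)) + (\<Sum>i\<in>{a..b}. ?s i * m i) = 0" by simp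
  then show ?thesis unfolding rank right_diff_distrib sum_subtractf by linarith
qed

end

section \<open>Coefficients of the Euler characteristic\<close>

lemma lookup_laurent_sum:
  assumes "finite {j. f j \<noteq> (0 :: 'a :: comm_monoid_add)}"
  shows "Poly_Mapping.lookup (\<Sum>j\<in>{j. f j \<noteq> 0}. Poly_Mapping.single j (f j)) k = f k"
  using assms by (simp add: lookup_sum lookup_single when_def)

text \<open>\<open>qdim\<close> and \<open>poincare_polynomial\<close> sum over all degrees with a
  nonzero entry, and a sum over an infinite set is 0 by convention; the finite sets \<open>J\<close>
  and \<open>N\<close> ensure that the sums have their intended values.\<close>

lemma lookup_euler_characteristic:
  assumes fin: "finite J" "\<And>i j. j \<notin> J \<Longrightarrow> abelian_rank (H i j) = 0"
    and N: "finite N" "\<And>i j. i \<notin> N \<Longrightarrow> abelian_rank (H i j) = 0"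
  shows "Poly_Mapping.lookup (euler_characteristic H) j = (\<Sum>i\<in>N. (- 1) ^ nat \<bar>i\<bar> * int (abelian_rank (H i j)))"
proof -
  have q: "Poly_Mapping.lookup (qdim (H i)) j = int (abelian_rank (H i j))" for i j
  proof -
    have "finite {j. int (abelian_rank (H i j)) \<noteq> 0}"
    proof (rule finite_subset[OF _ fin(1)])
      show "{j. int (abelian_rank (H i j)) \<noteq> 0} \<subseteq> J" using fin(2)[of _ i] by fastforce
    qed
    from lookup_laurent_sum[OF this] show ?thesis by (simp add: qdim_def)
  qed
  have q0: "qdim (H i) = 0" if "i \<notin> N" for i
    by (rule poly_mapping_eqI) (simp add: q N(2)[OF that])
  have "finite {i. qdim (H i) \<noteq> 0}" using q0 by (intro finite_subset[OF _ N(1)]) auto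
  from lookup_laurent_sum[OF this]
  have p: "Poly_Mapping.lookup (poincare_polynomial H) i = qdim (H i)" for i by (simp add: poincare_polynomial_def)
  have "Poly_Mapping.keys (poincare_polynomial H) \<subseteq> N"
    using q0 p by (metis in_keys_iff subsetI)
  then have "euler_characteristic H = (\<Sum>i\<in>N. (- 1) ^ nat \<bar>i\<bar> * qdim (H i))"
    unfolding euler_characteristic_def laurent_eval_neg1_def p
    using N(1) by (intro sum.mono_neutral_left) (auto simp: in_keys_iff p)
  moreover have "Poly_Mapping.lookup ((- 1) ^ n * p) j = (- 1) ^ n * Poly_Mapping.lookup p j"
    for n and p :: "int \<Rightarrow>\<^sub>0 int" by (induction n) simp_all
  ultimately show ?thesis by (simp add: lookup_sum q)
qed

lemma bigraded_iso_rank: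
  assumes "bigraded_iso H H'" "\<And>i j. comm_group (H i j)" "\<And>i j. comm_group (H' i j)"
  shows "abelian_rank (H i j) = abelian_rank (H' i j)"
  using assms unfolding bigraded_iso_def by (intro abelian_rank_iso) (auto intro: comm_group.axioms(2))

lemma bigraded_iso_euler:
  assumes "bigraded_iso H H'" "\<And>i j. comm_group (H i j)" "\<And>i j. comm_group (H' i j)"
  shows "euler_characteristic H = euler_characteristic H'"
  using bigraded_iso_rank[OF assms] by (simp add: euler_characteristic_def poincare_polynomial_def qdim_def)


section \<open>Graded ranks of the chain groups\<close>

lemma UNIV_vgen: "(UNIV :: vgen set) = {VPlus, VMinus}"
  using vgen.exhaust by auto

lemma UNIV_rgen: "(UNIV :: rgen set) = {X0, XMinus2}"
  using rgen.exhaust by auto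

abbreviation q_pow :: "int \<Rightarrow> int \<Rightarrow>\<^sub>0 int" where
  "q_pow i \<equiv> Poly_Mapping.single i 1"

lemma q_pow_add: "q_pow (a + b) = q_pow a * q_pow b"
  by (simp add: mult_single)

lemma q_pow_sum: "q_pow (\<Sum>x\<in>A. f x) = (\<Prod>x\<in>A. q_pow (f x))"
  by (induction A rule: infinite_finite_induct) (simp_all add: q_pow_add)

lemma sum_q_pow_PiE:
  assumes "finite A"
  shows "(\<Sum>f\<in>A \<rightarrow>\<^sub>E UNIV. q_pow (\<Sum>x\<in>A. vdeg (f x))) = (q_var + q_inv) ^ card A"
proof -
  have "(\<Sum>f\<in>A \<rightarrow>\<^sub>E UNIV. q_pow (\<Sum>x\<in>A. vdeg (f x))) = (\<Sum>f\<in>A \<rightarrow>\<^sub>E UNIV. \<Prod>x\<in>A. q_pow (vdeg (f x)))"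
    by (simp add: q_pow_sum)
  also have "\<dots> = (\<Prod>x\<in>A. \<Sum>y\<in>UNIV. q_pow (vdeg y))"
    using assms by (intro prod_sum_PiE[symmetric]) (auto simp: UNIV_vgen)
  finally show ?thesis by (simp add: UNIV_vgen)
qed

lemma sum_q_pow_lists:
  fixes deg :: "'a \<Rightarrow> int"
  assumes "finite (UNIV :: 'a set)"
  shows "(\<Sum>xs\<in>{xs :: 'a list. length xs = n}. q_pow (sum_list (map deg xs))) = (\<Sum>x\<in>UNIV. q_pow (deg x)) ^ n"
proof (induction n)
  case (Suc n)
  have "(\<Sum>xs\<in>{xs :: 'a list. length xs = Suc n}. q_pow (sum_list (map deg xs))) =
      (\<Sum>(x, xs)\<in>UNIV \<times> {xs :: 'a list. length xs = n}. q_pow (deg x) * q_pow (sum_list (map deg xs)))"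
    by (rule sum.reindex_bij_witness[where i = "\<lambda>(x, xs). x # xs" and j = "\<lambda>xs. (hd xs, tl xs)"])
      (auto simp: length_Suc_conv q_pow_add)
  also have "\<dots> = (\<Sum>x\<in>UNIV. q_pow (deg x)) * (\<Sum>xs\<in>{xs :: 'a list. length xs = n}. q_pow (sum_list (map deg xs)))"
    by (simp add: sum_product sum.cartesian_product)
  finally show ?case unfolding Suc.IH by simp
qed simp

text \<open>R has graded rank 1 + q^(-2); the shift by one for each factor turns it into q + q^(-1),
  the graded rank of V, so every tensor factor counts alike.\<close>

lemma sum_q_pow_rgen: "q_pow 1 ^ n * (\<Sum>x\<in>UNIV. q_pow (rdeg x)) ^ n = (q_var + q_inv) ^ n"
proof -
  have "(\<Sum>x\<in>UNIV. q_pow (rdeg x)) = q_pow 0 + q_pow (- 2)" unfolding UNIV_rgen by simp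
  then have "q_pow 1 * (\<Sum>x\<in>UNIV. q_pow (rdeg x)) = q_pow (1 + 0) + q_pow (1 + - 2)"
    by (simp only: distrib_left q_pow_add)
  then show ?thesis unfolding power_mult_distrib[symmetric] by simp
qed

lemma q_pow_of_nat: "q_pow (int n) = q_pow 1 ^ n"
proof (induction n)
  case (Suc n)
  have "q_pow (int (Suc n)) = q_pow 1 * q_pow (int n)" by (simp add: q_pow_add[symmetric] del: q_pow_add)
  then show ?case using Suc.IH by simp
qed simp

lemma poly_of_int_add: "poly (map_poly of_int (p + q :: int poly)) (x :: 'a :: comm_ring_1) =
    poly (map_poly of_int p) x + poly (map_poly of_int q) x"
proof -
  have "map_poly (of_int :: int \<Rightarrow> 'a) (p + q) = map_poly of_int p + map_poly of_int q"
    by (rule poly_eqI) (simp add: coeff_map_poly)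
  then show ?thesis by simp
qed

lemma poly_of_int_sum: "poly (map_poly of_int (\<Sum>i\<in>A. f i :: int poly)) (x :: 'a :: comm_ring_1) =
    (\<Sum>i\<in>A. poly (map_poly of_int (f i)) x)"
  by (induction A rule: infinite_finite_induct) (simp_all add: poly_of_int_add)

definition chain_gens :: "('v, 'h) fatgraph \<Rightarrow> int \<Rightarrow> int \<Rightarrow> ('v, 'h) tensor_gen set" where
  "chain_gens F i j =
     {x. \<exists>W\<subseteq>edges F. x \<in> state_gens F W \<and> int (height F W) = i + int (e_num F) \<and> gen_degree F x = j}"

lemma chromatic_complex_free: "chromatic_complex F es = free_complex (chain_gens F) (gen_diff F es)"
  by (simp add: chromatic_complex_def height_shift_def unshifted_complex_def free_complex_def chain_gens_def)

context fatgraph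
begin

lemma chain_gens_alt:
  "chain_gens F i j = {x. \<exists>W\<subseteq>edges F. - int (card W) = i \<and> x \<in> state_gens F W \<and> gen_degree F x = j}"
proof -
  have "int (height F W) = i + int (e_num F) \<longleftrightarrow> - int (card W) = i" if "W \<subseteq> edges F" for W
    using height_state[OF that] card_mono[OF finite_edges that] by (auto simp: e_num_def)
  then show ?thesis unfolding chain_gens_def by blast
qed

lemma state_gens_image:
  assumes "W \<subseteq> edges F"
  shows "state_gens F W = (\<lambda>(a, b, gs, rs). Tensor W a b gs rs) `
    ((verts F \<rightarrow>\<^sub>E UNIV) \<times> (boundaries (spanning_subgraph F W) \<rightarrow>\<^sub>E UNIV) \<times>
      {gs. length gs = 2 * genus (spanning_subgraph F W)} \<times> {rs. length rs = height F W})"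
  by (auto simp: state_gens_def Let_def spanning_subgraph_def image_iff)

lemma finite_lists_length: "finite (UNIV :: 'a set) \<Longrightarrow> finite {xs :: 'a list. length xs = n}"
  using finite_lists_length_eq[of UNIV n] by simp

lemma finite_state_gens:
  assumes "W \<subseteq> edges F" shows "finite (state_gens F W)"
proof -
  have "finite (boundaries (spanning_subgraph F W))"
    unfolding boundaries_spanning[OF assms] using finite_points by simp
  then show ?thesis unfolding state_gens_image[OF assms] using finite_verts
    by (intro finite_imageI finite_cartesian_product finite_PiE finite_lists_length) (auto simp: UNIV_vgen UNIV_rgen)
qed

lemma qdim_state_gens:
  assumes W: "W \<subseteq> edges F"
  shows "(\<Sum>x\<in>state_gens F W. q_pow (gen_degree F x)) =
    (q_var + q_inv) ^ (2 * state_components F W + e_num F)"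
proof -
  let ?H = "spanning_subgraph F W"
  let ?A = "verts F \<rightarrow>\<^sub>E (UNIV :: vgen set)" and ?B = "boundaries ?H \<rightarrow>\<^sub>E (UNIV :: vgen set)"
  let ?G = "{gs :: vgen list. length gs = 2 * genus ?H}" and ?R = "{rs :: rgen list. length rs = height F W}"
  let ?r = "q_var + q_inv"
  have finB: "finite (boundaries ?H)" unfolding boundaries_spanning[OF W] using finite_points by simp
  have deg: "gen_degree F (Tensor W a b gs rs) = (\<Sum>v\<in>verts F. vdeg (a v)) + ((\<Sum>c\<in>boundaries ?H. vdeg (b c)) +
     (sum_list (map vdeg gs) + (sum_list (map rdeg rs) + int (height F W))))" for a b gs rs
    by (simp add: gen_degree_def Let_def spanning_subgraph_def)
  have "(\<Sum>x\<in>state_gens F W. q_pow (gen_degree F x)) =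
      (\<Sum>(a, b, gs, rs)\<in>?A \<times> ?B \<times> ?G \<times> ?R. q_pow (gen_degree F (Tensor W a b gs rs)))"
    unfolding state_gens_image[OF W] by (subst sum.reindex) (auto simp: inj_on_def case_prod_beta)
  also have "\<dots> = (\<Sum>a\<in>?A. q_pow (\<Sum>v\<in>verts F. vdeg (a v))) *
      ((\<Sum>b\<in>?B. q_pow (\<Sum>c\<in>boundaries ?H. vdeg (b c))) *
       ((\<Sum>gs\<in>?G. q_pow (sum_list (map vdeg gs))) *
        (\<Sum>rs\<in>?R. q_pow (sum_list (map rdeg rs)) * q_pow (int (height F W)))))"
    unfolding deg q_pow_add sum_product sum.cartesian_product by (simp add: case_prod_beta)
  also have "(\<Sum>rs\<in>?R. q_pow (sum_list (map rdeg rs)) * q_pow (int (height F W))) = ?r ^ height F W"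
    unfolding sum_distrib_right[symmetric] q_pow_of_nat sum_q_pow_rgen[symmetric]
    by (subst sum_q_pow_lists) (auto simp: UNIV_rgen mult.commute)
  also have "(\<Sum>gs\<in>?G. q_pow (sum_list (map vdeg gs))) = ?r ^ (2 * genus ?H)"
    by (subst sum_q_pow_lists) (auto simp: UNIV_vgen)
  also have "(\<Sum>b\<in>?B. q_pow (\<Sum>c\<in>boundaries ?H. vdeg (b c))) = ?r ^ card (boundaries ?H)"
    by (rule sum_q_pow_PiE[OF finB])
  also have "(\<Sum>a\<in>?A. q_pow (\<Sum>v\<in>verts F. vdeg (a v))) = ?r ^ v_num F"
    unfolding v_num_def by (rule sum_q_pow_PiE[OF finite_verts])
  also have "?r ^ v_num F * (?r ^ card (boundaries ?H) * (?r ^ (2 * genus ?H) * ?r ^ height F W)) =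
      ?r ^ (v_num F + card (boundaries ?H) + 2 * genus ?H + height F W)"
    by (simp add: power_add mult.assoc)
  \<comment> \<open>Euler's formula, with \<open>card W\<close> and the height adding up to
    \<open>e_num F\<close>.\<close>
  also have "v_num F + card (boundaries ?H) + 2 * genus ?H + height F W = 2 * state_components F W + e_num F"
    using euler_formula[OF W] height_state[OF W] card_mono[OF finite_edges W]
    unfolding boundaries_spanning[OF W] e_num_def by simp
  finally show ?thesis .
qed

lemma chromatic_free_cochain_complex:
  assumes es: "edge_numbering F es"
  shows "free_cochain_complex (chain_gens F) (gen_diff F es)"
proof
  fix x i j assume "x \<in> chain_gens F i j"
  then obtain W where W: "W \<subseteq> edges F" "x \<in> state_gens F W" "- int (card W) = i" "gen_degree F x = j"
    unfolding chain_gens_alt by blast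
  show "frag_extend (gen_diff F es) (gen_diff F es x) = 0" by (rule gen_diff_gen_diff[OF W(1,2) es])
  show "Poly_Mapping.keys (gen_diff F es x) \<subseteq> chain_gens F (i + 1) j"
  proof
    fix y assume "y \<in> Poly_Mapping.keys (gen_diff F es x)"
    then obtain e where e: "e \<in> W" "y \<in> state_gens F (W - {e})" "gen_degree F y = gen_degree F x"
      using keys_gen_diff[OF W(1,2) es] by blast
    have "finite W" using W(1) finite_edges finite_subset by blast
    then have "card W = Suc (card (W - {e}))" using e(1) by (intro card.remove)
    then show "y \<in> chain_gens F (i + 1) j" using e W unfolding chain_gens_alt by (intro CollectI exI[of _ "W - {e}"]) auto
  qed
qed

lemma chain_gens_outside:
  assumes "i < - int (e_num F) \<or> i > 0" shows "chain_gens F i j = {}"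
proof -
  have "- int (card W) \<noteq> i" if "W \<subseteq> edges F" for W
    using card_mono[OF finite_edges that] assms unfolding e_num_def by linarith
  then show ?thesis unfolding chain_gens_alt by blast
qed

lemma finite_chain_gens: "finite (chain_gens F i j)"
  by (rule finite_subset[of _ "\<Union>W\<in>Pow (edges F). state_gens F W"])
    (auto simp: chain_gens_alt finite_edges finite_state_gens)

text \<open>After the shift a state \<open>W\<close> sits in degree \<open>- int (card W)\<close>,
  so its sign in the Euler characteristic is its sign in the chromatic polynomial.\<close>

lemma signed_card_chain_gens:
  "(\<Sum>i\<in>{- int (e_num F)..0}. (- 1) ^ nat \<bar>i\<bar> * int (card (chain_gens F i j))) =
    Poly_Mapping.lookup (\<Sum>W\<in>Pow (edges F). of_int ((- 1) ^ card W) * (\<Sum>x\<in>state_gens F W. q_pow (gen_degree F x))) j"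
proof -
  let ?P = "Pow (edges F)" and ?S = "\<lambda>W. {x \<in> state_gens F W. gen_degree F x = j}"
  have finP: "finite ?P" using finite_edges by simp
  have "chain_gens F i j = (\<Union>W\<in>{W \<in> ?P. - int (card W) = i}. ?S W)" for i
    unfolding chain_gens_alt by blast
  note gens = this
  have card: "card (chain_gens F i j) = (\<Sum>W\<in>{W \<in> ?P. - int (card W) = i}. card (?S W))" for i
  proof (subst card_UN_disjoint[symmetric])
    show "\<forall>W\<in>{W \<in> ?P. - int (card W) = i}. finite (?S W)" using finite_state_gens by simp
    show "\<forall>W\<in>{W \<in> ?P. - int (card W) = i}. \<forall>W'\<in>{W \<in> ?P. - int (card W) = i}. W \<noteq> W' \<longrightarrow> ?S W \<inter> ?S W' = {}"
      using state_gens_edges by blast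
  qed (use finP gens in simp_all)
  have "(\<Sum>i\<in>{- int (e_num F)..0}. (- 1) ^ nat \<bar>i\<bar> * int (card (chain_gens F i j))) =
      (\<Sum>i\<in>{- int (e_num F)..0}. \<Sum>W\<in>{W \<in> ?P. - int (card W) = i}. (- 1) ^ card W * int (card (?S W)))"
    unfolding card of_nat_sum sum_distrib_left by (intro sum.cong refl) auto
  also have "\<dots> = (\<Sum>W\<in>?P. (- 1) ^ card W * int (card (?S W)))"
    using card_mono[OF finite_edges] by (intro sum.group finP) (auto simp: e_num_def)
  also have "\<dots> = Poly_Mapping.lookup (\<Sum>W\<in>?P. of_int ((- 1) ^ card W) * (\<Sum>x\<in>state_gens F W. q_pow (gen_degree F x))) j"
    unfolding lookup_sum
  proof (intro sum.cong refl)
    fix W assume "W \<in> ?P"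
    then have fin: "finite (state_gens F W)" using finite_state_gens by blast
    have "Poly_Mapping.lookup (of_int ((- 1) ^ n) * p) j = (- 1) ^ n * Poly_Mapping.lookup p j"
      for n and p :: "int \<Rightarrow>\<^sub>0 int" by (induction n) simp_all
    moreover have "Poly_Mapping.lookup (\<Sum>x\<in>state_gens F W. q_pow (gen_degree F x)) j =
        (\<Sum>x\<in>state_gens F W. if gen_degree F x = j then 1 else 0)"
      unfolding lookup_sum by (intro sum.cong) (auto simp: lookup_single when_def)
    moreover have "\<dots> = int (card (?S W))" using fin by (simp add: sum.If_cases Int_def)
    ultimately show "(- 1) ^ card W * int (card (?S W)) =
      Poly_Mapping.lookup (of_int ((- 1) ^ card W) * (\<Sum>x\<in>state_gens F W. q_pow (gen_degree F x))) j" by simp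
  qed
  finally show ?thesis .
qed

theorem euler_characteristic_chromatic:
  assumes es: "edge_numbering F es"
  shows "euler_characteristic (chromatic_homology F es) =
    (q_var + q_inv) ^ e_num F *
    poly (map_poly of_int (chromatic_polynomial (underlying_graph F))) ((q_var + q_inv) ^ 2)"
proof (rule poly_mapping_eqI)
  fix j
  interpret free_cochain_complex "chain_gens F" "gen_diff F es"
    by (rule chromatic_free_cochain_complex[OF es])
  let ?N = "{- int (e_num F)..0}" and ?J = "gen_degree F ` (\<Union>W\<in>Pow (edges F). state_gens F W)"
  have J: "finite ?J" using finite_edges finite_state_gens by auto
  have empty: "chain_gens F i k = {}" if "k \<notin> ?J" for i k
    using that unfolding chain_gens_alt by blast
  have J': "abelian_rank (chromatic_homology F es i k) = 0" if "k \<notin> ?J" for i k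
    unfolding chromatic_complex_free by (intro rank_homology_empty empty that)
  have N: "abelian_rank (chromatic_homology F es i k) = 0" if "i \<notin> ?N" for i k
    unfolding chromatic_complex_free using that by (intro rank_homology_empty chain_gens_outside) auto
  have "Poly_Mapping.lookup (euler_characteristic (chromatic_homology F es)) j =
      (\<Sum>i\<in>?N. (- 1) ^ nat \<bar>i\<bar> * int (abelian_rank (chromatic_homology F es i j)))"
    by (rule lookup_euler_characteristic[OF J J' finite_atLeastAtMost_int N])
  also have "\<dots> = (\<Sum>i\<in>?N. (- 1) ^ nat \<bar>i\<bar> * int (card (chain_gens F i j)))"
    unfolding chromatic_complex_free
  proof (rule alternating_rank_sum)
    show "chain_gens F i j = {}" if "i < - int (e_num F) \<or> 0 < i" for i
      using that by (rule chain_gens_outside)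
  qed (rule finite_chain_gens)
  also have "\<dots> = Poly_Mapping.lookup (\<Sum>W\<in>Pow (edges F). of_int ((- 1) ^ card W) *
      (q_var + q_inv) ^ (2 * state_components F W + e_num F)) j"
    unfolding signed_card_chain_gens
    by (intro arg_cong2[where f = Poly_Mapping.lookup] sum.cong refl) (simp only: qdim_state_gens Pow_iff)
  also have "(\<Sum>W\<in>Pow (edges F). of_int ((- 1) ^ card W) * (q_var + q_inv) ^ (2 * state_components F W + e_num F)) =
      (q_var + q_inv) ^ e_num F *
      poly (map_poly of_int (chromatic_polynomial (underlying_graph F))) ((q_var + q_inv) ^ 2)"
    unfolding chromatic_polynomial_def underlying_graph_def multigraph.simps poly_of_int_sum sum_distrib_left
    by (intro sum.cong refl) (simp add: map_poly_monom poly_monom power_add power_mult mult.left_commute mult.commute)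
  finally show "Poly_Mapping.lookup (euler_characteristic (chromatic_homology F es)) j =
    Poly_Mapping.lookup ((q_var + q_inv) ^ e_num F *
      poly (map_poly of_int (chromatic_polynomial (underlying_graph F))) ((q_var + q_inv) ^ 2)) j" .
qed

end



section \<open>The homology determines the chromatic polynomial\<close>

lemma lookup_q_pow_mult:
  "Poly_Mapping.lookup (q_pow a * p) j = Poly_Mapping.lookup p (j - a)" for p :: "int \<Rightarrow>\<^sub>0 int"
  using subset_UNIV
proof (induction p rule: frag_induction)
  case (one x) then show ?case by (auto simp: mult_single lookup_single when_def)
qed (simp_all add: right_diff_distrib lookup_minus)

lemma lookup_of_int_mult:
  "Poly_Mapping.lookup (of_int c * p) j = c * Poly_Mapping.lookup p j" for p :: "int \<Rightarrow>\<^sub>0 int"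
  by (induction c rule: int_induct[of _ 0]) (simp_all add: lookup_add lookup_minus algebra_simps)

lemma lookup_power_top:
  "Poly_Mapping.lookup ((q_var + q_inv) ^ m) (int m) = 1"
  "int m < j \<Longrightarrow> Poly_Mapping.lookup ((q_var + q_inv) ^ m) j = 0"
proof (induction m arbitrary: j)
  case 0
  { case 1 then show ?case by (simp add: lookup_one)
  next case 2 then show ?case by (simp add: lookup_one when_def) }
next
  case (Suc m)
  have r: "Poly_Mapping.lookup ((q_var + q_inv) ^ Suc m) j =
      Poly_Mapping.lookup ((q_var + q_inv) ^ m) (j - 1) + Poly_Mapping.lookup ((q_var + q_inv) ^ m) (j + 1)" for j
    by (simp add: distrib_right lookup_add lookup_q_pow_mult)
  { case 1 show ?case unfolding r using Suc(1,2) by simp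
  next case 2 then show ?case unfolding r using Suc(2) by simp }
qed

text \<open>The right-hand side of the formula for the Euler characteristic, with the number of
  edges and the polynomial as separate variables.\<close>

definition laurent_of :: "nat \<Rightarrow> int poly \<Rightarrow> int \<Rightarrow>\<^sub>0 int" where
  "laurent_of a p = (q_var + q_inv) ^ a * poly (map_poly of_int p) ((q_var + q_inv) ^ 2)"

lemma laurent_of_altdef:
  "laurent_of a p = (\<Sum>i\<le>degree p. of_int (coeff p i) * (q_var + q_inv) ^ (a + 2 * i))"
proof -
  have "p = (\<Sum>i\<le>degree p. monom (coeff p i) i)" by (rule poly_as_sum_of_monoms[symmetric])
  then have "poly (map_poly of_int p) x = (\<Sum>i\<le>degree p. of_int (coeff p i) * x ^ i)" for x :: "int \<Rightarrow>\<^sub>0 int"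
    by (metis (mono_tags, lifting) map_poly_monom of_int_0 poly_monom poly_of_int_sum sum.cong)
  then show ?thesis
    unfolding laurent_of_def sum_distrib_left
    by (simp add: sum_distrib_left power_add power_mult mult.left_commute)
qed

lemma laurent_of_top:
  "Poly_Mapping.lookup (laurent_of a p) (int (a + 2 * degree p)) = lead_coeff p"
  "int (a + 2 * degree p) < j \<Longrightarrow> Poly_Mapping.lookup (laurent_of a p) j = 0"
proof -
  have l: "Poly_Mapping.lookup (laurent_of a p) j =
      (\<Sum>i\<le>degree p. coeff p i * Poly_Mapping.lookup ((q_var + q_inv) ^ (a + 2 * i)) j)" for j
    by (simp add: laurent_of_altdef lookup_sum lookup_of_int_mult)
  have "(\<Sum>i\<le>degree p. coeff p i * Poly_Mapping.lookup ((q_var + q_inv) ^ (a + 2 * i)) (int (a + 2 * degree p))) =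
      (\<Sum>i\<in>{degree p}. coeff p i * Poly_Mapping.lookup ((q_var + q_inv) ^ (a + 2 * i)) (int (a + 2 * degree p)))"
    by (intro sum.mono_neutral_right) (auto intro!: lookup_power_top(2))
  then show "Poly_Mapping.lookup (laurent_of a p) (int (a + 2 * degree p)) = lead_coeff p"
    unfolding l using lookup_power_top(1)[of "a + 2 * degree p"] by simp
  show "Poly_Mapping.lookup (laurent_of a p) j = 0" if "int (a + 2 * degree p) < j"
    unfolding l using that by (intro sum.neutral) (auto intro!: lookup_power_top(2))
qed

lemma laurent_of_eq_0_iff: "laurent_of a p = 0 \<longleftrightarrow> p = 0"
proof
  assume "laurent_of a p = 0"
  then show "p = 0" using laurent_of_top(1)[of a p] by simp
qed (simp add: laurent_of_def)

text \<open>Both sides of the equation are the highest exponent of q. For graphs, this fixes the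
  parity of the number of edges.\<close>

lemma laurent_of_degree:
  assumes "laurent_of a p = laurent_of b r" "p \<noteq> 0" "r \<noteq> 0"
  shows "a + 2 * degree p = b + 2 * degree r"
proof -
  have "\<not> int (b + 2 * degree r) < int (a + 2 * degree p)"
    using laurent_of_top(1)[of a p] laurent_of_top(2)[of b r] assms by force
  moreover have "\<not> int (a + 2 * degree p) < int (b + 2 * degree r)"
    using laurent_of_top(1)[of b r] laurent_of_top(2)[of a p] assms by force
  ultimately show ?thesis by simp
qed

text \<open>For a fixed number of edges the expression is additive in the polynomial, and its
  leading coefficient shows that only 0 is sent to 0.\<close>

lemma laurent_of_inject: "laurent_of a p = laurent_of a r \<Longrightarrow> p = r"
proof -
  assume "laurent_of a p = laurent_of a r"
  moreover have "poly (map_poly of_int (p - r)) x = poly (map_poly of_int p) x - poly (map_poly of_int r) x"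
    for x :: "int \<Rightarrow>\<^sub>0 int"
    using poly_of_int_add[of "p - r" r x] by simp
  ultimately have "laurent_of a (p - r) = 0" by (simp add: laurent_of_def right_diff_distrib)
  then show "p = r" by (simp add: laurent_of_eq_0_iff)
qed

section \<open>The lowest nonzero homology\<close>

definition nontrivial_group :: "('a, 'm) monoid_scheme \<Rightarrow> bool" where
  "nontrivial_group G \<longleftrightarrow> (\<exists>x\<in>carrier G. \<exists>y\<in>carrier G. x \<noteq> y)"

lemma nontrivial_group_iso: "G \<cong> H \<Longrightarrow> nontrivial_group G \<Longrightarrow> nontrivial_group H"
proof -
  assume "G \<cong> H" "nontrivial_group G"
  then obtain h x y where "bij_betw h (carrier G) (carrier H)" "x \<in> carrier G" "y \<in> carrier G" "x \<noteq> y"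
    by (auto simp: is_iso_def iso_def nontrivial_group_def)
  then show ?thesis unfolding nontrivial_group_def by (metis bij_betwE bij_betw_imp_inj_on inj_onD)
qed

context free_cochain_complex
begin

lemma nontrivial_homologyI:
  assumes "z \<in> cycles i j" "z \<notin> bounds i j"
  shows "nontrivial_group (homology (free_complex B d) i j)"
proof -
  let ?G = "subgroup_generated (free_Abelian_group (B i j)) (cycles i j)"
  have G: "frag_group ?G" by (rule frag_group_generated[OF frag_group_free])
  have z: "0 \<in> carrier ?G" "z \<in> carrier ?G"
    using assms(1) frag_group_subgroup_closed(1)[OF frag_group_free subgroup_cycles] unfolding carrier_cycles by auto
  have "bounds i j #>\<^bsub>?G\<^esub> z \<noteq> bounds i j #>\<^bsub>?G\<^esub> 0"
    using coset_eq_iff[OF G subgroup_bounds z(2,1)] assms(2) by auto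
  then show ?thesis
    unfolding nontrivial_group_def homology_free carrier_FactGroup using z by blast
qed

lemma trivial_homology:
  assumes "B i j = {}"
  shows "\<not> nontrivial_group (homology (free_complex B d) i j)"
  using assms unfolding nontrivial_group_def homology_free carrier_FactGroup carrier_cycles
  by (auto simp: kernel_def)

end

fun set_rpart :: "rgen list \<Rightarrow> ('v, 'h) tensor_gen \<Rightarrow> ('v, 'h) tensor_gen" where
  "set_rpart rs (Tensor W a b gs _) = Tensor W a b gs rs"

context fatgraph
begin

lemma set_rpart_state_gens:
  assumes "x \<in> state_gens F W" "length rs = height F W"
  shows "set_rpart rs x \<in> state_gens F W"
    and "gen_degree F (set_rpart rs x) = gen_degree F x - sum_list (map rdeg (rpart x)) + sum_list (map rdeg rs)"
  using assms by (auto simp: state_gens_def gen_degree_def Let_def)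

text \<open>The relation \<open>d (u \<otimes> x\<^sub>-\<^sub>2) = \<psi> (d (u \<otimes> x\<^sub>0))\<close> in heights 1 and 2.\<close>

lemma gen_diff_set_rpart:
  assumes "rpart x = [X0]"
  shows "gen_diff F es (set_rpart [XMinus2] x) =
    frag_extend (\<lambda>y. frag_of (set_rpart [XMinus2, X0] y) + frag_of (set_rpart [X0, XMinus2] y)) (gen_diff F es x)"
proof -
  let ?psi = "\<lambda>y. frag_of (set_rpart [XMinus2, X0] y) + frag_of (set_rpart [X0, XMinus2] y)"
  obtain W a b gs where x: "x = Tensor W a b gs [X0]" using assms by (cases x) auto
  have "edge_map F e (set_rpart [XMinus2] x) = frag_extend ?psi (edge_map F e x)" for e
    by (simp add: x edge_map_Tensor tensor_frag_def frag_extend_extend r_comult_def frag_extend_add)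
  then show ?thesis
    by (simp add: gen_diff_def x frag_extend_sum frag_extend_cmul)
qed

text \<open>In height 0 the map on the R factors sends 1 to \<open>X0\<close>.\<close>

lemma gen_diff_top_rpart:
  assumes "rpart x = []" "y \<in> Poly_Mapping.keys (gen_diff F es x)"
  shows "rpart y = [X0]"
proof -
  obtain j where "y \<in> Poly_Mapping.keys (edge_map F (es ! j) x)"
    using subsetD[OF keys_sum assms(2)[unfolded gen_diff_def]] by auto
  then show ?thesis using assms(1)
    by (cases x) (auto simp: edge_map_Tensor r_comult_def elim!: keys_tensor_frag)
qed

lemma nontrivial_lowest_homology:
  assumes es: "edge_numbering F es"
  shows "\<exists>i j. i \<le> 1 - int (e_num F) \<and> nontrivial_group (chromatic_homology F es i j)"
proof -
  interpret free_cochain_complex "chain_gens F" "gen_diff F es"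
    by (rule chromatic_free_cochain_complex[OF es])
  let ?E = "edges F" and ?H = "spanning_subgraph F (edges F)"
  \<comment> \<open>The unit of the full state, which has height 0 and hence no R factors.\<close>
  define x where "x = Tensor ?E (restrict (\<lambda>_. VPlus) (verts F)) (restrict (\<lambda>_. VPlus) (boundaries ?H))
    (replicate (2 * genus ?H) VPlus) []"
  define j where "j = gen_degree F x"
  have h0: "height F ?E = 0" by (simp add: height_state e_num_def)
  have xE: "x \<in> state_gens F ?E"
    by (auto simp: x_def state_gens_def Let_def spanning_subgraph_def h0)
  have x: "x \<in> chain_gens F (- int (e_num F)) j"
    unfolding chain_gens_alt using xE by (intro CollectI exI[of _ ?E]) (auto simp: j_def e_num_def)
  have rx: "rpart x = []" by (simp add: x_def)
  have b0: "bounds (- int (e_num F)) j = {0}"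
  proof -
    have "chain_gens F (- int (e_num F) - 1) j = {}" by (rule chain_gens_outside) simp
    then have "carrier (free_Abelian_group (chain_gens F (- int (e_num F) - 1) j)) = {0}" by auto
    then show ?thesis by simp
  qed
  show ?thesis
  proof (cases "gen_diff F es x = 0")
    case True
    \<comment> \<open>With no chains in lower degrees, a nonzero cocycle already represents a
      nonzero class.\<close>
    then have "frag_of x \<in> cycles (- int (e_num F)) j" using x by (simp add: kernel_def)
    moreover have "frag_of x \<notin> bounds (- int (e_num F)) j" unfolding b0 by simp
    ultimately have "nontrivial_group (chromatic_homology F es (- int (e_num F)) j)"
      unfolding chromatic_complex_free by (rule nontrivial_homologyI)
    then show ?thesis by (rule exI[of _ "- int (e_num F)", OF exI[of _ j, OF conjI[rotated]]]) simp
  next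
    case False
    define y where "y = gen_diff F es x"
    \<comment> \<open>\<open>z\<close> is \<open>y\<close> with \<open>X0\<close> replaced by
      \<open>XMinus2\<close>, which lowers the degree by 2.\<close>
    define z where "z = frag_extend (\<lambda>w. frag_of (set_rpart [XMinus2] w)) y"
    let ?i = "1 - int (e_num F)"
    have yr: "rpart w = [X0]" if "w \<in> Poly_Mapping.keys y" for w
      using gen_diff_top_rpart[OF rx] that unfolding y_def .
    have zr: "\<exists>w\<in>Poly_Mapping.keys y. v = set_rpart [XMinus2] w" if "v \<in> Poly_Mapping.keys z" for v
      using subsetD[OF keys_frag_extend that[unfolded z_def]] by auto
    have zC: "Poly_Mapping.keys z \<subseteq> chain_gens F ?i (j - 2)"
    proof
      fix v assume "v \<in> Poly_Mapping.keys z"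
      then obtain w where w: "w \<in> Poly_Mapping.keys y" "v = set_rpart [XMinus2] w" using zr by blast
      then obtain e where e: "e \<in> ?E" "w \<in> state_gens F (?E - {e})" "gen_degree F w = j"
        using keys_gen_diff[OF subset_refl xE es] unfolding y_def j_def by blast
      have h1: "height F (?E - {e}) = 1" using height_delete[OF subset_refl e(1)] h0 by simp
      have "card ?E = Suc (card (?E - {e}))" using finite_edges e(1) by (intro card.remove)
      then show "v \<in> chain_gens F ?i (j - 2)"
        using set_rpart_state_gens[OF e(2), of "[XMinus2]"] h1 e(3) yr[OF w(1)] unfolding chain_gens_alt w(2)
        by (intro CollectI exI[of _ "?E - {e}"]) (auto simp: e_num_def)
    qed
    have "frag_extend (gen_diff F es) z = frag_extend (\<lambda>w. gen_diff F es (set_rpart [XMinus2] w)) y"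
      by (simp add: z_def frag_extend_extend)
    \<comment> \<open>The linear map of \<open>gen_diff_set_rpart\<close> is now applied to the
      differential of \<open>y\<close>, that is, to the square of the differential at
      \<open>x\<close>.\<close>
    also have "\<dots> = frag_extend (\<lambda>w. frag_extend (\<lambda>v. frag_of (set_rpart [XMinus2, X0] v) +
        frag_of (set_rpart [X0, XMinus2] v)) (gen_diff F es w)) y"
      by (intro frag_extend_eq gen_diff_set_rpart yr)
    also have "\<dots> = 0"
      unfolding frag_extend_extend[symmetric] y_def gen_diff_gen_diff[OF subset_refl xE es] by simp
    finally have zc: "z \<in> cycles ?i (j - 2)" using zC by (simp add: kernel_def)
    have z0: "z \<noteq> 0"
    proof
      assume "z = 0"
      have "set_rpart [X0] (set_rpart [XMinus2] w) = w" if "w \<in> Poly_Mapping.keys y" for w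
        using yr[OF that] by (cases w) simp
      then have "frag_extend (\<lambda>v. frag_of (set_rpart [X0] v)) z = frag_extend frag_of y"
        unfolding z_def frag_extend_extend by (intro frag_extend_eq) simp
      then show False using False \<open>z = 0\<close> by (simp add: frag_extend_frag_of y_def)
    qed
    \<comment> \<open>Coboundaries in this degree come from height 0 and carry only
      \<open>X0\<close>, whereas every term of \<open>z\<close> carries
      \<open>XMinus2\<close>.\<close>
    have "z \<notin> bounds ?i (j - 2)"
    proof
      assume "z \<in> bounds ?i (j - 2)"
      then obtain u where u: "Poly_Mapping.keys u \<subseteq> chain_gens F (?i - 1) (j - 2)" "z = frag_extend (gen_diff F es) u"
        by auto
      obtain v where v: "v \<in> Poly_Mapping.keys z" using z0 by (metis ex_in_conv keys_eq_empty)
      then obtain t where t: "t \<in> Poly_Mapping.keys u" "v \<in> Poly_Mapping.keys (gen_diff F es t)"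
        using subsetD[OF keys_frag_extend v[unfolded u(2)]] by blast
      then obtain W where W: "W \<subseteq> ?E" "- int (card W) = ?i - 1" "t \<in> state_gens F W"
        using u(1) unfolding chain_gens_alt by blast
      then have "card W = card ?E" by (simp add: e_num_def)
      then have "W = ?E" using W(1) finite_edges card_subset_eq by blast
      then have "rpart t = []" using W(3) h0 by (auto simp: state_gens_def Let_def)
      then have "rpart v = [X0]" using gen_diff_top_rpart t(2) by blast
      moreover obtain w where "v = set_rpart [XMinus2] w" using zr[OF v] by blast
      ultimately show False by (cases w) simp
    qed
    then have "nontrivial_group (chromatic_homology F es ?i (j - 2))"
      unfolding chromatic_complex_free using zc by (intro nontrivial_homologyI)
    then show ?thesis by (rule exI[of _ ?i, OF exI[of _ "j - 2", OF conjI[rotated]]]) simp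
  qed
qed

lemma homology_low_trivial:
  assumes es: "edge_numbering F es" and "i < - int (e_num F)"
  shows "\<not> nontrivial_group (chromatic_homology F es i j)"
proof -
  interpret free_cochain_complex "chain_gens F" "gen_diff F es"
    by (rule chromatic_free_cochain_complex[OF es])
  show ?thesis unfolding chromatic_complex_free
    using assms(2) by (intro trivial_homology chain_gens_outside) simp
qed

lemma comm_group_chromatic_homology:
  assumes es: "edge_numbering F es"
  shows "comm_group (chromatic_homology F es i j)"
proof -
  interpret free_cochain_complex "chain_gens F" "gen_diff F es"
    by (rule chromatic_free_cochain_complex[OF es])
  show ?thesis unfolding chromatic_complex_free by (rule group_homology)
qed

end

text \<open>The homology of \<open>F\<close> is nonzero in some degree at most
  \<open>1 - e(F)\<close>, and that of \<open>F'\<close> vanishes in all degrees below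
  \<open>- e(F')\<close>.\<close>

lemma bigraded_iso_e_num_le:
  assumes "fatgraph F" "edge_numbering F es" "fatgraph F'" "edge_numbering F' es'"
    and "bigraded_iso (chromatic_homology F es) (chromatic_homology F' es')"
  shows "e_num F \<le> Suc (e_num F')"
proof -
  obtain i j where i: "i \<le> 1 - int (e_num F)" "nontrivial_group (chromatic_homology F es i j)"
    using fatgraph.nontrivial_lowest_homology[OF assms(1,2)] by blast
  then have "nontrivial_group (chromatic_homology F' es' i j)"
    using assms(5) nontrivial_group_iso unfolding bigraded_iso_def by blast
  then have "\<not> i < - int (e_num F')" using fatgraph.homology_low_trivial[OF assms(3,4)] by blast
  then show ?thesis using i(1) by linarith
qed

lemma bigraded_iso_sym:
  assumes "bigraded_iso H H'" "\<And>i j. comm_group (H i j)"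
  shows "bigraded_iso H' H"
  using assms unfolding bigraded_iso_def by (blast intro: group.iso_sym comm_group.axioms(2))

lemma bigraded_iso_laurent:
  assumes "fatgraph F" "edge_numbering F es" "fatgraph F'" "edge_numbering F' es'"
    and "bigraded_iso (chromatic_homology F es) (chromatic_homology F' es')"
  shows "laurent_of (e_num F) (chromatic_polynomial (underlying_graph F)) =
    laurent_of (e_num F') (chromatic_polynomial (underlying_graph F'))"
  using bigraded_iso_euler[OF assms(5) fatgraph.comm_group_chromatic_homology[OF assms(1,2)]
      fatgraph.comm_group_chromatic_homology[OF assms(3,4)]]
  unfolding laurent_of_def fatgraph.euler_characteristic_chromatic[OF assms(1,2)]
    fatgraph.euler_characteristic_chromatic[OF assms(3,4)] .

text \<open>The Euler characteristic alone is not enough: it fixes only the parity of the number of edges, and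
  agrees for an edge plus an isolated vertex and for a triple edge.\<close>

theorem bigraded_iso_chromatic_polynomial:
  assumes "fatgraph F" "edge_numbering F es" "fatgraph F'" "edge_numbering F' es'"
    and iso: "bigraded_iso (chromatic_homology F es) (chromatic_homology F' es')"
  shows "chromatic_polynomial (underlying_graph F) = chromatic_polynomial (underlying_graph F')"
proof -
  let ?M = "chromatic_polynomial (underlying_graph F)" and ?M' = "chromatic_polynomial (underlying_graph F')"
  note l = bigraded_iso_laurent[OF assms]
  have "bigraded_iso (chromatic_homology F' es') (chromatic_homology F es)"
    by (rule bigraded_iso_sym[OF iso fatgraph.comm_group_chromatic_homology[OF assms(1,2)]])
  from bigraded_iso_e_num_le[OF assms(3,4,1,2) this] bigraded_iso_e_num_le[OF assms]
  have e: "e_num F \<le> Suc (e_num F')" "e_num F' \<le> Suc (e_num F)" by auto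
  show ?thesis
  proof (cases "?M = 0 \<or> ?M' = 0")
    case True
    then show ?thesis using l laurent_of_eq_0_iff by metis
  next
    case False
    then have "e_num F + 2 * degree ?M = e_num F' + 2 * degree ?M'"
      using laurent_of_degree[OF l] by blast
    \<comment> \<open>Equal highest exponents force equal parity, and the two numbers differ by at
      most one.\<close>
    then have "e_num F = e_num F'" using e by presburger
    then show ?thesis using l laurent_of_inject by metis
  qed
qed


section \<open>Two graphs with equal chromatic polynomials\<close>

definition single_edge :: "(nat, nat) fatgraph" where
  "single_edge = \<lparr>verts = {0, 1}, halves = {0, 1}, vert = id, nxt = id, opp = (\<lambda>h. 1 - h)\<rparr>"

text \<open>The vertex of a half-edge is its parity, so the half-edges at one vertex differ by 2;
  the two edges are \<open>{0, 1}\<close> and \<open>{2, 3}\<close>.\<close>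

definition double_edge :: "(nat, nat) fatgraph" where
  "double_edge = \<lparr>verts = {0, 1}, halves = {0, 1, 2, 3}, vert = (\<lambda>h. h mod 2),
     nxt = (\<lambda>h. (h + 2) mod 4), opp = (\<lambda>h. if even h then h + 1 else h - 1)\<rparr>"

lemma fatgraph_single_edge: "fatgraph single_edge"
proof
  fix h assume h: "h \<in> halves single_edge"
  have "orbit id h = {h}" by (simp add: orbit_eq_singleton_iff)
  then show "orbit (nxt single_edge) h = {h' \<in> halves single_edge. vert single_edge h' = vert single_edge h}"
    using h by (auto simp: single_edge_def)
qed (auto simp: single_edge_def)

lemma fatgraph_double_edge: "fatgraph double_edge"
proof
  fix h assume h: "h \<in> halves double_edge"
  let ?n = "\<lambda>h::nat. (h + 2) mod 4"
  have "(?n ^^ 2) h = h" using h by (auto simp: double_edge_def numeral_2_eq_2)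
  then have "orbit ?n h = {(?n ^^ m) h | m. m < 2}" by (rule orbit_altdef_bounded) simp
  also have "\<dots> = {h, ?n h}" by (auto simp: less_2_cases_iff intro: exI[of _ 0] exI[of _ "Suc 0"])
  finally have o: "orbit (nxt double_edge) h = {h, ?n h}" by (simp add: double_edge_def)
  have "h = 0 \<or> h = 1 \<or> h = 2 \<or> h = 3" using h by (simp add: double_edge_def)
  then show "orbit (nxt double_edge) h = {h' \<in> halves double_edge. vert double_edge h' = vert double_edge h}"
    unfolding o by (elim disjE) (auto simp: double_edge_def)
qed (auto simp: double_edge_def)

lemma edges_single_edge: "edges single_edge = {{0, 1}}"
  by (auto simp: edges_def single_edge_def)

lemma edges_double_edge: "edges double_edge = {{0, 1}, {2, 3}}"
proof -
  have "edges double_edge = (\<lambda>h. {h, opp double_edge h}) ` halves double_edge"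
    unfolding edges_def by (rule Setcompr_eq_image)
  also have "\<dots> = {{0, 1}, {1, 0}, {2, 3}, {3, 2}}" by (simp add: double_edge_def)
  finally show ?thesis by (simp only: insert_commute[of 1 0] insert_commute[of 3 2] insert_absorb2)
qed

lemma num_components_two:
  assumes "W \<noteq> {}" "\<And>e. e \<in> W \<Longrightarrow> ends e = {0, 1 :: nat}"
  shows "num_components {0, 1} W ends = 1"
proof -
  let ?r = "{(u, v). u \<in> {0, 1} \<and> v \<in> {0, 1} \<and> (\<exists>e\<in>W. ends e = {u, v})}"
  obtain e where "e \<in> W" "ends e = {0, 1}" using assms by blast
  then have "(0, 1) \<in> ?r" "(1, 0) \<in> ?r" by (auto simp: insert_commute)
  then have "?r\<^sup>* \<inter> {0, 1} \<times> {0, 1} = {0, 1} \<times> {0, 1}" by auto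
  moreover have "{0, 1 :: nat} // ({0, 1} \<times> {0, 1}) = {{0, 1}}" by (auto simp: quotient_def)
  ultimately show ?thesis by (simp add: num_components_def)
qed

lemma chromatic_polynomial_single_edge:
  "chromatic_polynomial (underlying_graph single_edge) = monom 1 2 - monom 1 1"
proof -
  have k: "num_components {0, 1} {{0, 1}} (\<lambda>e. vert single_edge ` e) = 1"
    by (rule num_components_two) (auto simp: single_edge_def)
  have k0: "num_components {0, 1 :: nat} {} (\<lambda>e. vert single_edge ` e) = 2"
    by (simp add: num_components_empty)
  have v: "verts single_edge = {0, 1}" by (simp add: single_edge_def)
  have "chromatic_polynomial (underlying_graph single_edge) = monom 1 2 + monom (- 1) 1"
    unfolding chromatic_polynomial_def underlying_graph_def multigraph.simps edges_single_edge v
    using k k0 by (simp add: Pow_insert)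
  then show ?thesis by (simp add: minus_monom)
qed

lemma chromatic_polynomial_double_edge:
  "chromatic_polynomial (underlying_graph double_edge) = monom 1 2 - monom 1 1"
proof -
  have e: "vert double_edge ` e = {0, 1}" if "e \<in> {{0, 1}, {2, 3}}" for e
    using that by (auto simp: double_edge_def)
  have k: "num_components {0, 1} W (\<lambda>e. vert double_edge ` e) = 1" if "W \<noteq> {}" "W \<subseteq> {{0, 1}, {2, 3}}" for W
  proof (rule num_components_two[OF that(1)])
    show "vert double_edge ` f = {0, 1}" if "f \<in> W" for f
      using that \<open>W \<subseteq> _\<close> by (intro e) blast
  qed
  have k0: "num_components {0, 1 :: nat} {} (\<lambda>e. vert double_edge ` e) = 2"
    by (simp add: num_components_empty)
  have v: "verts double_edge = {0, 1}" by (simp add: double_edge_def)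
  have ne: "{0, 1} \<noteq> {2, 3 :: nat}" by (simp add: doubleton_eq_iff)
  have P: "Pow {{0, 1}, {2, 3 :: nat}} = {{}, {{0, 1}}, {{2, 3}}, {{0, 1}, {2, 3}}}"
    by (simp add: Pow_insert insert_commute)
  have "chromatic_polynomial (underlying_graph double_edge) =
      monom 1 2 + (monom (- 1) 1 + (monom (- 1) 1 + monom 1 1))"
    unfolding chromatic_polynomial_def underlying_graph_def multigraph.simps edges_double_edge v P
    using ne k0 k[of "{{0, 1}}"] k[of "{{2, 3}}"] k[of "{{0, 1}, {2, 3}}"]
    by (simp add: doubleton_eq_iff)
  then show ?thesis by (simp add: minus_monom add_monom)
qed

theorem homology_distinguishes:
  "\<exists>(F1 :: (nat, nat) fatgraph) es1 (F2 :: (nat, nat) fatgraph) es2.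
     fatgraph F1 \<and> edge_numbering F1 es1 \<and> fatgraph F2 \<and> edge_numbering F2 es2 \<and>
     chromatic_polynomial (underlying_graph F1) = chromatic_polynomial (underlying_graph F2) \<and>
     \<not> bigraded_iso (chromatic_homology F1 es1) (chromatic_homology F2 es2)"
proof -
  let ?M = "monom 1 2 - monom 1 1 :: int poly"
  have n1: "edge_numbering single_edge [{0, 1}]" by (simp add: edge_numbering_def edges_single_edge)
  have ne: "{0, 1} \<noteq> {2, 3 :: nat}" by (simp add: doubleton_eq_iff)
  then have n2: "edge_numbering double_edge [{0, 1}, {2, 3}]" by (simp add: edge_numbering_def edges_double_edge)
  have e: "e_num single_edge = 1" "e_num double_edge = 2"
    using ne by (simp_all add: e_num_def edges_single_edge edges_double_edge)
  have "coeff ?M 2 = 1" by simp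
  then have M: "?M \<noteq> 0" by (metis coeff_0 zero_neq_one)
  have "\<not> bigraded_iso (chromatic_homology single_edge [{0, 1}]) (chromatic_homology double_edge [{0, 1}, {2, 3}])"
  proof
    assume "bigraded_iso (chromatic_homology single_edge [{0, 1}]) (chromatic_homology double_edge [{0, 1}, {2, 3}])"
    from bigraded_iso_laurent[OF fatgraph_single_edge n1 fatgraph_double_edge n2 this]
    \<comment> \<open>The polynomials agree, so the highest exponents differ by 1, as the numbers of
      edges do.\<close>
    have "laurent_of 1 ?M = laurent_of 2 ?M"
      by (simp only: e chromatic_polynomial_single_edge chromatic_polynomial_double_edge)
    from laurent_of_degree[OF this M M] show False by simp
  qed
  then show ?thesis
    using fatgraph_single_edge n1 fatgraph_double_edge n2 chromatic_polynomial_single_edge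
      chromatic_polynomial_double_edge by metis
qed



section \<open>Isomorphic complexes\<close>

lemma rtrancl_map_rel:
  assumes "\<And>x y. (x, y) \<in> r \<Longrightarrow> (f x, f y) \<in> s" "(x, y) \<in> r\<^sup>*"
  shows "(f x, f y) \<in> s\<^sup>*"
  using assms(2) by induction (auto intro: rtrancl_into_rtrancl assms(1))

text \<open>A bijection of generators with signs gives an invertible chain map. It matches cycles
  with cycles and coboundaries with coboundaries, so the first isomorphism theorem applies to its
  restriction to cycles followed by the quotient map.\<close>

lemma homology_iso:
  assumes C: "free_cochain_complex B d" and C': "free_cochain_complex B' d'"
    and bij: "\<And>i j. bij_betw \<rho> (B i j) (B' i j)" and eps: "\<And>x. \<epsilon> x = 1 \<or> \<epsilon> x = - 1"
    and comm: "\<And>x i j. x \<in> B i j \<Longrightarrow> frag_extend (\<lambda>x. frag_cmul (\<epsilon> x) (frag_of (\<rho> x))) (d x) = frag_cmul (\<epsilon> x) (d' (\<rho> x))"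
  shows "bigraded_iso (homology (free_complex B d)) (homology (free_complex B' d'))"
  unfolding bigraded_iso_def
proof (intro allI)
  fix i j
  interpret C: free_cochain_complex B d by (rule C)
  interpret C': free_cochain_complex B' d' by (rule C')
  define \<Phi> where "\<Phi> = frag_extend (\<lambda>x. frag_cmul (\<epsilon> x) (frag_of (\<rho> x)))"
  \<comment> \<open>The inverse depends on the degree because \<open>\<rho>\<close> is known to be
    injective only on each \<open>B i j\<close>.\<close>
  define \<Psi> where "\<Psi> i = frag_extend (\<lambda>y. frag_cmul (\<epsilon> (inv_into (B i j) \<rho> y)) (frag_of (inv_into (B i j) \<rho> y)))" for i
  have ee: "\<epsilon> x * \<epsilon> x = 1" for x using eps[of x] by auto
  have PhiC: "Poly_Mapping.keys (\<Phi> x) \<subseteq> B' i j" if "Poly_Mapping.keys x \<subseteq> B i j" for x i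
    unfolding \<Phi>_def using that bij_betwE[OF bij[of i j]] by (intro keys_frag_extend_subset) auto
  have PsiC: "Poly_Mapping.keys (\<Psi> i y) \<subseteq> B i j" if "Poly_Mapping.keys y \<subseteq> B' i j" for y i
    unfolding \<Psi>_def using that bij_betwE[OF bij_betw_inv_into[OF bij[of i j]]]
    by (intro keys_frag_extend_subset) auto
  have PhiPsi: "\<Phi> (\<Psi> i y) = y" if y: "Poly_Mapping.keys y \<subseteq> B' i j" for y i
  proof -
    have "\<Phi> (\<Psi> i y) = frag_extend frag_of y"
      unfolding \<Phi>_def \<Psi>_def frag_extend_extend
    proof (rule frag_extend_eq)
      fix v assume "v \<in> Poly_Mapping.keys y"
      then have "\<rho> (inv_into (B i j) \<rho> v) = v" using y bij_betw_inv_into_right[OF bij] by blast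
      then show "frag_extend (\<lambda>x. frag_cmul (\<epsilon> x) (frag_of (\<rho> x)))
          (frag_cmul (\<epsilon> (inv_into (B i j) \<rho> v)) (frag_of (inv_into (B i j) \<rho> v))) = frag_of v"
        by (simp add: frag_extend_cmul ee)
    qed
    then show ?thesis by (simp add: frag_extend_frag_of)
  qed
  have PsiPhi: "\<Psi> i (\<Phi> x) = x" if x: "Poly_Mapping.keys x \<subseteq> B i j" for x i
  proof -
    have "\<Psi> i (\<Phi> x) = frag_extend frag_of x"
      unfolding \<Phi>_def \<Psi>_def frag_extend_extend
    proof (rule frag_extend_eq)
      fix v assume "v \<in> Poly_Mapping.keys x"
      then have "inv_into (B i j) \<rho> (\<rho> v) = v" using x bij_betw_inv_into_left[OF bij] by blast
      then show "frag_extend (\<lambda>y. frag_cmul (\<epsilon> (inv_into (B i j) \<rho> y)) (frag_of (inv_into (B i j) \<rho> y)))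
          (frag_cmul (\<epsilon> v) (frag_of (\<rho> v))) = frag_of v"
        by (simp add: frag_extend_cmul ee)
    qed
    then show ?thesis by (simp add: frag_extend_frag_of)
  qed
  have chain: "\<Phi> (frag_extend d x) = frag_extend d' (\<Phi> x)" if x: "Poly_Mapping.keys x \<subseteq> B i j" for x i
    unfolding \<Phi>_def frag_extend_extend
  proof (rule frag_extend_eq)
    fix v assume "v \<in> Poly_Mapping.keys x"
    then have "v \<in> B i j" using x by blast
    then show "frag_extend (\<lambda>x. frag_cmul (\<epsilon> x) (frag_of (\<rho> x))) (d v) =
        frag_extend d' (frag_cmul (\<epsilon> v) (frag_of (\<rho> v)))"
      using comm by (simp add: frag_extend_cmul)
  qed
  have Phi0: "\<Phi> 0 = 0" by (simp add: \<Phi>_def)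
  have inj0: "x = 0" if "Poly_Mapping.keys x \<subseteq> B i j" "\<Phi> x = 0" for x i
    using PsiPhi[OF that(1)] that(2) by (simp add: \<Psi>_def)
  have cyc: "\<Phi> x \<in> C'.cycles i j \<longleftrightarrow> x \<in> C.cycles i j" if x: "Poly_Mapping.keys x \<subseteq> B i j" for x
  proof -
    have dx: "Poly_Mapping.keys (frag_extend d x) \<subseteq> B (i + 1) j"
      using hom_in_carrier[OF C.d_hom, of x i j] x by simp
    have "frag_extend d' (\<Phi> x) = 0 \<longleftrightarrow> frag_extend d x = 0"
      using chain[OF x] inj0[OF dx] Phi0 by metis
    then show ?thesis using x PhiC[OF x] by (simp add: kernel_def)
  qed
  have bou: "\<Phi> x \<in> C'.bounds i j \<longleftrightarrow> x \<in> C.bounds i j" if x: "Poly_Mapping.keys x \<subseteq> B i j" for x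
  proof
    assume "x \<in> C.bounds i j"
    then obtain u where u: "Poly_Mapping.keys u \<subseteq> B (i - 1) j" "x = frag_extend d u" by auto
    then show "\<Phi> x \<in> C'.bounds i j" using chain[OF u(1)] PhiC[OF u(1)] by auto
  next
    assume "\<Phi> x \<in> C'.bounds i j"
    then obtain w where w: "Poly_Mapping.keys w \<subseteq> B' (i - 1) j" "\<Phi> x = frag_extend d' w" by auto
    define u where "u = \<Psi> (i - 1) w"
    have u: "Poly_Mapping.keys u \<subseteq> B (i - 1) j" "w = \<Phi> u"
      using PsiC[OF w(1)] PhiPsi[OF w(1)] by (simp_all add: u_def)
    have du: "Poly_Mapping.keys (frag_extend d u) \<subseteq> B i j"
      using hom_in_carrier[OF C.d_hom, of u "i - 1" j] u by simp
    have "\<Phi> x = \<Phi> (frag_extend d u)" using w(2) u chain by simp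
    then have "x = frag_extend d u" using PsiPhi[OF x] PsiPhi[OF du] by metis
    then show "x \<in> C.bounds i j" using u(1) by auto
  qed
  let ?Z = "subgroup_generated (free_Abelian_group (B i j)) (C.cycles i j)"
  let ?Z' = "subgroup_generated (free_Abelian_group (B' i j)) (C'.cycles i j)"
  let ?h = "\<lambda>x. C'.bounds i j #>\<^bsub>?Z'\<^esub> \<Phi> x"
  have fZ: "frag_group ?Z" "frag_group ?Z'" by (rule frag_group_generated[OF frag_group_free])+
  interpret Z: comm_group ?Z using fZ by (simp add: frag_group_def)
  interpret Z': comm_group ?Z' using fZ by (simp add: frag_group_def)
  interpret N: normal "C'.bounds i j" ?Z' unfolding Z'.normal_iff_subgroup by (rule C'.subgroup_bounds)
  have kx: "Poly_Mapping.keys x \<subseteq> B i j" if "x \<in> C.cycles i j" for x using that by (simp add: kernel_def)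
  have PhiZ: "\<Phi> x \<in> carrier ?Z'" if "x \<in> carrier ?Z" for x
    using that cyc[OF kx] unfolding C.carrier_cycles C'.carrier_cycles by blast
  have "\<Phi> \<in> hom ?Z ?Z'"
    using PhiZ by (auto intro!: homI simp: \<Phi>_def frag_extend_add)
  from hom_compose[OF this N.r_coset_hom_Mod]
  have hom: "?h \<in> hom ?Z (?Z' Mod C'.bounds i j)" by (simp add: comp_def)
  interpret Q: group "?Z' Mod C'.bounds i j" by (rule N.factorgroup_is_group)
  interpret h: group_hom ?Z "?Z' Mod C'.bounds i j" ?h using hom by unfold_locales
  have "kernel ?Z (?Z' Mod C'.bounds i j) ?h = C.bounds i j"
  proof -
    have "?h x = C'.bounds i j \<longleftrightarrow> x \<in> C.bounds i j" if "x \<in> carrier ?Z" for x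
      using coset_eq_self_iff[OF fZ(2) C'.subgroup_bounds PhiZ[OF that]] bou[OF kx] that
      unfolding C.carrier_cycles by blast
    then show ?thesis
      using C.bounds_cycles[of i j] unfolding kernel_def[of ?Z] one_FactGroup C.carrier_cycles by blast
  qed
  moreover have "?h ` carrier ?Z = carrier (?Z' Mod C'.bounds i j)"
  proof -
    have "\<Phi> ` carrier ?Z = carrier ?Z'"
    proof
      show "\<Phi> ` carrier ?Z \<subseteq> carrier ?Z'" using PhiZ by blast
      show "carrier ?Z' \<subseteq> \<Phi> ` carrier ?Z"
      proof
        fix y assume y: "y \<in> carrier ?Z'"
        then have ky: "Poly_Mapping.keys y \<subseteq> B' i j" unfolding C'.carrier_cycles by (simp add: kernel_def)
        then have "\<Psi> i y \<in> carrier ?Z"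
          using cyc[OF PsiC[OF ky]] PhiPsi[OF ky] y unfolding C.carrier_cycles C'.carrier_cycles by simp
        then show "y \<in> \<Phi> ` carrier ?Z" using PhiPsi[OF ky] by (metis imageI)
      qed
    qed
    then show ?thesis unfolding carrier_FactGroup by (metis image_image)
  qed
  ultimately show "homology (free_complex B d) i j \<cong> homology (free_complex B' d') i j"
    unfolding C.homology_free C'.homology_free using h.FactGroup_iso by metis
qed


section \<open>Relabelling\<close>

locale fatgraph_iso = A: fatgraph F + B: fatgraph F'
  for F :: "('v, 'h) fatgraph" and F' :: "('w, 'k) fatgraph" +
  fixes f :: "'v \<Rightarrow> 'w" and g :: "'h \<Rightarrow> 'k"
  assumes bij_f: "bij_betw f (verts F) (verts F')" and bij_g: "bij_betw g (halves F) (halves F')"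
    and vert_g: "h \<in> halves F \<Longrightarrow> vert F' (g h) = f (vert F h)"
    and nxt_g: "h \<in> halves F \<Longrightarrow> nxt F' (g h) = g (nxt F h)"
    and opp_g: "h \<in> halves F \<Longrightarrow> opp F' (g h) = g (opp F h)"
begin

abbreviation ge :: "'h set \<Rightarrow> 'k set" where "ge e \<equiv> g ` e"
abbreviation gw :: "'h set set \<Rightarrow> 'k set set" where "gw W \<equiv> ge ` W"

lemma inj_g: "inj_on g (halves F)" and g_halves: "g ` halves F = halves F'"
  and inj_f: "inj_on f (verts F)" and f_verts: "f ` verts F = verts F'"
  using bij_f bij_g by (simp_all add: bij_betw_def)

lemma Union_gw: "\<Union>(gw W) = g ` \<Union>W" by blast

lemma ge_mem_iff: "W \<subseteq> edges F \<Longrightarrow> h \<in> halves F \<Longrightarrow> g h \<in> \<Union>(gw W) \<longleftrightarrow> h \<in> \<Union>W"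
  unfolding Union_gw by (rule inj_on_image_mem_iff[OF inj_g _ A.Union_state])

lemma ge_edges: "gw (edges F) = edges F'"
proof -
  have "edges F = (\<lambda>h. {h, opp F h}) ` halves F" "edges F' = (\<lambda>h. {h, opp F' h}) ` halves F'"
    by (auto simp: edges_def)
  then show ?thesis using opp_g by (force simp: g_halves[symmetric] image_image)
qed

lemma inj_ge: "inj_on ge (edges F)"
proof -
  have "edges F \<subseteq> Pow (halves F)" using A.edge_cases by blast
  then show ?thesis using inj_on_image_Pow[OF inj_g] inj_on_subset by blast
qed

lemma gw_sub: "W \<subseteq> edges F \<Longrightarrow> gw W \<subseteq> edges F'"
  unfolding ge_edges[symmetric] by (rule image_mono)

lemma gw_card: "W \<subseteq> edges F \<Longrightarrow> card (gw W) = card W"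
  by (rule card_image[OF inj_on_subset[OF inj_ge]])

lemma gw_delete: "W \<subseteq> edges F \<Longrightarrow> e \<in> W \<Longrightarrow> gw (W - {e}) = gw W - {ge e}"
  using inj_on_image_set_diff[OF inj_ge, of W "{e}"] by auto

lemma e_num_eq: "e_num F' = e_num F"
  unfolding e_num_def ge_edges[symmetric] by (rule gw_card) simp

lemma v_num_eq: "v_num F' = v_num F"
  unfolding v_num_def f_verts[symmetric] by (rule card_image[OF inj_f])

lemma height_eq: "W \<subseteq> edges F \<Longrightarrow> height F' (gw W) = height F W"
  by (simp add: A.height_state B.height_state gw_sub gw_card e_num_eq)

lemma state_perm_g:
  assumes "W \<subseteq> edges F" "h \<in> halves F"
  shows "state_perm F' (gw W) (g h) = g (state_perm F W h)"
proof -
  have "g h \<in> halves F'" using assms(2) g_halves by blast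
  then show ?thesis using assms A.opp_in ge_mem_iff[OF assms] nxt_g opp_g by (simp add: state_perm_def)
qed

fun gb :: "('v, 'h) boundary \<Rightarrow> ('w, 'k) boundary" where
  "gb (Isolated v) = Isolated (f v)"
| "gb (Cycle S) = Cycle (g ` S)"

text \<open>\<open>g\<close> conjugates the permutations of the two states and, being injective on
  half-edges, respects the traces of their cycles.\<close>

lemma curve_g:
  assumes W: "W \<subseteq> edges F" and p: "p \<in> points F"
  shows "curve F' (gw W) (map_sum g f p) = gb (curve F W p)"
proof (cases p)
  case (Inl h)
  then have h: "h \<in> halves F" using p by (auto simp: points_def)
  let ?O = "orbit (state_perm F W) h"
  have sub: "?O \<subseteq> halves F" by (rule A.orbit_in_halves[OF W h])
  have "g ` ?O = orbit (state_perm F' (gw W)) (g h)"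
    using sub by (intro orbit_inverse A.state_orbit(1)[OF W] state_perm_g[OF W]) blast
  then have "orbit (state_perm F' (gw W)) (g h) \<inter> \<Union>(gw W) = g ` (?O \<inter> \<Union>W)"
    unfolding Union_gw using inj_on_image_Int[OF inj_g sub A.Union_state[OF W]] by simp
  then show ?thesis using vert_g[OF h] by (simp add: Inl Let_def)
qed simp

lemma points_g: "points F' = map_sum g f ` points F"
proof -
  have "vert F' ` halves F' = f ` vert F ` halves F"
    unfolding g_halves[symmetric] image_image using vert_g by (intro image_cong) auto
  moreover have "vert F ` halves F \<subseteq> verts F" using A.vert_in by blast
  then have "f ` (verts F - vert F ` halves F) = f ` verts F - f ` vert F ` halves F"
    by (intro inj_on_image_set_diff[OF inj_f]) auto
  ultimately have "verts F' - vert F' ` halves F' = f ` (verts F - vert F ` halves F)"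
    using f_verts by simp
  then show ?thesis unfolding points_def g_halves[symmetric] by (simp add: image_Un image_image)
qed

lemma curve_image_g:
  assumes "W \<subseteq> edges F"
  shows "curve F' (gw W) ` points F' = gb ` curve F W ` points F"
  unfolding points_g image_image by (rule image_cong[OF refl curve_g[OF assms]])

lemma boundaries_g:
  assumes "W \<subseteq> edges F"
  shows "boundaries (spanning_subgraph F' (gw W)) = gb ` boundaries (spanning_subgraph F W)"
  unfolding A.boundaries_spanning[OF assms] B.boundaries_spanning[OF gw_sub[OF assms]]
  by (rule curve_image_g[OF assms])

text \<open>A domain containing the curves of every state, so that one inverse of \<open>gb\<close>
  serves all of them; \<open>f\<close> and \<open>g\<close> are known to be injective only on
  vertices and half-edges of \<open>F\<close>.\<close>

definition all_curves :: "('v, 'h) boundary set" where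
  "all_curves = Isolated ` verts F \<union> Cycle ` Pow (halves F)"

lemma inj_gb: "inj_on gb all_curves"
proof (rule inj_onI)
  fix x y assume *: "x \<in> all_curves" "y \<in> all_curves" "gb x = gb y"
  have "Isolated v \<in> all_curves \<longleftrightarrow> v \<in> verts F" "Cycle S \<in> all_curves \<longleftrightarrow> S \<subseteq> halves F" for v S
    by (auto simp: all_curves_def)
  with * show "x = y"
    by (cases x; cases y) (simp_all add: inj_on_eq_iff[OF inj_f] inj_on_image_eq_iff[OF inj_g])
qed

lemma curves_sub:
  assumes W: "W \<subseteq> edges F" shows "curve F W ` points F \<subseteq> all_curves"
proof (rule image_subsetI)
  fix p assume "p \<in> points F"
  then consider h where "h \<in> halves F" "p = Inl h" | v where "v \<in> verts F" "p = Inr v"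
    by (auto simp: points_def)
  then show "curve F W p \<in> all_curves"
  proof cases
    case 1
    have "orbit (state_perm F W) h \<inter> \<Union>W \<in> Pow (halves F)" using A.orbit_in_halves[OF W 1(1)] by blast
    then show ?thesis using A.vert_in[OF 1(1)] unfolding 1(2) all_curves_def by (simp add: Let_def)
  next
    case 2 then show ?thesis by (simp add: all_curves_def)
  qed
qed

lemma boundaries_sub: "W \<subseteq> edges F \<Longrightarrow> boundaries (spanning_subgraph F W) \<subseteq> all_curves"
  by (simp add: A.boundaries_spanning curves_sub)

lemma state_components_g:
  assumes W: "W \<subseteq> edges F"
  shows "state_components F' (gw W) = state_components F W"
proof -
  let ?r = "adjacent F W" and ?r' = "adjacent F' (gw W)"
  have ends: "vert F' ` ge e = f ` vert F ` e" if "e \<in> W" for e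
    unfolding image_image using that W A.edge_cases vert_g by (intro image_cong) auto
  have vs: "vert F ` e \<subseteq> verts F" if "e \<in> W" for e using that W A.edge_cases A.vert_in by blast
  have fwd: "(f u, f v) \<in> ?r'" if uv: "(u, v) \<in> ?r" for u v
  proof -
    obtain e where e: "u \<in> verts F" "v \<in> verts F" "e \<in> W" "vert F ` e = {u, v}"
      using uv unfolding adjacent_def by blast
    then have "vert F' ` ge e = {f u, f v}" using ends by simp
    then show ?thesis using e f_verts unfolding adjacent_def by blast
  qed
  let ?k = "inv_into (verts F) f"
  have kf: "?k (f v) = v" if "v \<in> verts F" for v using that inj_f by simp
  have bwd: "(?k u, ?k v) \<in> ?r" if uv: "(u, v) \<in> ?r'" for u v
  proof -
    obtain e where e: "e \<in> W" "vert F' ` ge e = {u, v}" using uv unfolding adjacent_def by blast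
    have "?k ` f ` vert F ` e = (\<lambda>x. x) ` vert F ` e"
      unfolding image_image[of ?k] using vs[OF e(1)] kf by (intro image_cong) auto
    then have "vert F ` e = {?k u, ?k v}" using e ends by simp
    then show ?thesis using e(1) vs[OF e(1)] unfolding adjacent_def by blast
  qed
  have iff: "(f u, f v) \<in> ?r'\<^sup>* \<longleftrightarrow> (u, v) \<in> ?r\<^sup>*" if "u \<in> verts F" "v \<in> verts F" for u v
  proof
    assume "(f u, f v) \<in> ?r'\<^sup>*"
    then have "(?k (f u), ?k (f v)) \<in> ?r\<^sup>*" by (rule rtrancl_map_rel[rotated]) (rule bwd)
    then show "(u, v) \<in> ?r\<^sup>*" by (simp only: kf that)
  next
    assume "(u, v) \<in> ?r\<^sup>*"
    then show "(f u, f v) \<in> ?r'\<^sup>*" by (rule rtrancl_map_rel[rotated]) (rule fwd)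
  qed
  let ?E = "?r\<^sup>* \<inter> verts F \<times> verts F" and ?E' = "?r'\<^sup>* \<inter> verts F' \<times> verts F'"
  have cls: "?E' `` {f u} = f ` (?E `` {u})" if u: "u \<in> verts F" for u
  proof -
    have "y \<in> ?E' `` {f u} \<longleftrightarrow> y \<in> f ` (?E `` {u})" for y
    proof
      assume y: "y \<in> ?E' `` {f u}"
      then have y: "(f u, y) \<in> ?r'\<^sup>*" "y \<in> f ` verts F" by (simp_all add: f_verts)
      from y(2) obtain v where v: "y = f v" "v \<in> verts F" by (rule imageE)
      then have "v \<in> ?E `` {u}" using iff[OF u v(2)] u y(1) by simp
      then show "y \<in> f ` (?E `` {u})" unfolding v(1) by (rule imageI)
    next
      assume "y \<in> f ` (?E `` {u})"
      then obtain v where v: "y = f v" "v \<in> ?E `` {u}" by (rule imageE)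
      then have v': "v \<in> verts F" "(u, v) \<in> ?r\<^sup>*" by simp_all
      then have "(f u, f v) \<in> ?r'\<^sup>*" using iff[OF u v'(1)] by simp
      then show "y \<in> ?E' `` {f u}" unfolding v(1) f_verts[symmetric] using imageI[OF u, of f] imageI[OF v'(1), of f]
        by simp
    qed
    then show ?thesis by blast
  qed
  have "verts F' // ?E' = (\<lambda>u. ?E' `` {f u}) ` verts F"
    unfolding quotient_def f_verts[symmetric] by blast
  also have "\<dots> = (\<lambda>u. f ` (?E `` {u})) ` verts F" using cls by (intro image_cong) auto
  also have "\<dots> = (`) f ` (verts F // ?E)" unfolding quotient_def by blast
  finally have "card (verts F' // ?E') = card ((`) f ` (verts F // ?E))" by simp
  also have "\<dots> = card (verts F // ?E)"
  proof (rule card_image, rule inj_on_subset[OF inj_on_image_Pow[OF inj_f]])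
    show "verts F // ?E \<subseteq> Pow (verts F)" unfolding quotient_def by blast
  qed
  finally show ?thesis unfolding state_components_alt .
qed

text \<open>Euler's formula expresses the genus by numbers that the isomorphism preserves.\<close>

lemma genus_eq:
  assumes W: "W \<subseteq> edges F"
  shows "genus (spanning_subgraph F' (gw W)) = genus (spanning_subgraph F W)"
proof -
  have "card (curve F' (gw W) ` points F') = card (curve F W ` points F)"
    unfolding curve_image_g[OF W] by (intro card_image inj_on_subset[OF inj_gb] curves_sub W)
  then show ?thesis
    using A.euler_formula[OF W] B.euler_formula[OF gw_sub[OF W]] state_components_g[OF W] gw_card[OF W] v_num_eq
    by simp
qed

section \<open>Relabelling of labels and generators\<close>

definition relabel_v :: "('v \<Rightarrow> vgen) \<Rightarrow> 'w \<Rightarrow> vgen" where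
  "relabel_v a = restrict (a \<circ> inv_into (verts F) f) (verts F')"

definition relabel_b :: "('v, 'h) boundary set \<Rightarrow> (('v, 'h) boundary \<Rightarrow> vgen) \<Rightarrow> ('w, 'k) boundary \<Rightarrow> vgen" where
  "relabel_b S b = restrict (b \<circ> inv_into all_curves gb) (gb ` S)"

lemma relabel_v_f: "v \<in> verts F \<Longrightarrow> relabel_v a (f v) = a v"
  using f_verts inj_f by (auto simp: relabel_v_def)

lemma relabel_b_gb: "S \<subseteq> all_curves \<Longrightarrow> c \<in> S \<Longrightarrow> relabel_b S b (gb c) = b c"
  using inj_gb by (auto simp: relabel_b_def)

lemma relabel_b_eqI:
  assumes "S \<subseteq> all_curves" "y \<in> extensional (gb ` S)" "\<And>c. c \<in> S \<Longrightarrow> y (gb c) = b c"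
  shows "y = relabel_b S b"
proof
  fix z show "y z = relabel_b S b z"
  proof (cases "z \<in> gb ` S")
    case True
    then obtain c where "c \<in> S" "z = gb c" by blast
    then show ?thesis using assms relabel_b_gb by simp
  next
    case False
    then show ?thesis using assms(2) by (simp add: relabel_b_def extensional_def)
  qed
qed

lemma merge_labels_g:
  assumes S: "S \<subseteq> all_curves" "S' \<subseteq> all_curves" and k: "k1 \<in> S" "k2 \<in> S" "S' = insert k (S - {k1, k2})"
  shows "merge_labels (gb ` S') (gb k) (gb k1) (gb k2) (relabel_b S b) =
    frag_extend (\<lambda>x. frag_of (relabel_b S' x)) (merge_labels S' k k1 k2 b)"
proof -
  have "restrict ((relabel_b S b)(gb k := y)) (gb ` S') = relabel_b S' (restrict (b(k := y)) S')" for y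
  proof (rule relabel_b_eqI[OF S(2)])
    fix c assume c: "c \<in> S'"
    then have "gb c = gb k \<longleftrightarrow> c = k" using inj_on_eq_iff[OF inj_gb] S(2) k(3) by blast
    then show "restrict ((relabel_b S b)(gb k := y)) (gb ` S') (gb c) = restrict (b(k := y)) S' c"
      using c k(3) relabel_b_gb[OF S(1)] by auto
  qed simp
  then show ?thesis
    by (simp add: merge_labels_def frag_extend_extend relabel_b_gb[OF S(1)] k(1,2))
qed

lemma split_labels_g:
  assumes S: "S \<subseteq> all_curves" "S' \<subseteq> all_curves" and k: "k \<in> S" "S' = insert k1 (insert k2 (S - {k}))"
  shows "split_labels (gb ` S') (gb k) (gb k1) (gb k2) (relabel_b S b) =
    frag_extend (\<lambda>x. frag_of (relabel_b S' x)) (split_labels S' k k1 k2 b)"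
proof -
  have "restrict ((relabel_b S b)(gb k1 := y, gb k2 := z)) (gb ` S') =
      relabel_b S' (restrict (b(k1 := y, k2 := z)) S')" for y z
  proof (rule relabel_b_eqI[OF S(2)])
    fix c assume c: "c \<in> S'"
    then have "gb c = gb k1 \<longleftrightarrow> c = k1" "gb c = gb k2 \<longleftrightarrow> c = k2"
      using inj_on_eq_iff[OF inj_gb] S(2) k(2) by blast+
    then show "restrict ((relabel_b S b)(gb k1 := y, gb k2 := z)) (gb ` S') (gb c) =
        restrict (b(k1 := y, k2 := z)) S' c"
      using c k(2) relabel_b_gb[OF S(1)] by auto
  qed simp
  then show ?thesis
    by (simp add: split_labels_def frag_extend_extend relabel_b_gb[OF S(1)] k(1) split_def)
qed

text \<open>The choices made by \<open>SOME\<close> in the two graphs need not correspond. Passing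
  through \<open>surgery_map\<close> names the curves by the halves of the edge, which
  \<open>g\<close> carries over.\<close>

lemma boundary_map_g:
  assumes W: "W \<subseteq> edges F" and e: "e \<in> W"
  shows "state_boundary_map F' (ge e) (gw W) (relabel_b (boundaries (spanning_subgraph F W)) b) =
    frag_extend (\<lambda>x. frag_of (relabel_b (boundaries (spanning_subgraph F (W - {e}))) x)) (state_boundary_map F e W b)"
proof -
  obtain a where a: "e = {a, opp F a}" "a \<in> halves F" using W e A.edge_obtain by (metis subsetD)
  have W': "W - {e} \<subseteq> edges F" using W by blast
  have P: "Inl a \<in> points F" "Inl (opp F a) \<in> points F" using a A.opp_in by (auto simp: points_def)
  have ga: "ge e = {g a, opp F' (g a)}" using a opp_g by simp
  have gin: "{g a, opp F' (g a)} \<in> gw W" using e ga by blast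
  let ?c = "curve F W" and ?c' = "curve F (W - {e})"
  note m = A.boundary_map_eq_surgery[OF W e[unfolded a(1)] refl, folded a(1)]
  note s = A.surgery_delete[OF W e[unfolded a(1)], folded a(1)]
  note m' = B.boundary_map_eq_surgery[OF gw_sub[OF W] gin refl, folded ga]
  have cg: "curve F' (gw W) (Inl (g a)) = gb (?c (Inl a))"
    "curve F' (gw W) (Inl (opp F' (g a))) = gb (?c (Inl (opp F a)))"
    "curve F' (gw W - {ge e}) (Inl (g a)) = gb (?c' (Inl a))"
    "curve F' (gw W - {ge e}) (Inl (opp F' (g a))) = gb (?c' (Inl (opp F a)))"
    "curve F' (gw W - {ge e}) ` points F' = gb ` ?c' ` points F"
    using curve_g[OF W P(1)] curve_g[OF W P(2)] curve_g[OF W' P(1)] curve_g[OF W' P(2)]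
      curve_image_g[OF W'] opp_g[OF a(2)] unfolding gw_delete[OF W e] by simp_all
  have eq: "gb (?c (Inl a)) = gb (?c (Inl (opp F a))) \<longleftrightarrow> ?c (Inl a) = ?c (Inl (opp F a))"
    using inj_on_eq_iff[OF inj_gb] curves_sub[OF W] P by blast
  show ?thesis
    unfolding m m' A.boundaries_spanning[OF W] A.boundaries_spanning[OF W'] surgery_map_def cg eq
  proof (split if_split, intro conjI impI)
    assume c: "?c (Inl a) = ?c (Inl (opp F a))"
    note j = surgery_split_cond[OF surgery_joins(2)[OF s c]]
    show "split_labels (gb ` ?c' ` points F) (gb (?c (Inl a))) (gb (?c' (Inl a))) (gb (?c' (Inl (opp F a))))
        (relabel_b (?c ` points F) b) =
      frag_extend (\<lambda>x. frag_of (relabel_b (?c' ` points F) x))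
        ((if ?c (Inl a) = ?c (Inl (opp F a)) then split_labels (?c' ` points F) (?c (Inl a)) (?c' (Inl a)) (?c' (Inl (opp F a)))
          else merge_labels (?c' ` points F) (?c' (Inl a)) (?c (Inl a)) (?c (Inl (opp F a)))) b)"
      unfolding if_P[OF c] by (rule split_labels_g[OF curves_sub[OF W] curves_sub[OF W'] j(4,5)])
  next
    assume c: "?c (Inl a) \<noteq> ?c (Inl (opp F a))"
    note j = surgery_merge_cond[OF surgery_joins(1)[OF s c]]
    show "merge_labels (gb ` ?c' ` points F) (gb (?c' (Inl a))) (gb (?c (Inl a))) (gb (?c (Inl (opp F a))))
        (relabel_b (?c ` points F) b) =
      frag_extend (\<lambda>x. frag_of (relabel_b (?c' ` points F) x))
        ((if ?c (Inl a) = ?c (Inl (opp F a)) then split_labels (?c' ` points F) (?c (Inl a)) (?c' (Inl a)) (?c' (Inl (opp F a)))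
          else merge_labels (?c' ` points F) (?c' (Inl a)) (?c (Inl a)) (?c (Inl (opp F a)))) b)"
      unfolding if_not_P[OF c] by (rule merge_labels_g[OF curves_sub[OF W] curves_sub[OF W'] j(3-5)])
  qed
qed

fun relabel :: "('v, 'h) tensor_gen \<Rightarrow> ('w, 'k) tensor_gen" where
  "relabel (Tensor W a b gs rs) =
     Tensor (gw W) (relabel_v a) (relabel_b (boundaries (spanning_subgraph F W)) b) gs rs"

lemma edge_map_relabel:
  assumes W: "W \<subseteq> edges F" and e: "e \<in> W" and x: "state_edges x = W"
  shows "edge_map F' (ge e) (relabel x) = frag_extend (\<lambda>y. frag_of (relabel y)) (edge_map F e x)"
proof -
  obtain a b gs rs where x: "x = Tensor W a b gs rs" using x by (cases x) auto
  have W': "W - {e} \<subseteq> edges F" using W by blast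
  have G: "state_genus_map F' (ge e) (gw W) = state_genus_map F e W"
    using genus_eq[OF W] genus_eq[OF W'] unfolding gw_delete[OF W e] by (simp add: genus_map_def fun_eq_iff)
  show ?thesis
    unfolding x relabel.simps edge_map_Tensor boundary_map_g[OF W e] G
    by (simp add: tensor_frag_def frag_extend_extend gw_delete[OF W e])
qed

lemma relabel_state_gens:
  assumes W: "W \<subseteq> edges F" and x: "x \<in> state_gens F W"
  shows "relabel x \<in> state_gens F' (gw W)" and "gen_degree F' (relabel x) = gen_degree F x"
proof -
  let ?S = "boundaries (spanning_subgraph F W)"
  have HH: "verts (spanning_subgraph F W) = verts F" "verts (spanning_subgraph F' (gw W)) = verts F'"
    by (simp_all add: spanning_subgraph_def)
  obtain a b gs rs where x: "x = Tensor W a b gs rs" "length gs = 2 * genus (spanning_subgraph F W)"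
      "length rs = height F W" using x by (auto simp: state_gens_def Let_def)
  show "relabel x \<in> state_gens F' (gw W)"
    using x by (simp add: state_gens_def Let_def HH boundaries_g[OF W] genus_eq[OF W] height_eq[OF W]
        relabel_v_def relabel_b_def)
  have "(\<Sum>v\<in>verts F'. vdeg (relabel_v a v)) = (\<Sum>v\<in>verts F. vdeg (a v))"
    unfolding f_verts[symmetric] using inj_f by (simp add: sum.reindex relabel_v_f)
  moreover have "(\<Sum>c\<in>gb ` ?S. vdeg (relabel_b ?S b c)) = (\<Sum>c\<in>?S. vdeg (b c))"
    using inj_on_subset[OF inj_gb boundaries_sub[OF W]]
    by (simp add: sum.reindex relabel_b_gb[OF boundaries_sub[OF W]])
  ultimately show "gen_degree F' (relabel x) = gen_degree F x"
    by (simp add: x(1) gen_degree_def Let_def HH boundaries_g[OF W] height_eq[OF W])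
qed

lemma inj_relabel: "inj_on relabel (\<Union>W\<in>Pow (edges F). state_gens F W)"
proof (rule inj_onI)
  fix x y assume "x \<in> (\<Union>W\<in>Pow (edges F). state_gens F W)" "y \<in> (\<Union>W\<in>Pow (edges F). state_gens F W)"
    and eq: "relabel x = relabel y"
  then obtain W1 W2 where W: "W1 \<subseteq> edges F" "x \<in> state_gens F W1" "W2 \<subseteq> edges F" "y \<in> state_gens F W2" by auto
  obtain a b gs rs where x: "x = Tensor W1 a b gs rs" "a \<in> verts F \<rightarrow>\<^sub>E UNIV"
      "b \<in> boundaries (spanning_subgraph F W1) \<rightarrow>\<^sub>E UNIV"
    using W(2) by (auto simp: state_gens_def Let_def spanning_subgraph_def)
  obtain a' b' gs' rs' where y: "y = Tensor W2 a' b' gs' rs'" "a' \<in> verts F \<rightarrow>\<^sub>E UNIV"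
      "b' \<in> boundaries (spanning_subgraph F W2) \<rightarrow>\<^sub>E UNIV"
    using W(4) by (auto simp: state_gens_def Let_def spanning_subgraph_def)
  have "gw W1 = gw W2" using eq x y by simp
  then have WW: "W1 = W2" using inj_onD[OF inj_on_image_Pow[OF inj_ge]] W(1,3) by blast
  have "a = a'"
  proof (rule PiE_ext[OF x(2) y(2)])
    fix v assume v: "v \<in> verts F"
    have "relabel_v a = relabel_v a'" using eq x y by simp
    then show "a v = a' v" using relabel_v_f[OF v] by metis
  qed
  moreover have "b = b'"
  proof (rule PiE_ext[OF x(3) y(3)[folded WW]])
    fix c assume c: "c \<in> boundaries (spanning_subgraph F W1)"
    have "relabel_b (boundaries (spanning_subgraph F W1)) b = relabel_b (boundaries (spanning_subgraph F W1)) b'"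
      using eq x y WW by simp
    then show "b c = b' c" using relabel_b_gb[OF boundaries_sub[OF W(1)] c] by metis
  qed
  ultimately show "x = y" using eq x y WW by simp
qed

lemma relabel_chain_gens: "x \<in> chain_gens F i j \<Longrightarrow> relabel x \<in> chain_gens F' i j"
proof -
  assume "x \<in> chain_gens F i j"
  then obtain W where W: "W \<subseteq> edges F" "- int (card W) = i" "x \<in> state_gens F W" "gen_degree F x = j"
    unfolding A.chain_gens_alt by blast
  then show ?thesis unfolding B.chain_gens_alt
    using gw_sub[OF W(1)] gw_card[OF W(1)] relabel_state_gens[OF W(1,3)] by (intro CollectI exI[of _ "gw W"]) auto
qed

lemma inj_relabel_chain_gens: "inj_on relabel (chain_gens F i j)"
  by (rule inj_on_subset[OF inj_relabel]) (auto simp: A.chain_gens_alt)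

lemma card_chain_gens_le: "card (chain_gens F i j) \<le> card (chain_gens F' i j)"
  by (intro card_inj_on_le[OF inj_relabel_chain_gens] B.finite_chain_gens image_subsetI relabel_chain_gens)

end

lemma fatgraph_iso_sym:
  assumes "fatgraph_iso F F' f g"
  shows "fatgraph_iso F' F (inv_into (verts F) f) (inv_into (halves F) g)"
proof -
  interpret fatgraph_iso F F' f g by (rule assms)
  let ?k = "inv_into (verts F) f" and ?l = "inv_into (halves F) g"
  have l: "?l (g h) = h" if "h \<in> halves F" for h using that inj_g by simp
  have k: "?k (f v) = v" if "v \<in> verts F" for v using that inj_f by simp
  show ?thesis
  proof (intro fatgraph_iso.intro fatgraph_iso_axioms.intro B.fatgraph_axioms A.fatgraph_axioms)
    show "bij_betw ?k (verts F') (verts F)" by (rule bij_betw_inv_into[OF bij_f])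
    show "bij_betw ?l (halves F') (halves F)" by (rule bij_betw_inv_into[OF bij_g])
    fix h' assume "h' \<in> halves F'"
    then obtain h where h: "h \<in> halves F" "h' = g h" using g_halves by blast
    show "vert F (?l h') = ?k (vert F' h')" using h l vert_g k A.vert_in by simp
    show "nxt F (?l h') = ?l (nxt F' h')" using h l nxt_g A.nxt_in by simp
    show "opp F (?l h') = ?l (opp F' h')" using h l opp_g A.opp_in by simp
  qed
qed

text \<open>Surjectivity by counting: the inverse isomorphism gives the opposite inequality between
  the finite sets of generators.\<close>

lemma (in fatgraph_iso) bij_relabel: "bij_betw relabel (chain_gens F i j) (chain_gens F' i j)"
proof -
  have "card (chain_gens F' i j) \<le> card (chain_gens F i j)"
    by (rule fatgraph_iso.card_chain_gens_le[OF fatgraph_iso_sym[OF fatgraph_iso_axioms]])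
  moreover have "card (relabel ` chain_gens F i j) = card (chain_gens F i j)"
    by (rule card_image[OF inj_relabel_chain_gens])
  moreover have "relabel ` chain_gens F i j \<subseteq> chain_gens F' i j" using relabel_chain_gens by blast
  ultimately have "relabel ` chain_gens F i j = chain_gens F' i j"
    using card_seteq[OF B.finite_chain_gens] by metis
  then show ?thesis using inj_relabel_chain_gens by (simp add: bij_betw_def)
qed



section \<open>Independence of the edge numbering\<close>

definition position :: "'e list \<Rightarrow> 'e \<Rightarrow> nat" where
  "position es = inv_into {..<length es} ((!) es)"

lemma position_nth: "distinct es \<Longrightarrow> i < length es \<Longrightarrow> position es (es ! i) = i"
  unfolding position_def by (intro inv_into_f_f) (auto simp: inj_on_nth)

lemma inj_position: "distinct es \<Longrightarrow> inj_on (position es) (set es)"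
  using position_nth by (metis in_set_conv_nth inj_onI)

text \<open>Summing over edges instead of indices lets the differentials of two numberings be
  compared term by term.\<close>

lemma (in fatgraph) gen_diff_position:
  assumes es: "edge_numbering F es" and W: "W \<subseteq> edges F" and x: "state_edges x = W"
  shows "gen_diff F es x =
    (\<Sum>e\<in>W. frag_cmul ((- 1) ^ card {h \<in> edges F - W. position es h < position es e}) (edge_map F e x))"
proof -
  have dist: "distinct es" and set: "set es = edges F" using es by (auto simp: edge_numbering_def)
  let ?J = "{j. j < length es \<and> es ! j \<in> W}"
  have inj: "inj_on ((!) es) J" if "J \<subseteq> {..<length es}" for J
    using that by (intro inj_on_nth dist) auto
  have WJ: "W = (!) es ` ?J"
  proof
    show "W \<subseteq> (!) es ` ?J"
    proof
      fix e assume e: "e \<in> W"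
      then obtain i where "i < length es" "es ! i = e" using W set in_set_conv_nth[of e es] by blast
      then show "e \<in> (!) es ` ?J" using e by (intro image_eqI[of _ _ i]) auto
    qed
  qed blast
  have card: "card {i. i < j \<and> es ! i \<notin> W} = card {h \<in> edges F - W. position es h < position es (es ! j)}"
    if "j < length es" for j
  proof -
    have "{h \<in> edges F - W. position es h < position es (es ! j)} = (!) es ` {i. i < j \<and> es ! i \<notin> W}"
    proof (intro Set.equalityI subsetI)
      fix h assume h: "h \<in> {h \<in> edges F - W. position es h < position es (es ! j)}"
      then obtain i where "i < length es" "h = es ! i" using set in_set_conv_nth[of h es] by blast
      then show "h \<in> (!) es ` {i. i < j \<and> es ! i \<notin> W}"
        using h position_nth[OF dist] that by auto
    next
      fix h assume "h \<in> (!) es ` {i. i < j \<and> es ! i \<notin> W}"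
      then obtain i where "i < j" "es ! i \<notin> W" "h = es ! i" by blast
      then show "h \<in> {h \<in> edges F - W. position es h < position es (es ! j)}"
        using position_nth[OF dist] that set nth_mem[of i es] by auto
    qed
    then show ?thesis using that by (subst card_image[OF inj, symmetric]) auto
  qed
  have "gen_diff F es x = (\<Sum>j\<in>?J. frag_cmul ((- 1) ^ card {h \<in> edges F - W. position es h < position es (es ! j)})
      (edge_map F (es ! j) x))"
    unfolding gen_diff_def x using card by (intro sum.cong) auto
  also have "\<dots> = (\<Sum>e\<in>(!) es ` ?J. frag_cmul ((- 1) ^ card {h \<in> edges F - W. position es h < position es e}) (edge_map F e x))"
    by (subst sum.reindex[OF inj]) auto
  finally show ?thesis unfolding WJ[symmetric] .
qed

text \<open>Pairs that the two orders arrange oppositely; for injective \<open>p\<close> and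
  \<open>q\<close> the parity of their number is the sign of the permutation from one order of
  \<open>A\<close> to the other.\<close>

definition inversions :: "('e \<Rightarrow> nat) \<Rightarrow> ('e \<Rightarrow> nat) \<Rightarrow> 'e set \<Rightarrow> ('e \<times> 'e) set" where
  "inversions p q A = {(h, k) \<in> A \<times> A. p h < p k \<and> q k < q h}"

text \<open>The new inversions pair \<open>e\<close> with the elements preceding it in exactly one
  of the orders. Elements preceding it in both are counted twice on the right and cancel.\<close>

lemma sign_inversions_insert:
  assumes "finite A" "e \<notin> A" "inj_on p (insert e A)" "inj_on q (insert e A)"
  shows "(- 1 :: int) ^ card (inversions p q (insert e A)) =
    (- 1) ^ card (inversions p q A) * (- 1) ^ card {h \<in> A. p h < p e} * (- 1) ^ card {h \<in> A. q h < q e}"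
proof -
  define X where "X = {h \<in> A. p h < p e \<and> \<not> q h < q e}"
  define Y where "Y = {h \<in> A. \<not> p h < p e \<and> q h < q e}"
  define Z where "Z = {h \<in> A. p h < p e \<and> q h < q e}"
  have "inversions p q A \<subseteq> A \<times> A" by (auto simp: inversions_def)
  then have fin: "finite X" "finite Y" "finite Z" "finite (inversions p q A)"
    using assms(1) finite_subset[of "inversions p q A" "A \<times> A"] by (simp_all add: X_def Y_def Z_def)
  have ne: "p h \<noteq> p e" "q h \<noteq> q e" if "h \<in> A" for h
    using that assms(2) inj_onD[OF assms(3), of h e] inj_onD[OF assms(4), of h e] by auto
  have "inversions p q (insert e A) = inversions p q A \<union> ((\<lambda>h. (h, e)) ` X \<union> (\<lambda>h. (e, h)) ` Y)"
  proof -
    have "z \<in> inversions p q (insert e A) \<longleftrightarrow> z \<in> inversions p q A \<union> ((\<lambda>h. (h, e)) ` X \<union> (\<lambda>h. (e, h)) ` Y)" for z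
    proof (cases z)
      case (Pair h k)
      have "p h < p e \<longleftrightarrow> \<not> p e < p h" "q h < q e \<longleftrightarrow> \<not> q e < q h" if "h \<in> A" for h
        using ne[OF that] by linarith+
      then show ?thesis unfolding Pair inversions_def X_def Y_def using assms(2) by (auto simp: image_iff)
    qed
    then show ?thesis by blast
  qed
  moreover have "card ((\<lambda>h. (h, e)) ` X \<union> (\<lambda>h. (e, h)) ` Y) = card X + card Y"
  proof (subst card_Un_disjoint)
    show "(\<lambda>h. (h, e)) ` X \<inter> (\<lambda>h. (e, h)) ` Y = {}" using assms(2) by (auto simp: X_def)
    show "card ((\<lambda>h. (h, e)) ` X) + card ((\<lambda>h. (e, h)) ` Y) = card X + card Y"
      by (simp add: card_image inj_on_def)
  qed (use fin in auto)
  moreover have "inversions p q A \<inter> ((\<lambda>h. (h, e)) ` X \<union> (\<lambda>h. (e, h)) ` Y) = {}"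
    using assms(2) by (auto simp: inversions_def)
  ultimately have "card (inversions p q (insert e A)) = card (inversions p q A) + (card X + card Y)"
    using fin by (simp add: card_Un_disjoint)
  moreover have "{h \<in> A. p h < p e} = X \<union> Z" "{h \<in> A. q h < q e} = Y \<union> Z" "X \<inter> Z = {}" "Y \<inter> Z = {}"
    by (auto simp: X_def Y_def Z_def)
  then have "card {h \<in> A. p h < p e} = card X + card Z" "card {h \<in> A. q h < q e} = card Y + card Z"
    using fin by (simp_all add: card_Un_disjoint)
  moreover have "(- 1 :: int) ^ (n + (x + y)) = (- 1) ^ n * (- 1) ^ (x + z) * (- 1) ^ (y + z)" for n x y z
    by (simp add: minus_one_power_iff)
  ultimately show ?thesis by (simp only:)
qed

lemma frag_extend_cmul_fun: "frag_extend (\<lambda>y. frag_cmul c (h y)) z = frag_cmul c (frag_extend h z)"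
  using frag_extend_sum_fun[of "\<lambda>_. c" "\<lambda>_. h" "{()}" z] by simp

text \<open>The numberings of the two edge sets differ by a permutation, which is absorbed by the sign of
  its restriction to the edges missing from a state.\<close>

lemma (in fatgraph_iso) bigraded_iso_chromatic_homology:
  assumes es: "edge_numbering F es" and es': "edge_numbering F' es'"
  shows "bigraded_iso (chromatic_homology F es) (chromatic_homology F' es')"
proof -
  define p where "p = position es"
  \<comment> \<open>The second numbering pulled back to the edges of \<open>F\<close>.\<close>
  define q where "q e = position es' (ge e)" for e
  define sg :: "'h set set \<Rightarrow> int" where "sg W = (- 1) ^ card (inversions p q (edges F - W))" for W
  have inj_p: "inj_on p (edges F)"
    using inj_position[of es] es by (simp add: edge_numbering_def p_def)
  have inj_q: "inj_on q (edges F)"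
  proof -
    have "inj_on (position es') (ge ` edges F)"
      using inj_position[of es'] es' by (simp add: edge_numbering_def ge_edges)
    from comp_inj_on[OF inj_ge this] show ?thesis by (simp add: comp_def q_def[abs_def])
  qed
  \<comment> \<open>Deleting \<open>e\<close> adds it to the missing edges, and the sign changes by
    the product of the signs that the two differentials give to this deletion.\<close>
  have sg: "sg (W - {e}) = sg W * (- 1) ^ card {h \<in> edges F - W. p h < p e} * (- 1) ^ card {h \<in> edges F - W. q h < q e}"
    if W: "W \<subseteq> edges F" and e: "e \<in> W" for W e
  proof -
    have eq: "edges F - (W - {e}) = insert e (edges F - W)" using W e by blast
    have "insert e (edges F - W) \<subseteq> edges F" using W e by blast
    then show ?thesis unfolding sg_def eq using A.finite_edges e inj_p inj_q
      by (intro sign_inversions_insert inj_on_subset[OF inj_p] inj_on_subset[OF inj_q]) auto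
  qed
  have comm: "frag_extend (\<lambda>x. frag_cmul (sg (state_edges x)) (frag_of (relabel x))) (gen_diff F es x) =
      frag_cmul (sg (state_edges x)) (gen_diff F' es' (relabel x))" if xij: "x \<in> chain_gens F i j" for x i j
  proof -
    obtain W where W: "W \<subseteq> edges F" "x \<in> state_gens F W" using xij unfolding A.chain_gens_alt by blast
    have x: "state_edges x = W" using A.state_gens_edges[OF W(2)] .
    then have x': "state_edges (relabel x) = gw W" by (cases x) simp
    have finW: "finite W" using W(1) A.finite_edges finite_subset by blast
    have edge: "frag_extend (\<lambda>x. frag_cmul (sg (state_edges x)) (frag_of (relabel x))) (edge_map F e x) =
        frag_cmul (sg (W - {e})) (edge_map F' (ge e) (relabel x))" if e: "e \<in> W" for e
    proof -
      have "frag_extend (\<lambda>x. frag_cmul (sg (state_edges x)) (frag_of (relabel x))) (edge_map F e x) =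
          frag_extend (\<lambda>x. frag_cmul (sg (W - {e})) (frag_of (relabel x))) (edge_map F e x)"
      proof (rule frag_extend_eq)
        fix y assume "y \<in> Poly_Mapping.keys (edge_map F e x)"
        then have "state_edges y = W - {e}"
          using A.keys_edge_map(1)[OF W(1) e W(2)] A.state_gens_edges by blast
        then show "frag_cmul (sg (state_edges y)) (frag_of (relabel y)) = frag_cmul (sg (W - {e})) (frag_of (relabel y))"
          by simp
      qed
      then show ?thesis by (simp add: frag_extend_cmul_fun edge_map_relabel[OF W(1) e x])
    qed
    have q: "card {h \<in> edges F' - gw W. position es' h < position es' (ge e)} = card {h \<in> edges F - W. q h < q e}" for e
    proof -
      have "edges F' - gw W = gw (edges F - W)"
        unfolding ge_edges[symmetric] using inj_on_image_set_diff[OF inj_ge, of "edges F" W] W(1) by auto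
      then have "{h \<in> edges F' - gw W. position es' h < position es' (ge e)} = gw {h \<in> edges F - W. q h < q e}"
        by (auto simp: q_def)
      then show ?thesis by (simp only:) (intro gw_card; blast)
    qed
    have "frag_extend (\<lambda>x. frag_cmul (sg (state_edges x)) (frag_of (relabel x))) (gen_diff F es x) =
        (\<Sum>e\<in>W. frag_cmul ((- 1) ^ card {h \<in> edges F - W. p h < p e} * sg (W - {e})) (edge_map F' (ge e) (relabel x)))"
      unfolding A.gen_diff_position[OF es W(1) x] p_def[symmetric] frag_extend_sum[OF finW]
      by (intro sum.cong refl) (simp add: frag_extend_cmul edge)
    \<comment> \<open>The sign from the first numbering now occurs twice and cancels.\<close>
    also have "\<dots> = (\<Sum>e\<in>W. frag_cmul (sg W * (- 1) ^ card {h \<in> edges F - W. q h < q e}) (edge_map F' (ge e) (relabel x)))"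
    proof (intro sum.cong refl arg_cong2[where f = frag_cmul])
      fix e assume "e \<in> W"
      have "(- 1) ^ n * (w * (- 1) ^ n * b) = w * b" for n and w b :: int
        by (simp add: minus_one_power_iff)
      then show "(- 1) ^ card {h \<in> edges F - W. p h < p e} * sg (W - {e}) =
          sg W * (- 1) ^ card {h \<in> edges F - W. q h < q e}"
        unfolding sg[OF W(1) \<open>e \<in> W\<close>] .
    qed
    also have "\<dots> = frag_cmul (sg W) (\<Sum>e'\<in>gw W. frag_cmul ((- 1) ^ card {h \<in> edges F' - gw W. position es' h < position es' e'})
        (edge_map F' e' (relabel x)))"
      unfolding sum.reindex[OF inj_on_subset[OF inj_ge W(1)]] comp_apply q frag_cmul_sum frag_cmul_cmul ..
    also have "\<dots> = frag_cmul (sg W) (gen_diff F' es' (relabel x))"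
      unfolding B.gen_diff_position[OF es' gw_sub[OF W(1)] x'] ..
    finally show ?thesis unfolding x .
  qed
  have "sg W = 1 \<or> sg W = - 1" for W by (simp add: sg_def minus_one_power_iff)
  from homology_iso[OF A.chromatic_free_cochain_complex[OF es] B.chromatic_free_cochain_complex[OF es']
      bij_relabel this comm]
  show ?thesis unfolding chromatic_complex_free .
qed

lemma bigraded_iso_of_fatgraph_isomorphic:
  assumes "fatgraph F" "edge_numbering F es" "fatgraph F'" "edge_numbering F' es'" "fatgraph_isomorphic F F'"
  shows "bigraded_iso (chromatic_homology F es) (chromatic_homology F' es')"
proof -
  obtain f g where "fatgraph_iso F F' f g"
    using assms unfolding fatgraph_isomorphic_def fatgraph_iso_def fatgraph_iso_axioms_def by blast
  then show ?thesis using assms(2,4) by (rule fatgraph_iso.bigraded_iso_chromatic_homology)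
qed


theorem theorem3p2:
  fixes F :: "('v, 'h) fatgraph" and F' :: "('w, 'k) fatgraph"
    and es :: "'h set list" and es' :: "'k set list"
  assumes "fatgraph F" and "edge_numbering F es"
    and "fatgraph F'" and "edge_numbering F' es'"
  shows "euler_characteristic (chromatic_homology F es) =
           (q_var + q_inv) ^ e_num F *
           poly (map_poly of_int (chromatic_polynomial (underlying_graph F)))
             ((q_var + q_inv) ^ 2)
         \<and> (fatgraph_isomorphic F F' \<longrightarrow>
             bigraded_iso (chromatic_homology F es) (chromatic_homology F' es'))
         \<and> (bigraded_iso (chromatic_homology F es) (chromatic_homology F' es') \<longrightarrow>
             chromatic_polynomial (underlying_graph F) =
               chromatic_polynomial (underlying_graph F'))
         \<and> (\<exists>(F1 :: (nat, nat) fatgraph) es1 (F2 :: (nat, nat) fatgraph) es2.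
             fatgraph F1 \<and> edge_numbering F1 es1 \<and> fatgraph F2 \<and> edge_numbering F2 es2 \<and>
             chromatic_polynomial (underlying_graph F1) =
               chromatic_polynomial (underlying_graph F2) \<and>
             \<not> bigraded_iso (chromatic_homology F1 es1) (chromatic_homology F2 es2))"
  using fatgraph.euler_characteristic_chromatic[OF assms(1,2)]
    bigraded_iso_of_fatgraph_isomorphic[OF assms] bigraded_iso_chromatic_polynomial[OF assms]
    homology_distinguishes
  by blast

end
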